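(* Let $\beta>0$ and let $V\in\mathbb R^{d\times d}$ be symmetric and negative definite, with orthonormal eigenbasis $(e_k)_{k=1}^d$ and eigenvalues $0>\lambda_1\ge\lambda_2\ge\dots\ge\lambda_d$, where the smallest eigenvalue $\lambda_d$ is simple. Consider the two-particle system on $\mathbb S^{d-1}\times\mathbb S^{d-1}$ \[ \dot x_i=P^\perp_{x_i}\Big(\frac1{Z_i}\sum_{j=1}^2 e^{\beta\langle x_i,Vx_j\rangle}Vx_j\Big),\qquad Z_i=\sum_{k=1}^2 e^{\beta\langle x_i,Vx_k\rangle},\quad i=1,2. \] Then for almost every initial datum $(x_1(0),x_2(0))\in\mathbb S^{d-1}\times\mathbb S^{d-1}$ there exists $\sigma\in\{\pm1\}$ such that $(x_1(t),x_2(t))\to(\sigma e_d,-\sigma e_d)$ as $t\to\infty$.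
   Context: $P^\perp_xy=y-\langle x,y\rangle x$ denotes the orthogonal projection onto $T_x\mathbb S^{d-1}$. "Almost every" is with respect to the standard (Riemannian volume) measure on $\mathbb S^{d-1}\times\mathbb S^{d-1}$.
   Formalization: The dimension is assumed to satisfy d ≥ 2; for d = 1 the sphere is two points of positive measure, the dynamics is stationary, and the initial datum (1,1) does not converge to (σe_1, −σe_1), so the claim fails there. *)

theory Defs
  imports "HOL-Analysis.Analysis"
begin

definition Pperp :: "'a::real_inner \<Rightarrow> 'a \<Rightarrow> 'a" where
  "Pperp x y = y - (x \<bullet> y) *\<^sub>R x"

text \<open>Right-hand side for particle x_i = x, with the other particle y
  (sum over j = 1,2 of the two particles; order of summation irrelevant).\<close>
definition attn_field :: "real \<Rightarrow> real^'n^'n \<Rightarrow> real^'n \<Rightarrow> real^'n \<Rightarrow> real^'n" where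
  "attn_field \<beta> V x y =
     (let Z = exp (\<beta> * (x \<bullet> (V *v x))) + exp (\<beta> * (x \<bullet> (V *v y)))
      in Pperp x ((1 / Z) *\<^sub>R (exp (\<beta> * (x \<bullet> (V *v x))) *\<^sub>R (V *v x)
                              + exp (\<beta> * (x \<bullet> (V *v y))) *\<^sub>R (V *v y))))"

text \<open>Surface (Riemannian volume) measure on the unit sphere, defined as the
  cone measure: sigma(A) = DIM * lebesgue measure of {r x. 0 < r <= 1, x in A}.\<close>
definition sphere_measure :: "('a::euclidean_space) measure" where
  "sphere_measure =
     scale_measure (of_nat DIM('a))
       (distr (restrict_space lborel (cball 0 1 - {0})) (restrict_space borel (sphere 0 1))
              (\<lambda>x. x /\<^sub>R norm x))"

end

theory Submission
  imports Defs
begin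

text \<open>
  Idea. The energy \<open>E = exp (\<beta> \<langle>x,Vx\<rangle>) + 2 exp (\<beta> \<langle>x,Vy\<rangle>) + exp (\<beta> \<langle>y,Vy\<rangle>)\<close>
  increases along solutions, so both velocities tend to zero, and the only equilibria are
  \<open>(x, \<plusminus>x)\<close> with an eigenvector \<open>x\<close>. The diagonal repels: \<open>1 - \<langle>x,y\<rangle>\<close> grows exponentially
  near \<open>(x, x)\<close>. Hence a solution starting off the diagonal either converges to
  \<open>(\<plusminus>e\<^sub>d, \<mp>e\<^sub>d)\<close> or remains from some time on near the antipodal pairs \<open>(x, -x)\<close> of an
  eigenvalue different from \<open>\<lambda>\<^sub>d\<close>. Near such pairs the direction \<open>(e\<^sub>d, -e\<^sub>d)\<close> is the one of
  fastest expansion, and it does not depend on the pair. A cone around it is therefore invariant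
  for differences of two trapped solutions, and such differences expand although the
  \<open>e\<^sub>d\<close>-coordinates stay small. So the trapped set meets each line in direction \<open>(e\<^sub>d, 0)\<close> at most
  once, and is a null set because its translates along that direction are disjoint; no stable
  manifold theorem and no convergence to a single equilibrium is needed. The
  initial data that become trapped later are its images under the backward flow, which is
  Lipschitz.
\<close>

section \<open>Differential inequalities and global solutions\<close>

text \<open>Multiple eigenvalues make the equilibria form continua, so vanishing velocities alone do
  not give convergence of a trajectory. What does converge are scalar quantities with finitely many
  values at equilibria: the overlap \<open>x \<bullet> y\<close> and the form
  \<open>x \<bullet> (V *v x)\<close>. For the difference of two solutions near antipodal eigenpairs
  of eigenvalue -m, let \<sigma> and \<tau> be the difference and the sum of its two components. The
  linear part decouples: \<sigma> evolves by -\<omega>(V + m) and \<tau> by V - \<omega>m, with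
  \<omega> > 0. So \<tau> contracts, while \<sigma> grows at rate \<omega>(\<mu> - m) along
  \<open>ed\<close> and at most at rate \<omega>(\<mu>2 - m) across it; the gap between these rates
  absorbs the nonlinear error. Lines in direction \<open>(ed, 0)\<close> fit the cone although its
  axis is \<open>(ed, -ed)\<close>: moving only the first particle gives \<sigma> = \<tau>, which is
  still inside. Straight lines leave the sphere, so null sets are handled through the cones over
  them, in accordance with the definition of \<open>sphere_measure\<close>.\<close>

lemma exponential_upper_bound:
  fixes g g' :: "real \<Rightarrow> real"
  assumes der: "\<And>t. t \<in> {0..T} \<Longrightarrow> (g has_real_derivative g' t) (at t within {0..T})"
    and le: "\<And>t. t \<in> {0..T} \<Longrightarrow> g' t \<le> c * g t" and T: "0 \<le> T"
  shows "g T \<le> g 0 * exp (c * T)"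
proof -
  define k where "k t = g t * exp (- c * t)" for t
  have dk: "(k has_real_derivative (g' t - c * g t) * exp (- c * t)) (at t within {0..T})"
    if "t \<in> {0..T}" for t
    unfolding k_def
    by (rule derivative_eq_intros der that refl | simp add: algebra_simps)+
  have "k T \<le> k 0"
  proof (rule DERIV_nonpos_imp_decreasing_open[OF T])
    show "\<exists>y. (k has_real_derivative y) (at x) \<and> y \<le> 0" if "0 < x" "x < T" for x
    proof (intro exI conjI)
      show "(k has_real_derivative (g' x - c * g x) * exp (- c * x)) (at x)"
        using dk[of x] that at_within_Icc_at[of 0 x T] by auto
      show "(g' x - c * g x) * exp (- c * x) \<le> 0"
        using le[of x] that by (intro mult_nonpos_nonneg) auto
    qed
    show "continuous_on {0..T} k"
      using dk by (meson DERIV_continuous continuous_on_eq_continuous_within)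
  qed
  then have "g T * exp (- c * T) * exp (c * T) \<le> g 0 * exp (c * T)"
    by (intro mult_right_mono) (auto simp: k_def)
  then show ?thesis by (simp add: mult.assoc exp_minus_inverse flip: exp_add)
qed

lemma exponential_lower_bound:
  fixes g g' :: "real \<Rightarrow> real"
  assumes der: "\<And>t. t \<in> {0..T} \<Longrightarrow> (g has_real_derivative g' t) (at t within {0..T})"
    and ge: "\<And>t. t \<in> {0..T} \<Longrightarrow> g' t \<ge> c * g t" and T: "0 \<le> T"
  shows "g T \<ge> g 0 * exp (c * T)"
  using exponential_upper_bound[of T "\<lambda>t. - g t" "\<lambda>t. - g' t" c] assms
  by (auto intro!: derivative_eq_intros)

text \<open>The differential inequality is available only while \<open>h\<close> is positive, so
  positivity must be propagated together with the bound. Up to the first time at which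
  \<open>h t * exp (- c * t)\<close> has dropped to a positive level below its initial value, the
  inequality has held throughout, and this forbids the drop.\<close>

lemma exponential_growth_while_positive:
  fixes h h' :: "real \<Rightarrow> real"
  assumes der: "\<And>t. t \<ge> 0 \<Longrightarrow> (h has_real_derivative h' t) (at t within {0..})"
    and ge: "\<And>t. t \<ge> 0 \<Longrightarrow> h t > 0 \<Longrightarrow> h' t \<ge> c * h t"
    and h0: "h 0 > 0" and t: "t \<ge> 0"
  shows "h t \<ge> h 0 * exp (c * t)"
proof (rule ccontr)
  assume less: "\<not> h t \<ge> h 0 * exp (c * t)"
  define k where "k s = h s * exp (- c * s)" for s
  have der': "(h has_real_derivative h' s) (at s within {0..S})" if "s \<in> {0..S}" for s S
    by (rule has_field_derivative_subset[OF der]) (use that in auto)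
  have conth: "continuous_on {0..S} h" for S
    using der' by (meson DERIV_continuous continuous_on_eq_continuous_within)
  have contk: "continuous_on {0..S} k" for S
    unfolding k_def by (intro continuous_intros conth)
  have kt: "k t < k 0"
  proof -
    have "h t * exp (- c * t) < h 0 * exp (c * t) * exp (- c * t)"
      using less by (intro mult_strict_right_mono) auto
    then show ?thesis by (simp add: k_def mult.assoc flip: exp_add)
  qed
  \<comment> \<open>The level is positive, so \<open>h\<close> is positive above it, and lies below
    \<open>k 0\<close>, so reaching it contradicts growth.\<close>
  define v where "v = (max 0 (k t) + k 0) / 2"
  have v: "0 < v" "v < k 0" "k t < v" using kt h0 unfolding v_def k_def by auto
  define C where "C = {s \<in> {0..t}. k s \<in> {..v}}"
  have C_eq: "C = {0..t} \<inter> k -` {..v}" by (auto simp: C_def)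
  have "closed C" unfolding C_eq
    by (rule continuous_closed_preimage[OF contk]) auto
  moreover have "bounded C" unfolding C_eq by (rule bounded_subset[of "{0..t}"]) auto
  ultimately have "compact C" by (simp add: compact_eq_bounded_closed)
  moreover have "t \<in> C" using t v by (auto simp: C_def)
  ultimately obtain s where s: "s \<in> C" "\<And>r. r \<in> C \<Longrightarrow> s \<le> r"
    using compact_attains_inf by (metis empty_iff)
  \<comment> \<open>Before \<open>s\<close> this is the minimality of \<open>s\<close>; at
    \<open>s\<close> itself, a value below \<open>v\<close> would produce an earlier crossing by the
    intermediate value theorem.\<close>
  have pos: "k r \<ge> v" if "r \<in> {0..s}" for r
  proof (rule ccontr)
    assume "\<not> k r \<ge> v"
    then have "r \<in> C" using that s(1) by (auto simp: C_def)
    then have "r = s" using s that by force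
    have "\<exists>q. 0 \<le> q \<and> q \<le> s \<and> k q = v"
      by (rule IVT2') (use \<open>\<not> k r \<ge> v\<close> \<open>r = s\<close> v contk that in auto)
    then obtain q where q: "0 \<le> q" "q \<le> s" "k q = v" by blast
    then have "q \<in> C" using s(1) by (auto simp: C_def)
    then have "q = s" using s q by force
    then show False using \<open>\<not> k r \<ge> v\<close> \<open>r = s\<close> q by simp
  qed
  have hpos: "h r > 0" if "r \<in> {0..s}" for r
    using pos[OF that] v by (simp add: k_def) (smt (verit) exp_gt_zero mult_nonpos_nonneg)
  have "h s \<ge> h 0 * exp (c * s)"
    by (rule exponential_lower_bound[of s h h' c]) (use der' ge hpos s(1) in \<open>auto simp: C_def\<close>)
  then have "h s * exp (- c * s) \<ge> h 0 * exp (c * s) * exp (- c * s)"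
    by (intro mult_right_mono) auto
  then have "k s \<ge> k 0" by (simp add: k_def mult.assoc flip: exp_add)
  then show False using s(1) v by (simp add: C_def)
qed

lemma has_real_derivative_inner:
  fixes f g :: "real \<Rightarrow> 'a::real_inner"
  assumes "(f has_vector_derivative f') (at t within S)" "(g has_vector_derivative g') (at t within S)"
  shows "((\<lambda>t. f t \<bullet> g t) has_real_derivative (f t \<bullet> g' + f' \<bullet> g t)) (at t within S)"
  using bounded_bilinear.has_vector_derivative[OF bounded_bilinear_inner assms]
  by (simp add: has_real_derivative_iff_has_vector_derivative)

text \<open>Gronwall for the squared distance, which is differentiable even where the solutions
  meet; hence the rate \<open>2 * L\<close>. The compact time interval lets it apply to trajectories
  run backwards from time \<open>T\<close>.\<close>

lemma lipschitz_flow_distance: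
  fixes F :: "'a::real_inner \<Rightarrow> 'a"
  assumes x: "\<And>t. t \<in> {0..T} \<Longrightarrow> (x has_vector_derivative F (x t)) (at t within {0..T})"
    and y: "\<And>t. t \<in> {0..T} \<Longrightarrow> (y has_vector_derivative F (y t)) (at t within {0..T})"
    and L: "\<And>u v. norm (F u - F v) \<le> L * norm (u - v)" and T: "0 \<le> T"
  shows "norm (x T - y T) \<le> norm (x 0 - y 0) * exp (L * T)"
proof -
  define g where "g t = (x t - y t) \<bullet> (x t - y t)" for t
  have "g T \<le> g 0 * exp ((2 * L) * T)"
  proof (rule exponential_upper_bound[OF _ _ T])
    show "(g has_real_derivative 2 * ((x t - y t) \<bullet> (F (x t) - F (y t)))) (at t within {0..T})"
      if "t \<in> {0..T}" for t
      unfolding g_def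
      using has_real_derivative_inner[OF has_vector_derivative_diff[OF x y] has_vector_derivative_diff[OF x y]] that
      by (simp add: inner_commute)
    show "2 * ((x t - y t) \<bullet> (F (x t) - F (y t))) \<le> 2 * L * g t" for t
    proof -
      have "(x t - y t) \<bullet> (F (x t) - F (y t)) \<le> norm (x t - y t) * (L * norm (x t - y t))"
        by (rule order_trans[OF norm_cauchy_schwarz mult_left_mono[OF L]]) simp
      also have "\<dots> = L * g t"
        by (simp add: g_def power2_norm_eq_inner[symmetric] power2_eq_square)
      finally show ?thesis by simp
    qed
  qed
  then have "(norm (x T - y T))\<^sup>2 \<le> (norm (x 0 - y 0) * exp (L * T))\<^sup>2"
    by (simp add: g_def power2_norm_eq_inner power_mult_distrib mult.assoc flip: exp_double)
  then show ?thesis by (rule power2_le_imp_le) simp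
qed

text \<open>The weight \<open>exp (- 2 * L * t)\<close> makes the Picard operator a contraction
  on the whole half-line, so that no gluing of local solutions is needed.\<close>

lemma global_lipschitz_ode_solution:
  fixes F :: "'a::euclidean_space \<Rightarrow> 'a"
  assumes L: "\<And>u v. norm (F u - F v) \<le> L * norm (u - v)" and Lpos: "L > 0"
  shows "\<exists>x. x 0 = z \<and> (\<forall>t\<ge>0. (x has_vector_derivative F (x t)) (at t within {0..}))"
proof -
  have contF: "continuous_on UNIV F"
  proof -
    have "L-lipschitz_on UNIV F"
      using L Lpos by (intro lipschitz_onI) (auto simp: dist_norm)
    then show ?thesis by (rule lipschitz_on_continuous_on)
  qed
  \<comment> \<open>The unknown \<open>u\<close> is the rescaled displacement: the solution sought
    is \<open>x s = z + exp (2 * L * s) *\<^sub>R u s\<close>, with \<open>u\<close> in the Banach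
    space of bounded continuous functions.\<close>
  define G where "G u s = F (z + exp (2 * L * s) *\<^sub>R apply_bcontfun u s)" for u :: "real \<Rightarrow>\<^sub>C 'a" and s
  have contG: "continuous_on S (G u)" for u S
    unfolding G_def
    by (intro continuous_on_compose2[OF contF] continuous_intros continuous_on_apply_bcontfun) auto
  have intG: "(G u) integrable_on {0..t}" for u t
    by (intro integrable_continuous_interval contG)
  have int_exp: "((\<lambda>s. L * exp (2 * L * s)) has_integral (exp (2 * L * t) / 2 - 1 / 2)) {0..t}" if "t \<ge> 0" for t
  proof -
    have "((\<lambda>s. exp (2 * L * s) / 2) has_vector_derivative L * exp (2 * L * s)) (at s within {0..t})" for s
      unfolding has_real_derivative_iff_has_vector_derivative[symmetric]
      by (auto intro!: derivative_eq_intros)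
    from fundamental_theorem_of_calculus[OF that this] show ?thesis by simp
  qed
  \<comment> \<open>Bounded continuous functions live on the whole real line; \<open>max 0 t\<close>
    makes the operator constant at negative times.\<close>
  define P where "P u t = exp (- 2 * L * max 0 t) *\<^sub>R integral {0..max 0 t} (G u)" for u t
  have diffP: "norm (P u t - P v t) \<le> dist u v / 2" for u v t
  proof -
    define s where "s = max 0 t"
    have s: "s \<ge> 0" by (simp add: s_def)
    have "norm (integral {0..s} (G u) - integral {0..s} (G v)) = norm (integral {0..s} (\<lambda>r. G u r - G v r))"
      by (simp add: integral_diff intG)
    also have "\<dots> \<le> integral {0..s} (\<lambda>r. L * exp (2 * L * r) * dist u v)"
    proof (rule integral_norm_bound_integral)
      show "(\<lambda>r. G u r - G v r) integrable_on {0..s}" by (intro integrable_diff intG)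
      show "(\<lambda>r. L * exp (2 * L * r) * dist u v) integrable_on {0..s}"
        by (intro integrable_continuous_interval continuous_intros)
      show "norm (G u r - G v r) \<le> L * exp (2 * L * r) * dist u v" for r
      proof -
        have "norm (G u r - G v r) \<le> L * norm (exp (2 * L * r) *\<^sub>R (apply_bcontfun u r - apply_bcontfun v r))"
          unfolding G_def by (rule order_trans[OF L]) (simp add: algebra_simps)
        also have "\<dots> = L * (exp (2 * L * r) * dist (apply_bcontfun u r) (apply_bcontfun v r))"
          by (simp add: dist_norm)
        also have "\<dots> \<le> L * (exp (2 * L * r) * dist u v)"
          using Lpos by (intro mult_left_mono dist_bounded) auto
        finally show ?thesis by (simp add: mult.assoc)
      qed
    qed
    also have "\<dots> = (exp (2 * L * s) / 2 - 1 / 2) * dist u v"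
      by (rule integral_unique[OF has_integral_mult_left[OF int_exp[OF s]]])
    also have "\<dots> \<le> exp (2 * L * s) / 2 * dist u v"
      by (intro mult_right_mono) auto
    finally have "exp (- 2 * L * s) * norm (integral {0..s} (G u) - integral {0..s} (G v))
        \<le> exp (- 2 * L * s) * (exp (2 * L * s) / 2 * dist u v)"
      by (intro mult_left_mono) auto
    also have "\<dots> = dist u v / 2" by (simp add: exp_minus field_simps)
    finally show ?thesis
      unfolding P_def s_def[symmetric] by (simp flip: scaleR_diff_right)
  qed
  have contP: "continuous_on UNIV (P u)" for u
  proof -
    have "isCont (\<lambda>t. integral {0..max 0 t} (G u)) t" for t
    proof -
      have "continuous_on {0..max 0 t + 1} (\<lambda>s. integral {0..s} (G u))"
        by (rule indefinite_integral_continuous_1[OF intG])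
      then have "continuous_on {..t + 1} (\<lambda>s. integral {0..max 0 s} (G u))"
        by (rule continuous_on_compose2) (auto intro!: continuous_intros)
      then show ?thesis
        by (rule continuous_on_interior) auto
    qed
    then have "continuous_on UNIV (\<lambda>t. integral {0..max 0 t} (G u))"
      by (simp add: continuous_on_eq_continuous_at)
    then show ?thesis unfolding P_def by (intro continuous_intros)
  qed
  \<comment> \<open>The weight beats the linear growth of the integral of a constant, so
    \<open>P 0\<close> is bounded; \<open>diffP\<close> then bounds \<open>P u\<close> for every
    \<open>u\<close>.\<close>
  have bndP0: "norm (P 0 t) \<le> norm (F z) / (2 * L)" for t
  proof -
    define s where "s = max 0 t"
    have s: "s \<ge> 0" by (simp add: s_def)
    have "integral {0..s} (G 0) = s *\<^sub>R F z"
      using s by (simp add: G_def[abs_def])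
    then have "norm (P 0 t) = exp (- 2 * L * s) * s * norm (F z)"
      using s unfolding P_def s_def[symmetric] by simp
    moreover have "exp (- 2 * L * s) * s \<le> 1 / (2 * L)"
    proof -
      have "2 * L * s \<le> exp (2 * L * s)" using exp_ge_add_one_self[of "2 * L * s"] by linarith
      then show ?thesis using Lpos by (simp add: exp_minus field_simps)
    qed
    ultimately show ?thesis
      by (metis mult_right_mono norm_ge_zero times_divide_eq_left mult_1)
  qed
  have bcP: "P u \<in> bcontfun" for u
  proof -
    have "norm (P u t) \<le> norm (F z) / (2 * L) + dist u 0 / 2" for t
      using norm_triangle_ineq[of "P 0 t" "P u t - P 0 t"] bndP0[of t] diffP[of u t 0] by simp
    then have "bounded (range (P u))" by (auto simp: bounded_iff)
    then show ?thesis using contP by (auto simp: bcontfun_def)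
  qed
  have "\<exists>!u. Bcontfun (P u) = u"
  proof (rule banach_fix_type[of "1/2"])
    show "\<forall>u v. dist (Bcontfun (P u)) (Bcontfun (P v)) \<le> 1 / 2 * dist u v"
    proof (intro allI dist_bound)
      show "dist (apply_bcontfun (Bcontfun (P u)) t) (apply_bcontfun (Bcontfun (P v)) t) \<le> 1 / 2 * dist u v"
        for u v t
        using diffP[of u t v] by (simp add: Bcontfun_inverse[OF bcP] dist_norm[of "P u t"])
    qed
  qed auto
  then obtain u where u: "Bcontfun (P u) = u" by blast
  then have uP: "apply_bcontfun u t = P u t" for t
    using Bcontfun_inverse[OF bcP[of u]] by simp
  define x where "x t = z + integral {0..t} (G u)" for t
  have xG: "G u t = F (x t)" if "t \<ge> 0" for t
    using that by (simp add: G_def uP P_def x_def max_def flip: exp_add)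
  have "(x has_vector_derivative F (x t)) (at t within {0..})" if "t \<ge> 0" for t
  proof -
    have "((\<lambda>s. integral {0..s} (G u)) has_vector_derivative G u t) (at t within {0..t+1})"
      by (rule integral_has_vector_derivative) (use that contG in auto)
    then have "(x has_vector_derivative F (x t)) (at t within {0..t+1})"
      unfolding x_def using xG[OF that] by (auto simp: x_def intro!: derivative_eq_intros)
    moreover have "at t within {0..t+1} = at t within {0..}"
      by (rule at_within_nhd[of t "{..<t+1}"]) (use that in auto)
    ultimately show ?thesis by simp
  qed
  moreover have "x 0 = z" by (simp add: x_def)
  ultimately show ?thesis by blast
qed

section \<open>Long-time limits: Barbalat's lemma, finite target sets, compactness\<close>

text \<open>A late value \<open>g t \<ge> e\<close> persists as \<open>e / 2\<close> for a fixed
  length of time, and the resulting increase exceeds what a bounded nondecreasing \<open>f\<close>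
  has left. Only a minorant \<open>g\<close> of \<open>f'\<close> has to be Lipschitz; in the
  application it is a multiple of the squared speed.\<close>

lemma barbalat_lipschitz:
  fixes f f' g :: "real \<Rightarrow> real"
  assumes der: "\<And>t. t \<ge> 0 \<Longrightarrow> (f has_real_derivative f' t) (at t within {0..})"
    and ge: "\<And>t. t \<ge> 0 \<Longrightarrow> f' t \<ge> g t" and g0: "\<And>t. t \<ge> 0 \<Longrightarrow> g t \<ge> 0"
    and lip: "\<And>s t. s \<ge> 0 \<Longrightarrow> t \<ge> 0 \<Longrightarrow> \<bar>g s - g t\<bar> \<le> L * \<bar>s - t\<bar>"
    and bnd: "\<And>t. t \<ge> 0 \<Longrightarrow> f t \<le> M"
  shows "(g \<longlongrightarrow> 0) at_top"
proof -
  have incr: "\<exists>\<xi>. s < \<xi> \<and> \<xi> < t \<and> f t - f s = (t - s) * f' \<xi>" if "0 \<le> s" "s < t" for s t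
  proof -
    have "\<exists>\<xi>\<in>{s<..<t}. f t - f s = (\<lambda>h. h * f' \<xi>) (t - s)"
    proof (rule mvt_simple[OF \<open>s < t\<close>])
      fix r assume "s \<le> r" "r \<le> t"
      then show "(f has_derivative (\<lambda>h. h * f' r)) (at r within {s..t})"
        using has_field_derivative_subset[OF der[of r], of "{s..t}"] that
        by (auto simp: has_field_derivative_def mult_commute_abs)
    qed
    then show ?thesis by auto
  qed
  have mono: "f s \<le> f t" if st: "0 \<le> s" "s \<le> t" for s t
  proof (cases "s = t")
    case False
    then obtain \<xi> where "s < \<xi>" "f t - f s = (t - s) * f' \<xi>" using incr[of s t] st by auto
    then show ?thesis using ge[of \<xi>] g0[of \<xi>] that
      by (smt (verit) mult_nonneg_nonneg)
  qed auto
  define S where "S = (SUP t\<in>{0..}. f t)"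
  have bdd: "bdd_above (f ` {0..})" using bnd by (auto intro!: bdd_aboveI2[of _ _ M])
  have fS: "f t \<le> S" if "t \<ge> 0" for t unfolding S_def using that by (intro cSUP_upper bdd) auto
  define L' where "L' = max L 1"
  have L'pos: "L' > 0" by (simp add: L'_def)
  have L'lip: "\<bar>g s - g t\<bar> \<le> L' * \<bar>s - t\<bar>" if "s \<ge> 0" "t \<ge> 0" for s t
    using lip[OF that] mult_right_mono[of L L' "\<bar>s - t\<bar>"] by (simp add: L'_def)
  show ?thesis
  proof (rule tendstoI)
    fix e :: real assume e: "e > 0"
    define \<delta> where "\<delta> = e / (2 * L')"
    have \<delta>: "\<delta> > 0" using e L'pos by (simp add: \<delta>_def)
    have "S - \<delta> * (e / 2) < S" using \<delta> e by simp
    then obtain T where T: "T \<ge> 0" "f T > S - \<delta> * (e / 2)"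
      using less_cSUP_iff[OF _ bdd, of "S - \<delta> * (e / 2)"] unfolding S_def[symmetric] by auto
    have "g t < e" if t: "t \<ge> T" for t
    proof (rule ccontr)
      assume "\<not> g t < e"
      obtain \<xi> where \<xi>: "t < \<xi>" "\<xi> < t + \<delta>" "f (t + \<delta>) - f t = \<delta> * f' \<xi>"
        using incr[of t "t + \<delta>"] T t \<delta> by auto
      have "\<bar>g t - g \<xi>\<bar> \<le> L' * \<bar>t - \<xi>\<bar>" by (rule L'lip) (use T t \<xi> in auto)
      also have "\<dots> \<le> L' * \<delta>" using \<xi> L'pos by (intro mult_left_mono) auto
      also have "\<dots> = e / 2" using L'pos by (simp add: \<delta>_def)
      finally have "g \<xi> \<ge> e / 2" using \<open>\<not> g t < e\<close> by linarith
      then have "f' \<xi> \<ge> e / 2" using ge[of \<xi>] T t \<xi> by force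
      then have "f (t + \<delta>) - f t \<ge> \<delta> * (e / 2)" using \<xi> \<delta> by (simp add: mult_left_mono)
      then show False using mono[of T t] T t fS[of "t + \<delta>"] \<delta> by linarith
    qed
    then show "eventually (\<lambda>t. dist (g t) 0 < e) at_top"
      using T g0 by (intro eventually_at_top_linorderI[of T]) auto
  qed
qed

text \<open>A continuous path close to a finite set cannot switch between its points: it would have
  to pass at distance exactly \<open>r\<close> from the present one, where every point of the set is
  at distance at least \<open>r\<close>.\<close>

lemma tendsto_of_infdist_finite:
  fixes h :: "real \<Rightarrow> real"
  assumes cont: "continuous_on {0..} h" and fin: "finite F" and ne: "F \<noteq> {}"
    and lim: "((\<lambda>t. infdist (h t) F) \<longlongrightarrow> 0) at_top"
  shows "\<exists>l\<in>F. (h \<longlongrightarrow> l) at_top"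
proof -
  obtain r where r: "r > 0" "\<And>k l. k \<in> F \<Longrightarrow> l \<in> F \<Longrightarrow> k \<noteq> l \<Longrightarrow> dist k l > 3 * r"
  proof -
    obtain s where "s > 0" "\<And>k l. k \<in> F \<Longrightarrow> l \<in> F \<Longrightarrow> k \<noteq> l \<Longrightarrow> dist k l \<ge> s"
    proof (cases "\<exists>k\<in>F. \<exists>l\<in>F. k \<noteq> l")
      case True
      define D where "D = (\<lambda>(k,l). dist k l) ` {(k,l) \<in> F \<times> F. k \<noteq> l}"
      have fD: "finite D" unfolding D_def using fin
        by (intro finite_imageI finite_subset[OF _ finite_cartesian_product[OF fin fin]]) auto
      have "D \<noteq> {}" using True by (auto simp: D_def)
      show ?thesis
      proof (rule that[of "Min D"])
        show "Min D > 0" using fD \<open>D \<noteq> {}\<close> by (subst Min_gr_iff) (auto simp: D_def)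
        show "dist k l \<ge> Min D" if "k \<in> F" "l \<in> F" "k \<noteq> l" for k l
          using that by (intro Min_le fD) (auto simp: D_def)
      qed
    next
      case False
      then show ?thesis using that[of 1] by auto
    qed
    then show ?thesis by (intro that[of "s / 4"]) fastforce+
  qed
  have near: "\<exists>l\<in>F. dist (h t) l = infdist (h t) F" for t
    using infdist_attains_inf[OF finite_imp_closed[OF fin] ne, of "h t"] by metis
  obtain T0 where T0: "\<And>t. t \<ge> T0 \<Longrightarrow> infdist (h t) F < r"
    using tendstoD[OF lim r(1)] by (auto simp: eventually_at_top_linorder infdist_nonneg)
  define T where "T = max T0 0"
  obtain l where l: "l \<in> F" "dist (h T) l < r" using near[of T] T0[of T] by (auto simp: T_def)
  have close: "dist (h t) l < r" if t: "t \<ge> T" for t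
  proof (rule ccontr)
    assume "\<not> dist (h t) l < r"
    have "continuous_on {T..t} (\<lambda>t. dist (h t) l)"
      by (intro continuous_intros continuous_on_subset[OF cont]) (auto simp: T_def)
    then obtain s where s: "T \<le> s" "dist (h s) l = r"
      using IVT'[of "\<lambda>t. dist (h t) l" T r t] l t \<open>\<not> dist (h t) l < r\<close> by auto
    obtain k where k: "k \<in> F" "dist (h s) k < r" using near[of s] T0[of s] s by (auto simp: T_def)
    have "k \<noteq> l" using k s by auto
    then show False using r(2)[OF k(1) l(1)] k s dist_triangle[of k l "h s"]
      by (simp add: dist_commute r(1)) (use r(1) in linarith)
  qed
  have "infdist (h t) F = dist (h t) l" if t: "t \<ge> T" for t
  proof -
    obtain k where k: "k \<in> F" "dist (h t) k = infdist (h t) F" using near[of t] by auto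
    have "infdist (h t) F < r" using T0[of t] t by (auto simp: T_def)
    then have "k = l"
      using r(2)[OF k(1) l(1)] k close[OF t] dist_triangle[of k l "h t"] r(1)
      by (auto simp: dist_commute)
    then show ?thesis using k by simp
  qed
  then have "eventually (\<lambda>t. infdist (h t) F = dist (h t) l) at_top"
    by (intro eventually_at_top_linorderI[of T]) auto
  then have "((\<lambda>t. dist (h t) l) \<longlongrightarrow> 0) at_top"
    using lim by (subst (asm) tendsto_cong) auto
  then show ?thesis using l tendsto_dist_iff by blast
qed

text \<open>On the compact part of \<open>S\<close> where \<open>\<bar>g z\<bar> \<ge> e\<close>,
  the norm of \<open>f\<close> has a positive lower bound, so a small value of \<open>f\<close>
  forces \<open>\<bar>g z\<bar> < e\<close>.\<close>

lemma tendsto_zero_of_zeros_on_compact: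
  fixes f :: "'a::metric_space \<Rightarrow> 'b::real_normed_vector" and g :: "'a \<Rightarrow> real"
  assumes S: "compact S" and f: "continuous_on S f" and g: "continuous_on S g"
    and zero: "\<And>z. z \<in> S \<Longrightarrow> f z = 0 \<Longrightarrow> g z = 0"
    and x: "eventually (\<lambda>t. x t \<in> S) F" and lim: "((\<lambda>t. f (x t)) \<longlongrightarrow> 0) F"
  shows "((\<lambda>t. g (x t)) \<longlongrightarrow> 0) F"
proof (rule tendstoI)
  fix e :: real assume e: "e > 0"
  define C where "C = S \<inter> (S \<inter> g -` {y. \<bar>y\<bar> \<ge> e})"
  have "closed {y::real. \<bar>y\<bar> \<ge> e}" by (intro closed_Collect_le continuous_intros)
  then have "compact C" unfolding C_def
    by (intro compact_Int_closed[OF S] continuous_closed_preimage[OF g compact_imp_closed[OF S]])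
  have "\<exists>c>0. \<forall>z\<in>C. norm (f z) \<ge> c"
  proof (cases "C = {}")
    case False
    have "continuous_on C (\<lambda>z. norm (f z))"
      by (intro continuous_intros continuous_on_subset[OF f]) (auto simp: C_def)
    then obtain w where w: "w \<in> C" "\<And>z. z \<in> C \<Longrightarrow> norm (f w) \<le> norm (f z)"
      using continuous_attains_inf[OF \<open>compact C\<close> False] by blast
    have "f w \<noteq> 0" using zero[of w] w(1) e by (auto simp: C_def)
    then show ?thesis using w by (intro exI[of _ "norm (f w)"]) auto
  qed (auto intro: exI[of _ 1])
  then obtain c where c: "c > 0" "\<And>z. z \<in> C \<Longrightarrow> norm (f z) \<ge> c" by blast
  show "eventually (\<lambda>t. dist (g (x t)) 0 < e) F"
    using x tendstoD[OF lim c(1)]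
  proof eventually_elim
    case (elim t)
    then show ?case using c(2)[of "x t"] by (force simp: C_def)
  qed
qed

section \<open>The attention field\<close>

text \<open>Boundedness is bundled with the Lipschitz estimate because Lipschitz functions alone are
  not closed under products.\<close>

definition bounded_lipschitz_on :: "'a::real_normed_vector set \<Rightarrow> ('a \<Rightarrow> 'b::real_normed_vector) \<Rightarrow> bool" where
  "bounded_lipschitz_on S f \<longleftrightarrow> (\<exists>M. \<forall>x\<in>S. norm (f x) \<le> M)
     \<and> (\<exists>L. \<forall>x\<in>S. \<forall>y\<in>S. norm (f x - f y) \<le> L * norm (x - y))"

lemma bounded_lipschitz_onI:
  assumes "\<And>x. x \<in> S \<Longrightarrow> norm (f x) \<le> M"
    and "\<And>x y. x \<in> S \<Longrightarrow> y \<in> S \<Longrightarrow> norm (f x - f y) \<le> L * norm (x - y)"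
  shows "bounded_lipschitz_on S f"
  using assms unfolding bounded_lipschitz_on_def by blast

lemma bounded_lipschitz_onE:
  assumes "bounded_lipschitz_on S f"
  obtains M L where "M > 0" "L > 0" "\<And>x. x \<in> S \<Longrightarrow> norm (f x) \<le> M"
    "\<And>x y. x \<in> S \<Longrightarrow> y \<in> S \<Longrightarrow> norm (f x - f y) \<le> L * norm (x - y)"
proof -
  obtain M L where M: "\<And>x. x \<in> S \<Longrightarrow> norm (f x) \<le> M"
    and L: "\<And>x y. x \<in> S \<Longrightarrow> y \<in> S \<Longrightarrow> norm (f x - f y) \<le> L * norm (x - y)"
    using assms unfolding bounded_lipschitz_on_def by blast
  show ?thesis
  proof (rule that[of "max M 1" "max L 1"])
    show "norm (f x - f y) \<le> max L 1 * norm (x - y)" if "x \<in> S" "y \<in> S" for x y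
      using L[OF that] mult_right_mono[of L "max L 1" "norm (x - y)"] by simp
    show "norm (f x) \<le> max M 1" if "x \<in> S" for x using M[OF that] by simp
  qed auto
qed

lemma bounded_lipschitz_on_const: "bounded_lipschitz_on S (\<lambda>x. c)"
  by (rule bounded_lipschitz_onI[of _ _ "norm c" 0]) auto

lemma bounded_lipschitz_on_add:
  assumes "bounded_lipschitz_on S f" "bounded_lipschitz_on S g"
  shows "bounded_lipschitz_on S (\<lambda>x. f x + g x)"
proof -
  obtain M L where f: "\<And>x. x \<in> S \<Longrightarrow> norm (f x) \<le> M"
    "\<And>x y. x \<in> S \<Longrightarrow> y \<in> S \<Longrightarrow> norm (f x - f y) \<le> L * norm (x - y)"
    using assms(1) by (rule bounded_lipschitz_onE) blast
  obtain M' L' where g: "\<And>x. x \<in> S \<Longrightarrow> norm (g x) \<le> M'"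
    "\<And>x y. x \<in> S \<Longrightarrow> y \<in> S \<Longrightarrow> norm (g x - g y) \<le> L' * norm (x - y)"
    using assms(2) by (rule bounded_lipschitz_onE) blast
  show ?thesis
  proof (rule bounded_lipschitz_onI[of _ _ "M + M'" "L + L'"])
    show "norm (f x + g x) \<le> M + M'" if "x \<in> S" for x
      by (intro norm_triangle_mono f g that)
    show "norm (f x + g x - (f y + g y)) \<le> (L + L') * norm (x - y)" if "x \<in> S" "y \<in> S" for x y
      using norm_triangle_mono[OF f(2)[OF that] g(2)[OF that]] by (simp add: algebra_simps)
  qed
qed

lemma bounded_lipschitz_on_continuous:
  assumes "bounded_lipschitz_on S f"
  shows "continuous_on S f"
proof -
  obtain M L where L: "L > 0" "\<And>x y. x \<in> S \<Longrightarrow> y \<in> S \<Longrightarrow> norm (f x - f y) \<le> L * norm (x - y)"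
    using assms by (rule bounded_lipschitz_onE) blast
  then have "L-lipschitz_on S f" by (intro lipschitz_onI) (auto simp: dist_norm)
  then show ?thesis by (rule lipschitz_on_continuous_on)
qed

text \<open>The increment of a product telescopes into two terms, each with one factor bounded and
  the other Lipschitz. One rule serves multiplication, scaling and inner products.\<close>

lemma bounded_lipschitz_on_bilinear:
  assumes "bounded_bilinear pr" "bounded_lipschitz_on S f" "bounded_lipschitz_on S g"
  shows "bounded_lipschitz_on S (\<lambda>x. pr (f x) (g x))"
proof -
  interpret bounded_bilinear pr by fact
  obtain M L where f: "M > 0" "L > 0" "\<And>x. x \<in> S \<Longrightarrow> norm (f x) \<le> M"
    "\<And>x y. x \<in> S \<Longrightarrow> y \<in> S \<Longrightarrow> norm (f x - f y) \<le> L * norm (x - y)"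
    using assms(2) by (rule bounded_lipschitz_onE) blast
  obtain M' L' where g: "M' > 0" "L' > 0" "\<And>x. x \<in> S \<Longrightarrow> norm (g x) \<le> M'"
    "\<And>x y. x \<in> S \<Longrightarrow> y \<in> S \<Longrightarrow> norm (g x - g y) \<le> L' * norm (x - y)"
    using assms(3) by (rule bounded_lipschitz_onE) blast
  obtain K where K: "K > 0" "\<And>a b. norm (pr a b) \<le> norm a * norm b * K"
    using pos_bounded by blast
  have le: "norm (pr a b) \<le> A * B * K" if "norm a \<le> A" "norm b \<le> B" for a b A B
    by (rule order_trans[OF K(2)], intro mult_mono that)
       (use K(1) that norm_ge_zero order_trans in \<open>auto intro: mult_nonneg_nonneg order_trans[OF norm_ge_zero]\<close>)
  show ?thesis
  proof (rule bounded_lipschitz_onI[of _ _ "M * M' * K" "L * M' * K + M * L' * K"])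
    show "norm (pr (f x) (g x)) \<le> M * M' * K" if "x \<in> S" for x
      by (intro le f g that)
    show "norm (pr (f x) (g x) - pr (f y) (g y)) \<le> (L * M' * K + M * L' * K) * norm (x - y)"
      if "x \<in> S" "y \<in> S" for x y
    proof -
      have "pr (f x) (g x) - pr (f y) (g y) = pr (f x - f y) (g x) + pr (f y) (g x - g y)"
        by (simp add: diff_left diff_right)
      also have "norm \<dots> \<le> L * norm (x - y) * M' * K + M * (L' * norm (x - y)) * K"
        by (intro norm_triangle_mono le f g that)
      finally show ?thesis by (simp add: algebra_simps)
    qed
  qed
qed

lemma bounded_lipschitz_on_linear:
  assumes "bounded_linear h" "bounded_lipschitz_on S f"
  shows "bounded_lipschitz_on S (\<lambda>x. h (f x))"
proof -
  have "bounded_bilinear (\<lambda>(r::real) x. r *\<^sub>R h x)"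
    by (rule bounded_bilinear.comp[OF bounded_bilinear_scaleR bounded_linear_ident assms(1)])
  from bounded_lipschitz_on_bilinear[OF this bounded_lipschitz_on_const[of S 1] assms(2)]
  show ?thesis by simp
qed

lemma bounded_lipschitz_on_uminus:
  assumes "bounded_lipschitz_on S f"
  shows "bounded_lipschitz_on S (\<lambda>x. - f x)"
  using bounded_lipschitz_on_linear[OF bounded_linear_minus[OF bounded_linear_ident] assms] .

lemma bounded_lipschitz_on_diff:
  assumes "bounded_lipschitz_on S f" "bounded_lipschitz_on S g"
  shows "bounded_lipschitz_on S (\<lambda>x. f x - g x)"
  using bounded_lipschitz_on_add[OF assms(1) bounded_lipschitz_on_uminus[OF assms(2)]] by simp

text \<open>The inequality \<open>1 + u \<le> exp u\<close> gives the Lipschitz constant 1; the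
  optimal 1/4 would bring nothing more here.\<close>

lemma logistic_diff_le:
  fixes s t :: real
  shows "\<bar>1 / (1 + exp s) - 1 / (1 + exp t)\<bar> \<le> \<bar>s - t\<bar>"
proof -
  have *: "\<bar>1 / (1 + exp s) - 1 / (1 + exp t)\<bar> \<le> t - s" if "s \<le> t" for s t :: real
  proof -
    have pos: "1 + exp s > 0" "1 + exp t > 0" by (simp_all add: add_pos_nonneg)
    have "1 / (1 + exp s) - 1 / (1 + exp t) = (exp t - exp s) / ((1 + exp s) * (1 + exp t))"
      using pos by (simp add: field_simps)
    then have "\<bar>1 / (1 + exp s) - 1 / (1 + exp t)\<bar> = (exp t - exp s) / ((1 + exp s) * (1 + exp t))"
      using pos that by (simp add: abs_mult)
    also have "\<dots> \<le> (exp t - exp s) / (1 * exp t)"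
      using that pos by (intro divide_left_mono mult_mono mult_pos_pos) auto
    also have "\<dots> = 1 - exp (s - t)" by (simp add: exp_diff diff_divide_distrib)
    also have "\<dots> \<le> t - s" using exp_ge_add_one_self[of "s - t"] by linarith
    finally show ?thesis .
  qed
  show ?thesis using *[of s t] *[of t s] by (cases "s \<le> t") (auto simp: abs_minus_commute)
qed

lemma bounded_lipschitz_on_logistic:
  fixes f :: "'a::real_normed_vector \<Rightarrow> real"
  assumes "bounded_lipschitz_on S f"
  shows "bounded_lipschitz_on S (\<lambda>x. 1 / (1 + exp (f x)))"
proof -
  obtain L where L: "\<And>x y. x \<in> S \<Longrightarrow> y \<in> S \<Longrightarrow> norm (f x - f y) \<le> L * norm (x - y)"
    using assms by (rule bounded_lipschitz_onE) blast
  show ?thesis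
  proof (rule bounded_lipschitz_onI[of _ _ 1 L])
    show "norm (1 / (1 + exp (f x))) \<le> 1" for x by (simp add: add_pos_nonneg)
    show "norm (1 / (1 + exp (f x)) - 1 / (1 + exp (f y))) \<le> L * norm (x - y)"
      if "x \<in> S" "y \<in> S" for x y
      using order_trans[OF logistic_diff_le] L[OF that] by simp
  qed
qed

lemma bounded_lipschitz_on_Pair:
  assumes "bounded_lipschitz_on S f" "bounded_lipschitz_on S g"
  shows "bounded_lipschitz_on S (\<lambda>x. (f x, g x))"
proof -
  have "bounded_lipschitz_on S (\<lambda>x. (f x, 0) + (0, g x))"
    by (intro bounded_lipschitz_on_add bounded_lipschitz_on_linear[OF bounded_linear_Pair] assms
        bounded_linear_ident bounded_linear_zero
        bounded_lipschitz_on_linear[of "\<lambda>x. (x, 0)"] bounded_lipschitz_on_linear[of "\<lambda>x. (0, x)"])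
  then show ?thesis by simp
qed

lemma bounded_lipschitz_on_fst_snd:
  fixes S :: "('a::real_normed_vector \<times> 'b::real_normed_vector) set"
  assumes "bounded S"
  shows "bounded_lipschitz_on S (\<lambda>x. fst x)" "bounded_lipschitz_on S (\<lambda>x. snd x)"
proof -
  obtain M where M: "\<And>x. x \<in> S \<Longrightarrow> norm x \<le> M" using assms by (auto simp: bounded_iff)
  have fst_le: "norm (fst x) \<le> norm x" and snd_le: "norm (snd x) \<le> norm x" for x :: "'a \<times> 'b"
    using norm_fst_le[of "fst x" "snd x"] norm_snd_le[of "snd x" "fst x"] by simp_all
  show "bounded_lipschitz_on S (\<lambda>x. fst x)"
    by (rule bounded_lipschitz_onI[of _ _ M 1])
       (use order_trans[OF fst_le M] fst_le in \<open>simp_all flip: fst_diff\<close>)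
  show "bounded_lipschitz_on S (\<lambda>x. snd x)"
    by (rule bounded_lipschitz_onI[of _ _ M 1])
       (use order_trans[OF snd_le M] snd_le in \<open>simp_all flip: snd_diff\<close>)
qed

section \<open>The attention field as a convex combination\<close>

text \<open>The softmax weight that a particle gives to itself, written as a logistic function of
  one real argument so that \<open>logistic_diff_le\<close> applies and no quotient has to be
  estimated.\<close>

definition attn_weight :: "real \<Rightarrow> real^'n^'n \<Rightarrow> real^'n \<Rightarrow> real^'n \<Rightarrow> real" where
  "attn_weight \<beta> V x y = 1 / (1 + exp (\<beta> * (x \<bullet> (V *v y) - x \<bullet> (V *v x))))"

text \<open>The inner product of \<open>x\<close> with the weighted average of \<open>V *v x\<close>
  and \<open>V *v y\<close>: the coefficient of \<open>x\<close> that the projection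
  subtracts.\<close>

definition attn_rate :: "real \<Rightarrow> real^'n^'n \<Rightarrow> real^'n \<Rightarrow> real^'n \<Rightarrow> real" where
  "attn_rate \<beta> V x y = attn_weight \<beta> V x y * (x \<bullet> (V *v x)) + (1 - attn_weight \<beta> V x y) * (x \<bullet> (V *v y))"

lemma attn_weight_pos: "0 < attn_weight \<beta> V x y"
  and attn_weight_less_1: "attn_weight \<beta> V x y < 1"
  by (simp_all add: attn_weight_def add_pos_nonneg)

lemma attn_weight_eq:
  "attn_weight \<beta> V x y = exp (\<beta> * (x \<bullet> (V *v x))) / (exp (\<beta> * (x \<bullet> (V *v x))) + exp (\<beta> * (x \<bullet> (V *v y))))"
  "1 - attn_weight \<beta> V x y = exp (\<beta> * (x \<bullet> (V *v y))) / (exp (\<beta> * (x \<bullet> (V *v x))) + exp (\<beta> * (x \<bullet> (V *v y))))"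
proof -
  define a b where "a = exp (\<beta> * (x \<bullet> (V *v x)))" and "b = exp (\<beta> * (x \<bullet> (V *v y)))"
  have pos: "a > 0" "b > 0" "a + b > 0" by (auto simp: a_def b_def add_pos_pos)
  have "attn_weight \<beta> V x y = 1 / (1 + b / a)"
    by (simp add: attn_weight_def a_def b_def exp_diff right_diff_distrib)
  also have "\<dots> = a / (a + b)" using pos by (simp add: field_simps)
  finally have *: "attn_weight \<beta> V x y = a / (a + b)" .
  show "attn_weight \<beta> V x y = exp (\<beta> * (x \<bullet> (V *v x))) / (exp (\<beta> * (x \<bullet> (V *v x))) + exp (\<beta> * (x \<bullet> (V *v y))))"
    using * by (simp add: a_def b_def)
  have "1 - attn_weight \<beta> V x y = b / (a + b)" unfolding * using pos by (simp add: field_simps)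
  then show "1 - attn_weight \<beta> V x y = exp (\<beta> * (x \<bullet> (V *v y))) / (exp (\<beta> * (x \<bullet> (V *v x))) + exp (\<beta> * (x \<bullet> (V *v y))))"
    by (simp add: a_def b_def)
qed

lemma attn_field_eq:
  "attn_field \<beta> V x y = attn_weight \<beta> V x y *\<^sub>R (V *v x) + (1 - attn_weight \<beta> V x y) *\<^sub>R (V *v y)
     - attn_rate \<beta> V x y *\<^sub>R x"
proof -
  define a b where "a = exp (\<beta> * (x \<bullet> (V *v x)))" and "b = exp (\<beta> * (x \<bullet> (V *v y)))"
  have *: "(1 / (a + b)) *\<^sub>R (a *\<^sub>R (V *v x) + b *\<^sub>R (V *v y))
     = attn_weight \<beta> V x y *\<^sub>R (V *v x) + (1 - attn_weight \<beta> V x y) *\<^sub>R (V *v y)"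
    unfolding attn_weight_eq(2) unfolding attn_weight_eq(1) by (simp add: a_def b_def scaleR_add_right)
  have "attn_field \<beta> V x y = Pperp x ((1 / (a + b)) *\<^sub>R (a *\<^sub>R (V *v x) + b *\<^sub>R (V *v y)))"
    by (simp add: attn_field_def Let_def a_def b_def)
  then show ?thesis
    unfolding * by (simp add: Pperp_def attn_rate_def inner_add_right)
qed

text \<open>Holding off the sphere too, this makes the derivative of
  \<open>x \<bullet> x - 1\<close> along a solution a multiple of that quantity itself, so the unit
  sphere is invariant.\<close>

lemma inner_attn_field:
  "x \<bullet> attn_field \<beta> V x y = attn_rate \<beta> V x y * (1 - x \<bullet> x)"
  by (simp add: attn_field_eq attn_rate_def inner_add_right inner_diff_right algebra_simps)

definition pair_field :: "real \<Rightarrow> real^'n^'n \<Rightarrow> (real^'n) \<times> (real^'n) \<Rightarrow> (real^'n) \<times> (real^'n)" where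
  "pair_field \<beta> V z = (attn_field \<beta> V (fst z) (snd z), attn_field \<beta> V (snd z) (fst z))"

lemma bounded_lipschitz_on_inner_matrix:
  fixes f g :: "'a::real_normed_vector \<Rightarrow> real^'n"
  assumes "bounded_lipschitz_on S f" "bounded_lipschitz_on S g"
  shows "bounded_lipschitz_on S (\<lambda>z. f z \<bullet> (V *v g z))"
  by (intro bounded_lipschitz_on_bilinear[OF bounded_bilinear_inner] assms
      bounded_lipschitz_on_linear[OF matrix_vector_mul_bounded_linear])

lemma bounded_lipschitz_on_attn_rate:
  assumes "bounded_lipschitz_on S f" "bounded_lipschitz_on S g"
  shows "bounded_lipschitz_on S (\<lambda>z. attn_weight \<beta> V (f z) (g z))"
    and "bounded_lipschitz_on S (\<lambda>z. attn_rate \<beta> V (f z) (g z))"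
proof -
  note rules = bounded_lipschitz_on_bilinear[OF bounded_bilinear_mult] bounded_lipschitz_on_inner_matrix
     bounded_lipschitz_on_add bounded_lipschitz_on_diff bounded_lipschitz_on_const assms
  show w: "bounded_lipschitz_on S (\<lambda>z. attn_weight \<beta> V (f z) (g z))"
    unfolding attn_weight_def by (intro bounded_lipschitz_on_logistic rules)
  show "bounded_lipschitz_on S (\<lambda>z. attn_rate \<beta> V (f z) (g z))"
    unfolding attn_rate_def by (intro rules w)
qed

lemma bounded_lipschitz_on_attn_field:
  assumes "bounded_lipschitz_on S f" "bounded_lipschitz_on S g"
  shows "bounded_lipschitz_on S (\<lambda>z. attn_field \<beta> V (f z) (g z))"
  unfolding attn_field_eq
  by (intro bounded_lipschitz_on_bilinear[OF bounded_bilinear_scaleR] assms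
      bounded_lipschitz_on_add bounded_lipschitz_on_diff bounded_lipschitz_on_attn_rate
      bounded_lipschitz_on_const bounded_lipschitz_on_linear[OF matrix_vector_mul_bounded_linear])

lemma bounded_lipschitz_on_pair_field:
  "bounded S \<Longrightarrow> bounded_lipschitz_on S (pair_field \<beta> V)"
  unfolding pair_field_def[abs_def]
  by (intro bounded_lipschitz_on_Pair bounded_lipschitz_on_attn_field bounded_lipschitz_on_fst_snd)

section \<open>Radial truncation to a globally Lipschitz field\<close>

text \<open>Each component is retracted radially to the unit ball. The Lipschitz bound for the field
  is available on bounded sets only; composing with this map makes it global and leaves the field
  unchanged on pairs of unit vectors.\<close>

definition clamp_pair :: "'a::real_normed_vector \<times> 'a \<Rightarrow> 'a \<times> 'a" where
  "clamp_pair z = (fst z /\<^sub>R max 1 (norm (fst z)), snd z /\<^sub>R max 1 (norm (snd z)))"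

text \<open>The difference splits into \<open>(x - y) /\<^sub>R a\<close> and a change of scale
  applied to \<open>y\<close>, each of norm at most \<open>norm (x - y)\<close>.\<close>

lemma norm_clamp_diff_le:
  fixes x y :: "'a::real_normed_vector"
  shows "norm (x /\<^sub>R max 1 (norm x) - y /\<^sub>R max 1 (norm y)) \<le> 2 * norm (x - y)"
proof -
  define a b where "a = max 1 (norm x)" and "b = max 1 (norm y)"
  have ab: "a \<ge> 1" "b \<ge> 1" "norm y \<le> b" "\<bar>a - b\<bar> \<le> norm (x - y)"
    using norm_triangle_ineq3[of x y] by (auto simp: a_def b_def max_def)
  have "x /\<^sub>R a - y /\<^sub>R b = (x - y) /\<^sub>R a + (1 / a - 1 / b) *\<^sub>R y"
    by (simp add: algebra_simps divide_inverse)
  also have "norm \<dots> \<le> norm (x - y) + norm (x - y)"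
  proof (rule norm_triangle_mono)
    show "norm ((x - y) /\<^sub>R a) \<le> norm (x - y)"
      using ab mult_right_mono[of "inverse a" 1 "norm (x - y)"] by (simp add: inverse_le_1_iff del: scaleR_right_diff_distrib)
    have "norm ((1 / a - 1 / b) *\<^sub>R y) = \<bar>a - b\<bar> / a * (norm y / b)"
    proof -
      have "1 / a - 1 / b = (b - a) / (a * b)" using ab by (simp add: field_simps)
      then show ?thesis using ab by (simp add: abs_mult abs_minus_commute)
    qed
    also have "\<dots> \<le> \<bar>a - b\<bar> * 1"
      using ab mult_right_mono[of 1 a "\<bar>a - b\<bar>"] by (intro mult_mono) (auto simp: field_simps)
    finally show "norm ((1 / a - 1 / b) *\<^sub>R y) \<le> norm (x - y)" using ab by simp
  qed
  finally show ?thesis by (simp add: a_def b_def)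
qed

lemma norm_clamp_pair_diff_le:
  fixes z w :: "'a::real_normed_vector \<times> 'a"
  shows "norm (clamp_pair z - clamp_pair w) \<le> 4 * norm (z - w)"
proof -
  have "norm (clamp_pair z - clamp_pair w) \<le> 2 * norm (fst (z - w)) + 2 * norm (snd (z - w))"
    unfolding clamp_pair_def
    using norm_clamp_diff_le[of "fst z" "fst w"] norm_clamp_diff_le[of "snd z" "snd w"]
    by (auto intro!: order_trans[OF norm_Pair_le])
  then show ?thesis
    using norm_fst_le[of "fst (z - w)" "snd (z - w)"] norm_snd_le[of "snd (z - w)" "fst (z - w)"]
    unfolding prod.collapse by linarith
qed

lemma norm_scaleR_clamp_le: "norm (x /\<^sub>R max 1 (norm x)) \<le> 1"
  by (cases "norm x \<le> 1") (auto simp: max_def field_simps)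

lemma clamp_pair_unit: "norm (fst z) = 1 \<Longrightarrow> norm (snd z) = 1 \<Longrightarrow> clamp_pair z = z"
  by (simp add: clamp_pair_def)

lemma clamp_pair_in: "clamp_pair z \<in> cball 0 1 \<times> cball 0 1"
  using norm_scaleR_clamp_le[of "fst z"] norm_scaleR_clamp_le[of "snd z"]
  by (simp add: clamp_pair_def mem_Times_iff)

definition clamped_field :: "real \<Rightarrow> real^'n^'n \<Rightarrow> (real^'n) \<times> (real^'n) \<Rightarrow> (real^'n) \<times> (real^'n)" where
  "clamped_field \<beta> V z = pair_field \<beta> V (clamp_pair z)"

lemma clamped_field_lipschitz:
  "\<exists>L>0. \<forall>z w. norm (clamped_field \<beta> V z - clamped_field \<beta> V w) \<le> L * norm (z - w)"
proof -
  let ?B = "cball 0 1 \<times> cball 0 1 :: ((real^'n) \<times> (real^'n)) set"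
  have "bounded ?B" by (intro bounded_Times bounded_cball)
  then obtain L where L: "L > 0"
    "\<And>z w. z \<in> ?B \<Longrightarrow> w \<in> ?B \<Longrightarrow> norm (pair_field \<beta> V z - pair_field \<beta> V w) \<le> L * norm (z - w)"
    using bounded_lipschitz_onE[OF bounded_lipschitz_on_pair_field] by (metis (no_types))
  show ?thesis
  proof (intro exI conjI allI)
    show "L * 4 > 0" using L by simp
    show "norm (clamped_field \<beta> V z - clamped_field \<beta> V w) \<le> L * 4 * norm (z - w)" for z w
    proof -
      have "norm (clamped_field \<beta> V z - clamped_field \<beta> V w) \<le> L * norm (clamp_pair z - clamp_pair w)"
        unfolding clamped_field_def by (rule L(2)[OF clamp_pair_in clamp_pair_in])
      also have "\<dots> \<le> L * (4 * norm (z - w))"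
        using L(1) by (intro mult_left_mono norm_clamp_pair_diff_le) auto
      finally show ?thesis by simp
    qed
  qed
qed

text \<open>Gronwall for the square, so that no modulus is differentiated. Applied to
  \<open>x \<bullet> x - 1\<close>, it keeps trajectories on the sphere.\<close>

lemma zero_of_linear_bound:
  fixes g g' :: "real \<Rightarrow> real"
  assumes der: "\<And>t. t \<in> {0..T} \<Longrightarrow> (g has_real_derivative g' t) (at t within {0..T})"
    and le: "\<And>t. t \<in> {0..T} \<Longrightarrow> \<bar>g' t\<bar> \<le> C * \<bar>g t\<bar>" and g0: "g 0 = 0" and T: "0 \<le> T"
  shows "g T = 0"
proof -
  have "(g T)\<^sup>2 \<le> (g 0)\<^sup>2 * exp ((2 * C) * T)"
  proof (rule exponential_upper_bound[OF _ _ T])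
    show "((\<lambda>t. (g t)\<^sup>2) has_real_derivative 2 * g t * g' t) (at t within {0..T})" if "t \<in> {0..T}" for t
      using that by (auto intro!: derivative_eq_intros der)
    show "2 * g t * g' t \<le> 2 * C * (g t)\<^sup>2" if "t \<in> {0..T}" for t
    proof -
      have "g t * g' t \<le> \<bar>g t\<bar> * \<bar>g' t\<bar>" by (metis abs_ge_self abs_mult)
      also have "\<dots> \<le> \<bar>g t\<bar> * (C * \<bar>g t\<bar>)" by (intro mult_left_mono le that) auto
      also have "\<dots> = C * (g t)\<^sup>2" by (simp add: power2_eq_square)
      finally show ?thesis by simp
    qed
  qed
  then show ?thesis using g0 by simp
qed

section \<open>Flows of Lipschitz fields\<close>

lemma has_vector_derivative_shift:
  fixes x :: "real \<Rightarrow> 'a::real_normed_vector"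
  assumes x: "\<And>t. t \<ge> 0 \<Longrightarrow> (x has_vector_derivative f (x t)) (at t within {0..})"
    and s: "s \<ge> 0" and t: "t \<ge> 0"
  shows "((\<lambda>t. x (s + t)) has_vector_derivative f (x (s + t))) (at t within {0..})"
proof -
  have "((x \<circ> (\<lambda>t. s + t)) has_vector_derivative 1 *\<^sub>R f (x (s + t))) (at t within {0..})"
  proof (rule vector_diff_chain_within)
    show "((+) s has_vector_derivative 1) (at t within {0..})"
      by (auto intro!: derivative_eq_intros simp flip: has_real_derivative_iff_has_vector_derivative)
    show "(x has_vector_derivative f (x (s + t))) (at (s + t) within (+) s ` {0..})"
      by (rule has_vector_derivative_within_subset[OF x]) (use s t in auto)
  qed
  then show ?thesis by (simp add: o_def)
qed

text \<open>A total function obtained by choice, informative only where a solution exists, as in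
  \<open>lipschitz_field\<close>. It is a solution for nonnegative times; backward motion is the
  flow of \<open>- F\<close>.\<close>

definition ode_flow :: "('a::real_normed_vector \<Rightarrow> 'a) \<Rightarrow> 'a \<Rightarrow> real \<Rightarrow> 'a" where
  "ode_flow F z = (SOME x. x 0 = z \<and> (\<forall>t\<ge>0. (x has_vector_derivative F (x t)) (at t within {0..})))"

locale lipschitz_field =
  fixes F :: "'a::euclidean_space \<Rightarrow> 'a" and L :: real
  assumes lip: "norm (F u - F v) \<le> L * norm (u - v)" and L_pos: "L > 0"
begin

lemma
  shows flow_0: "ode_flow F z 0 = z"
    and flow_deriv: "t \<ge> 0 \<Longrightarrow> (ode_flow F z has_vector_derivative F (ode_flow F z t)) (at t within {0..})"
  using someI_ex[OF global_lipschitz_ode_solution[of F L z, OF lip L_pos]]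
  unfolding ode_flow_def by blast+

lemma flow_unique:
  assumes "\<And>t. t \<ge> 0 \<Longrightarrow> (x has_vector_derivative F (x t)) (at t within {0..})" and "t \<ge> 0"
  shows "x t = ode_flow F (x 0) t"
proof -
  have "norm (x t - ode_flow F (x 0) t) \<le> norm (x 0 - ode_flow F (x 0) 0) * exp (L * t)"
    by (rule lipschitz_flow_distance[OF _ _ lip \<open>t \<ge> 0\<close>])
       (auto intro!: has_vector_derivative_within_subset[OF assms(1)]
         has_vector_derivative_within_subset[OF flow_deriv])
  then show ?thesis by (simp add: flow_0)
qed

lemma flow_distance:
  assumes "t \<ge> 0"
  shows "norm (ode_flow F z t - ode_flow F w t) \<le> norm (z - w) * exp (L * t)"
proof -
  have "norm (ode_flow F z t - ode_flow F w t) \<le> norm (ode_flow F z 0 - ode_flow F w 0) * exp (L * t)"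
    by (rule lipschitz_flow_distance[OF _ _ lip \<open>t \<ge> 0\<close>])
       (auto intro!: has_vector_derivative_within_subset[OF flow_deriv])
  then show ?thesis by (simp add: flow_0)
qed

lemma flow_continuous: "t \<ge> 0 \<Longrightarrow> continuous_on S (\<lambda>z. ode_flow F z t)"
  by (rule lipschitz_on_continuous_on[of "exp (L * t)"], rule lipschitz_onI)
     (use flow_distance in \<open>auto simp: dist_norm mult.commute[of "exp _"]\<close>)

lemma flow_add:
  assumes "s \<ge> 0" "t \<ge> 0"
  shows "ode_flow F (ode_flow F z s) t = ode_flow F z (s + t)"
  using flow_unique[of "\<lambda>t. ode_flow F z (s + t)" t]
    has_vector_derivative_shift[of "ode_flow F z" F s, OF flow_deriv \<open>s \<ge> 0\<close>] \<open>t \<ge> 0\<close> by simp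

lemma lipschitz_field_uminus: "lipschitz_field (\<lambda>z. - F z) L"
  by unfold_locales (use lip L_pos in \<open>auto simp: norm_minus_commute\<close>)

text \<open>The reversed trajectory solves the equation of \<open>- F\<close> from the end point,
  and uniqueness identifies it with the flow of \<open>- F\<close>. This exhibits the inverse of the
  time-\<open>T\<close> map as a Lipschitz map.\<close>

lemma backward_flow:
  assumes T: "T \<ge> 0"
  shows "ode_flow (\<lambda>z. - F z) (ode_flow F z T) T = z"
proof -
  interpret bw: lipschitz_field "\<lambda>z. - F z" L by (rule lipschitz_field_uminus)
  define x where "x s = ode_flow F z (T - s)" for s
  have "norm (x T - ode_flow (\<lambda>z. - F z) (x 0) T)
      \<le> norm (x 0 - ode_flow (\<lambda>z. - F z) (x 0) 0) * exp (L * T)"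
  proof (rule lipschitz_flow_distance[OF _ _ bw.lip T])
    show "(ode_flow (\<lambda>z. - F z) (x 0) has_vector_derivative - F (ode_flow (\<lambda>z. - F z) (x 0) s))
        (at s within {0..T})" if "s \<in> {0..T}" for s
      by (rule has_vector_derivative_within_subset[OF bw.flow_deriv]) (use that in auto)
    show "(x has_vector_derivative - F (x s)) (at s within {0..T})" if "s \<in> {0..T}" for s
    proof -
      have "((ode_flow F z \<circ> (\<lambda>s. T - s)) has_vector_derivative (-1) *\<^sub>R F (x s)) (at s within {0..T})"
      proof (rule vector_diff_chain_within)
        show "((-) T has_vector_derivative - 1) (at s within {0..T})"
          by (auto intro!: derivative_eq_intros simp flip: has_real_derivative_iff_has_vector_derivative)
        show "(ode_flow F z has_vector_derivative F (x s)) (at (T - s) within (-) T ` {0..T})"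
          unfolding x_def by (rule has_vector_derivative_within_subset[OF flow_deriv]) (use that in auto)
      qed
      then show ?thesis by (simp add: o_def x_def[abs_def])
    qed
  qed
  then show ?thesis by (simp add: bw.flow_0 x_def flow_0)
qed

end

definition attn_solution ::
  "real \<Rightarrow> real^'n^'n \<Rightarrow> (real \<Rightarrow> real^'n) \<Rightarrow> (real \<Rightarrow> real^'n) \<Rightarrow> bool" where
  "attn_solution \<beta> V x y \<longleftrightarrow> (\<forall>t\<ge>0. (x has_vector_derivative attn_field \<beta> V (x t) (y t)) (at t within {0..}) \<and>
                (y has_vector_derivative attn_field \<beta> V (y t) (x t)) (at t within {0..}))"

lemma attn_solution_commute: "attn_solution \<beta> V x y \<Longrightarrow> attn_solution \<beta> V y x"
  by (simp add: attn_solution_def)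

lemma attn_solution_continuous:
  assumes "attn_solution \<beta> V x y"
  shows "continuous_on {0..} x" "continuous_on {0..} y"
  using assms unfolding attn_solution_def
  by (meson atLeast_iff continuous_on_eq_continuous_within has_vector_derivative_continuous)+

text \<open>This is about arbitrary solutions of the original equation, where no global bound is at
  hand; the rate is bounded on the compact piece of the trajectory up to time
  \<open>T\<close>.\<close>

lemma attn_solution_unit_norm:
  assumes sol: "attn_solution \<beta> V x y" and x0: "norm (x 0) = 1" and T: "T \<ge> 0"
  shows "norm (x T) = 1"
proof -
  note cont = attn_solution_continuous[OF sol]
  define S where "S = (\<lambda>t. (x t, y t)) ` {0..T}"
  have "compact S" unfolding S_def
    by (intro compact_continuous_image continuous_intros continuous_on_subset[OF cont(1)] continuous_on_subset[OF cont(2)]) auto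
  then have bS: "bounded S" by (rule compact_imp_bounded)
  obtain M where M: "\<And>z. z \<in> S \<Longrightarrow> norm (attn_rate \<beta> V (fst z) (snd z)) \<le> M"
    using bounded_lipschitz_onE[OF bounded_lipschitz_on_attn_rate(2)[OF bounded_lipschitz_on_fst_snd[OF bS]]]
    by metis
  have "x T \<bullet> x T - 1 = 0"
  proof (rule zero_of_linear_bound[OF _ _ _ T, where C = "2 * M"
        and g' = "\<lambda>t. 2 * (attn_rate \<beta> V (x t) (y t) * (1 - x t \<bullet> x t))"])
    show "((\<lambda>t. x t \<bullet> x t - 1) has_real_derivative 2 * (attn_rate \<beta> V (x t) (y t) * (1 - x t \<bullet> x t)))
        (at t within {0..T})" if "t \<in> {0..T}" for t
    proof -
      have "(x has_vector_derivative attn_field \<beta> V (x t) (y t)) (at t within {0..T})"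
        by (rule has_vector_derivative_within_subset[of _ _ _ "{0..}"])
           (use sol that in \<open>auto simp: attn_solution_def\<close>)
      from has_real_derivative_inner[OF this this] show ?thesis
        by (auto intro!: derivative_eq_intros simp: inner_commute[of "attn_field _ _ _ _"] inner_attn_field)
    qed
    show "\<bar>2 * (attn_rate \<beta> V (x t) (y t) * (1 - x t \<bullet> x t))\<bar> \<le> 2 * M * \<bar>x t \<bullet> x t - 1\<bar>"
      if "t \<in> {0..T}" for t
      using mult_right_mono[OF M[of "(x t, y t)"], of "\<bar>x t \<bullet> x t - 1\<bar>"] that
      by (auto simp: abs_mult S_def abs_minus_commute)
  qed (use x0 in \<open>simp add: norm_eq_1\<close>)
  then show ?thesis by (simp add: norm_eq_1)
qed

text \<open>The analogue for the clamped equation; the factor \<open>s\<close> covers both forward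
  and reversed time.\<close>

lemma clamped_unit_norm:
  fixes x y :: "real \<Rightarrow> real^'n"
  assumes der: "\<And>t. t \<ge> 0 \<Longrightarrow> (x has_vector_derivative
        s *\<^sub>R attn_field \<beta> V (x t /\<^sub>R max 1 (norm (x t))) (y t /\<^sub>R max 1 (norm (y t)))) (at t within {0..})"
    and x0: "norm (x 0) = 1" and T: "T \<ge> 0"
  shows "norm (x T) = 1"
proof -
  define c :: "real^'n \<Rightarrow> real^'n" where "c v = v /\<^sub>R max 1 (norm v)" for v
  let ?B = "cball 0 1 \<times> cball 0 1 :: ((real^'n) \<times> (real^'n)) set"
  have bB: "bounded ?B" by (intro bounded_Times bounded_cball)
  obtain M where M: "\<And>z. z \<in> ?B \<Longrightarrow> norm (attn_rate \<beta> V (fst z) (snd z)) \<le> M"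
    using bounded_lipschitz_onE[OF bounded_lipschitz_on_attn_rate(2)[OF bounded_lipschitz_on_fst_snd[OF bB]]]
    by metis
  have rate: "\<bar>attn_rate \<beta> V (c u) (c v)\<bar> \<le> M" for u v
    using M[of "(c u, c v)"] norm_scaleR_clamp_le[of u] norm_scaleR_clamp_le[of v] by (simp add: c_def)
  \<comment> \<open>Inside the ball clamping leaves \<open>u\<close> alone, and the radial component
    is the rate times \<open>1 - u \<bullet> u\<close>. Outside, the clamped vector is a unit vector
    at which the field is tangential, so the radial component vanishes.\<close>
  have inner: "\<bar>u \<bullet> attn_field \<beta> V (c u) (c v)\<bar> \<le> M * \<bar>u \<bullet> u - 1\<bar>" for u v
  proof (cases "norm u \<le> 1")
    case True
    then have "c u = u" by (simp add: c_def max_def)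
    then show ?thesis
      using mult_right_mono[OF rate[of u v], of "\<bar>u \<bullet> u - 1\<bar>"]
      by (simp add: inner_attn_field abs_mult abs_minus_commute)
  next
    case False
    then have c: "c u = u /\<^sub>R norm u" "u \<noteq> 0" by (auto simp: c_def max_def)
    then have "u = norm u *\<^sub>R c u" "norm (c u) = 1" by simp_all
    then have "c u \<bullet> c u = 1" by (simp add: norm_eq_1)
    then have "u \<bullet> attn_field \<beta> V (c u) (c v) = norm u * (c u \<bullet> attn_field \<beta> V (c u) (c v))"
      by (metis \<open>u = norm u *\<^sub>R c u\<close> inner_scaleR_left)
    then show ?thesis using \<open>c u \<bullet> c u = 1\<close> order_trans[OF abs_ge_zero rate[of u v]]
      by (simp add: inner_attn_field)
  qed
  have "x T \<bullet> x T - 1 = 0"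
  proof (rule zero_of_linear_bound[OF _ _ _ T, where C = "2 * \<bar>s\<bar> * M"
        and g' = "\<lambda>t. 2 * s * (x t \<bullet> attn_field \<beta> V (c (x t)) (c (y t)))"])
    show "((\<lambda>t. x t \<bullet> x t - 1) has_real_derivative 2 * s * (x t \<bullet> attn_field \<beta> V (c (x t)) (c (y t))))
        (at t within {0..T})" if "t \<in> {0..T}" for t
    proof -
      have "(x has_vector_derivative s *\<^sub>R attn_field \<beta> V (c (x t)) (c (y t))) (at t within {0..T})"
        unfolding c_def by (rule has_vector_derivative_within_subset[OF der]) (use that in auto)
      from has_real_derivative_inner[OF this this] show ?thesis
        by (auto intro!: derivative_eq_intros simp: inner_commute[of "attn_field _ _ _ _"])
    qed
    show "\<bar>2 * s * (x t \<bullet> attn_field \<beta> V (c (x t)) (c (y t)))\<bar> \<le> 2 * \<bar>s\<bar> * M * \<bar>x t \<bullet> x t - 1\<bar>" for t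
      using mult_left_mono[OF inner[of "x t" "y t"], of "2 * \<bar>s\<bar>"] by (simp add: abs_mult)
  qed (use x0 in \<open>simp add: norm_eq_1\<close>)
  then show ?thesis by (simp add: norm_eq_1)
qed

section \<open>Null sets on the product of two spheres\<close>

text \<open>Arbitrarily many disjoint translates of \<open>S\<close> along bounded multiples of
  \<open>v\<close> fit into one ball, so their common measure is zero.\<close>

lemma negligible_of_disjoint_translates:
  fixes S :: "'a::euclidean_space set"
  assumes bnd: "bounded S" and meas: "S \<in> sets lebesgue"
    and disj: "\<And>x \<tau>. x \<in> S \<Longrightarrow> x + \<tau> *\<^sub>R v \<in> S \<Longrightarrow> \<tau> = 0"
  shows "negligible S"
proof -
  obtain M where M: "\<And>x. x \<in> S \<Longrightarrow> norm x \<le> M" using bnd by (auto simp: bounded_iff)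
  define c :: "nat \<Rightarrow> real" where "c k = 1 / real (Suc k)" for k
  define A where "A k = (+) (c k *\<^sub>R v) ` S" for k
  have lm: "S \<in> lmeasurable" by (rule bounded_set_imp_lmeasurable[OF bnd meas])
  have Alm: "A k \<in> lmeasurable" for k unfolding A_def by (rule measurable_translation[OF lm])
  have Am: "measure lebesgue (A k) = measure lebesgue S" for k unfolding A_def by (rule measure_translation)
  have dA: "disjoint_family_on A {..<n}" for n
  proof (unfold disjoint_family_on_def, intro ballI impI equals0I)
    fix i j z assume "i \<noteq> j" "z \<in> A i \<inter> A j"
    then obtain x y where x: "x \<in> S" "z = c i *\<^sub>R v + x" and y: "y \<in> S" "z = c j *\<^sub>R v + y"
      by (auto simp: A_def)
    then have "x + (c i - c j) *\<^sub>R v = y" by (simp add: algebra_simps)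
    then have "c i - c j = 0" using disj x y by blast
    then show False using \<open>i \<noteq> j\<close> by (simp add: c_def)
  qed
  define B :: "'a set" where "B = cball 0 (M + norm v)"
  have Asub: "A k \<subseteq> B" for k
  proof
    fix z assume "z \<in> A k"
    then obtain x where x: "x \<in> S" "z = c k *\<^sub>R v + x" by (auto simp: A_def)
    have "norm (c k *\<^sub>R v) \<le> 1 * norm v" unfolding norm_scaleR by (intro mult_right_mono) (auto simp: c_def)
    then show "z \<in> B" using x M[OF x(1)] norm_triangle_ineq[of "c k *\<^sub>R v" x] by (simp add: B_def)
  qed
  have bound: "real n * measure lebesgue S \<le> measure lebesgue B" for n
  proof -
    have "measure lebesgue (\<Union>k<n. A k) = (\<Sum>k<n. measure lebesgue (A k))"
    proof (intro measure_finite_Union dA)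
      show "emeasure lebesgue (A k) \<noteq> \<infinity>" for k using fmeasurableD2[OF Alm] by simp
    qed (use Alm in auto)
    also have "\<dots> = real n * measure lebesgue S" by (simp add: Am)
    finally show ?thesis
      using measure_mono_fmeasurable[of "\<Union>k<n. A k" B lebesgue] Asub Alm
      by (auto simp: B_def UN_subset_iff)
  qed
  have "measure lebesgue S = 0"
  proof (rule ccontr)
    assume "measure lebesgue S \<noteq> 0"
    then have pos: "measure lebesgue S > 0" by (simp add: zero_less_measure_iff)
    obtain n where "measure lebesgue B < real n * measure lebesgue S"
      using reals_Archimedean3[OF pos] by blast
    then show False using bound[of n] by simp
  qed
  then show ?thesis using negligible_iff_measure0[OF lm] by simp
qed

text \<open>The punctured cone over \<open>C\<close>, taken in both components separately. As
  \<open>sphere_measure\<close> is a cone measure, a Lebesgue-null cone means a null set for the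
  product measure, and Euclidean negligibility arguments become available.\<close>

definition conic_over :: "('a::euclidean_space \<times> 'a) set \<Rightarrow> ('a \<times> 'a) set" where
  "conic_over C = {p. fst p \<in> cball 0 1 - {0} \<and> snd p \<in> cball 0 1 - {0} \<and> (sgn (fst p), sgn (snd p)) \<in> C}"

lemma bounded_conic_over: "bounded (conic_over C)"
  by (rule bounded_subset[of "cball 0 1 \<times> cball 0 1"]) (auto simp: conic_over_def bounded_Times mem_Times_iff)

lemma borel_conic_over:
  fixes C :: "('a::euclidean_space \<times> 'a) set"
  assumes "C \<in> sets borel"
  shows "conic_over C \<in> sets borel"
proof -
  have m: "(\<lambda>p::'a \<times> 'a. (sgn (fst p), sgn (snd p))) \<in> borel_measurable borel"
    by (intro borel_measurable_Pair borel_measurable_sgn[THEN measurable_compose[rotated]] borel_measurable_continuous_onI continuous_intros)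
  have "(\<lambda>p::'a \<times> 'a. (sgn (fst p), sgn (snd p))) -` C \<in> sets borel"
    using measurable_sets[OF m assms] by simp
  moreover have "(cball 0 1 - {0}) \<times> (cball 0 1 - {0}) \<in> sets (borel :: ('a \<times> 'a) measure)"
    by (simp add: borel_prod[symmetric])
  moreover have "conic_over C = (cball 0 1 - {0}) \<times> (cball 0 1 - {0}) \<inter> (\<lambda>p. (sgn (fst p), sgn (snd p))) -` C"
    by (auto simp: conic_over_def)
  ultimately show ?thesis by simp
qed

lemma sets_sphere_measure: "sets sphere_measure = sets (restrict_space borel (sphere 0 1))"
  and space_sphere_measure: "space sphere_measure = sphere 0 1"
  by (simp_all add: sphere_measure_def space_scale_measure space_restrict_space)

lemma emeasure_sphere_measure:
  fixes A :: "'a::euclidean_space set"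
  assumes "A \<in> sets sphere_measure"
  shows "emeasure sphere_measure A = of_nat DIM('a) * emeasure lborel {x \<in> cball 0 1 - {0}. sgn x \<in> A}"
proof -
  let ?R = "restrict_space lborel (cball 0 1 - {0}) :: 'a measure"
  have m: "(\<lambda>x. x /\<^sub>R norm x) \<in> measurable ?R (restrict_space borel (sphere 0 1))"
  proof (rule measurable_restrict_space2)
    have "sgn \<in> borel_measurable ?R" by (rule measurable_restrict_space1) simp
    then show "(\<lambda>x. x /\<^sub>R norm x) \<in> borel_measurable ?R" by (simp add: sgn_div_norm[abs_def])
  qed (auto simp: space_restrict_space)
  have "emeasure (distr ?R (restrict_space borel (sphere 0 1)) (\<lambda>x. x /\<^sub>R norm x)) A
     = emeasure ?R ((\<lambda>x. x /\<^sub>R norm x) -` A \<inter> space ?R)"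
    by (rule emeasure_distr[OF m]) (use assms in \<open>simp add: sets_sphere_measure\<close>)
  also have "\<dots> = emeasure lborel ((\<lambda>x. x /\<^sub>R norm x) -` A \<inter> space ?R)"
    by (rule emeasure_restrict_space) (auto simp: space_restrict_space)
  also have "(\<lambda>x. x /\<^sub>R norm x) -` A \<inter> space ?R = {x \<in> cball 0 1 - {0}. sgn x \<in> A}"
    by (auto simp: space_restrict_space sgn_div_norm)
  finally show ?thesis by (simp add: sphere_measure_def)
qed

lemma finite_sphere_measure: "finite_measure (sphere_measure :: 'a::euclidean_space measure)"
proof (rule finite_measureI)
  have "space sphere_measure \<in> sets (sphere_measure :: 'a measure)" by simp
  then have "emeasure (sphere_measure :: 'a measure) (space sphere_measure)
     = of_nat DIM('a) * emeasure lborel {x \<in> cball 0 1 - {0} :: 'a set. sgn x \<in> space sphere_measure}"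
    by (rule emeasure_sphere_measure)
  also have "\<dots> \<le> of_nat DIM('a) * emeasure lborel (cball 0 1 :: 'a set)"
    by (intro mult_left_mono emeasure_mono) auto
  also have "\<dots> < \<infinity>"
    using emeasure_lborel_cball_finite[of "0::'a" 1] by (simp add: ennreal_mult_less_top of_nat_less_top)
  finally show "emeasure (sphere_measure :: 'a measure) (space sphere_measure) \<noteq> \<infinity>" by simp
qed

text \<open>Fubini is used for Lebesgue measure and for the sphere measure. For nonzero
  \<open>x\<close> in the ball, the slice of the cone at \<open>x\<close> depends only on
  \<open>sgn x\<close>, so the almost-everywhere statement about \<open>x\<close> passes to
  directions.\<close>

lemma AE_sphere_product:
  fixes C :: "('a::euclidean_space \<times> 'a) set"
  assumes C: "C \<in> sets borel" and null: "negligible (conic_over C)"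
  shows "AE p in sphere_measure \<Otimes>\<^sub>M sphere_measure. p \<notin> C"
proof -
  let ?M = "sphere_measure :: 'a measure"
  interpret finite_measure ?M by (rule finite_sphere_measure)
  have id_meas: "(\<lambda>x. x) \<in> measurable ?M borel"
  proof -
    have "(\<lambda>x. x) \<in> measurable (restrict_space borel (sphere 0 1)) (borel :: 'a measure)"
      by (rule measurable_restrict_space1) simp
    then show ?thesis by (simp add: measurable_cong_sets[OF sets_sphere_measure refl])
  qed
  define N where "N = {p \<in> space (?M \<Otimes>\<^sub>M ?M). p \<in> C}"
  have "(\<lambda>p. (fst p, snd p)) \<in> borel_measurable (?M \<Otimes>\<^sub>M ?M)"
    by (intro borel_measurable_Pair measurable_compose[OF measurable_fst id_meas] measurable_compose[OF measurable_snd id_meas])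
  then have N: "N \<in> sets (?M \<Otimes>\<^sub>M ?M)"
    using measurable_sets[OF _ C, of "\<lambda>p. p" "?M \<Otimes>\<^sub>M ?M"] by (simp add: N_def vimage_def Int_def conj_commute)
  have slice: "emeasure ?M (Pair x -` N) = of_nat DIM('a) * emeasure lborel {y \<in> cball 0 1 - {0}. (x, sgn y) \<in> C}"
    if "norm x = 1" for x
  proof -
    have "{y \<in> cball 0 1 - {0}. sgn y \<in> Pair x -` N} = {y \<in> cball 0 1 - {0}. (x, sgn y) \<in> C}"
      using that by (auto simp: N_def space_pair_measure space_sphere_measure norm_sgn)
    then show ?thesis using emeasure_sphere_measure[OF sets_Pair1[OF N, of x]] by simp
  qed
  have "conic_over C \<in> null_sets lborel"
    using null borel_conic_over[OF C] by (simp add: negligible_iff_null_sets null_sets_completion_iff)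
  then have "AE p in lborel \<Otimes>\<^sub>M lborel. p \<notin> conic_over C"
    unfolding lborel_prod by (rule AE_not_in)
  then have AE2: "AE x in lborel. AE y in lborel. (x, y) \<notin> conic_over C"
    by (rule lborel_pair.AE_pair)
  have zero: "emeasure ?M (Pair (sgn x) -` N) = 0"
    if x: "x \<in> cball 0 1 - {0}" and ae: "AE y in lborel. (x, y) \<notin> conic_over C" for x
  proof -
    have "AE y in lborel. \<not> (y \<in> cball 0 1 - {0} \<and> (sgn x, sgn y) \<in> C)"
      using ae by eventually_elim (use x in \<open>auto simp: conic_over_def\<close>)
    from emeasure_eq_0_AE[OF this] show ?thesis using slice[of "sgn x"] x by (auto simp: norm_sgn)
  qed
  \<comment> \<open>Directions whose slice has positive measure; the cone over them consists of
    exceptional \<open>x\<close> of the Lebesgue statement.\<close>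
  define Z where "Z = {x \<in> space ?M. emeasure ?M (Pair x -` N) \<noteq> 0}"
  have Z: "Z \<in> sets ?M"
    unfolding Z_def using measurable_emeasure_Pair[OF N] by measurable
  have "AE x in lborel. \<not> (x \<in> cball 0 1 - {0} \<and> sgn x \<in> Z)"
    using AE2 by eventually_elim (use zero in \<open>auto simp: Z_def\<close>)
  from emeasure_eq_0_AE[OF this] have "emeasure ?M Z = 0"
    unfolding emeasure_sphere_measure[OF Z] by simp
  then have "AE x in ?M. emeasure ?M (Pair x -` N) = 0"
    by (intro AE_I[OF _ _ Z]) (auto simp: Z_def)
  then have "emeasure (?M \<Otimes>\<^sub>M ?M) N = 0"
    unfolding emeasure_pair_measure_alt[OF N]
    using nn_integral_cong_AE[of "\<lambda>x. emeasure ?M (Pair x -` N)" "\<lambda>x. 0" ?M] by simp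
  then show ?thesis by (intro AE_I[OF _ _ N]) (auto simp: N_def)
qed

text \<open>The slice above each \<open>x\<close> lies on the line through \<open>x\<close>. In
  dimension one that line is the whole space, and the diagonal has positive measure.\<close>

lemma negligible_conic_over_diagonal:
  assumes "DIM('a::euclidean_space) \<ge> 2"
  shows "negligible (conic_over {p :: 'a \<times> 'a. fst p = snd p})"
proof -
  have "closed {p :: 'a \<times> 'a. fst p = snd p}" by (intro closed_Collect_eq continuous_intros)
  then have borel: "conic_over {p :: 'a \<times> 'a. fst p = snd p} \<in> sets borel" (is "?D \<in> _")
    by (intro borel_conic_over borel_closed)
  have "emeasure lborel (Pair x -` ?D) = 0" for x
  proof -
    have "Pair x -` ?D \<subseteq> span {x}"
    proof
      fix y assume "y \<in> Pair x -` ?D"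
      then have "y \<noteq> 0" "sgn x = sgn y" by (auto simp: conic_over_def)
      then have "y = norm y *\<^sub>R sgn x" by (metis norm_eq_zero scaleR_one scaleR_scaleR sgn_div_norm right_inverse)
      then have "y = (norm y * inverse (norm x)) *\<^sub>R x" by (simp add: sgn_div_norm)
      then show "y \<in> span {x}" by (metis span_base span_scale singletonI)
    qed
    moreover have "negligible (span {x})"
    proof (rule negligible_lowdim)
      have "dim (span {x}) \<le> card {x}" unfolding dim_span by (rule dim_le_card') simp
      then show "dim (span {x}) < DIM('a)" using assms by simp
    qed
    ultimately have "negligible (Pair x -` ?D)" by (meson negligible_subset)
    moreover have "Pair x -` ?D \<in> sets borel"
    proof -
      have "Pair x \<in> borel_measurable (borel :: 'a measure)" by (intro borel_measurable_continuous_onI continuous_intros)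
      from measurable_sets[OF this borel] show ?thesis by simp
    qed
    ultimately show ?thesis by (simp add: negligible_iff_null_sets null_sets_completion_iff null_sets_def)
  qed
  then have "emeasure (lborel \<Otimes>\<^sub>M lborel) ?D = 0"
  proof (subst lborel.emeasure_pair_measure_alt)
    show "?D \<in> sets (lborel \<Otimes>\<^sub>M lborel)" unfolding lborel_prod using borel by simp
  qed simp
  then have "?D \<in> null_sets lborel" using borel by (auto simp: lborel_prod)
  then show ?thesis using borel by (simp add: negligible_iff_null_sets null_sets_completion_iff)
qed

text \<open>The constant degenerates at the origin, so images of cones are treated by locally
  Lipschitz estimates.\<close>

lemma norm_sgn_diff_le:
  fixes x y :: "'a::real_normed_vector"
  assumes "x \<noteq> 0"
  shows "norm (sgn y - sgn x) \<le> 2 / norm x * norm (y - x)"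
proof -
  have "norm x *\<^sub>R (sgn y - sgn x) = (y - x) - (norm y - norm x) *\<^sub>R sgn y"
    by (cases "y = 0") (auto simp: sgn_div_norm algebra_simps assms)
  then have "norm x * norm (sgn y - sgn x) = norm ((y - x) - (norm y - norm x) *\<^sub>R sgn y)"
    by (metis abs_norm_cancel norm_scaleR)
  also have "\<dots> \<le> norm (y - x) + \<bar>norm y - norm x\<bar> * norm (sgn y)"
    using norm_triangle_ineq4[of "y - x" "(norm y - norm x) *\<^sub>R sgn y"] by simp
  also have "\<dots> \<le> norm (y - x) + norm (y - x) * 1"
    by (intro add_mono mult_mono norm_triangle_ineq3) (auto simp: norm_sgn)
  finally show ?thesis using assms by (simp add: field_simps)
qed

text \<open>The map \<open>\<psi>\<close> is extended to cones by keeping both radii. At each point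
  \<open>p\<close> the extension satisfies a Lipschitz estimate with a constant depending on
  \<open>p\<close>, which is enough to preserve null sets.\<close>

lemma negligible_conic_over_image:
  fixes A B :: "('a::euclidean_space \<times> 'a) set"
  assumes null: "negligible (conic_over A)" and A: "A \<subseteq> sphere 0 1 \<times> sphere 0 1"
    and \<psi>: "\<psi> ` A \<subseteq> sphere 0 1 \<times> sphere 0 1" and B: "B \<subseteq> \<psi> ` A"
    and lip: "\<And>z w. z \<in> A \<Longrightarrow> w \<in> A \<Longrightarrow> norm (\<psi> z - \<psi> w) \<le> K * norm (z - w)" and K: "K \<ge> 0"
  shows "negligible (conic_over B)"
proof -
  define \<pi> where "\<pi> p = (sgn (fst p), sgn (snd p))" for p :: "'a \<times> 'a"
  define \<Psi> where "\<Psi> p = (norm (fst p) *\<^sub>R fst (\<psi> (\<pi> p)), norm (snd p) *\<^sub>R snd (\<psi> (\<pi> p)))" for p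
  have "negligible (\<Psi> ` conic_over A)"
  proof (rule negligible_locally_Lipschitz_image[OF order_refl null])
    fix p assume p: "p \<in> conic_over A"
    then have p': "fst p \<noteq> 0" "snd p \<noteq> 0" "norm (fst p) \<le> 1" "norm (snd p) \<le> 1" "\<pi> p \<in> A"
      by (auto simp: conic_over_def \<pi>_def)
    define c where "c = 2 / norm (fst p) + 2 / norm (snd p)"
    have c: "c \<ge> 0" by (simp add: c_def)
    have "norm (\<Psi> q - \<Psi> p) \<le> (2 + 2 * (K * c)) * norm (q - p)" if "q \<in> conic_over A" for q
    proof -
      have qA: "\<pi> q \<in> A" using that by (auto simp: conic_over_def \<pi>_def)
      have fs: "norm (fst r) \<le> norm r" "norm (snd r) \<le> norm r" for r :: "'a \<times> 'a"
        using norm_fst_le[of "fst r" "snd r"] norm_snd_le[of "snd r" "fst r"] by simp_all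
      have "norm (\<pi> q - \<pi> p) \<le> norm (sgn (fst q) - sgn (fst p)) + norm (sgn (snd q) - sgn (snd p))"
        unfolding \<pi>_def by (simp add: norm_Pair_le)
      also have "\<dots> \<le> 2 / norm (fst p) * norm (fst q - fst p) + 2 / norm (snd p) * norm (snd q - snd p)"
        by (intro add_mono norm_sgn_diff_le p')
      also have "\<dots> \<le> 2 / norm (fst p) * norm (q - p) + 2 / norm (snd p) * norm (q - p)"
        using fs[of "q - p"] by (intro add_mono mult_left_mono) auto
      finally have "norm (\<pi> q - \<pi> p) \<le> c * norm (q - p)" by (simp add: c_def algebra_simps)
      then have d\<psi>: "norm (\<psi> (\<pi> q) - \<psi> (\<pi> p)) \<le> K * c * norm (q - p)"
        using order_trans[OF lip[OF qA p'(5)] mult_left_mono[OF _ K]] by (simp add: mult.assoc)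
      \<comment> \<open>One component: a change of radius times a unit vector, plus a radius at most
        1 times a change of direction.\<close>
      have comp: "norm (norm u *\<^sub>R a - norm v *\<^sub>R b) \<le> (1 + K * c) * norm (q - p)"
        if "norm a = 1" "norm v \<le> 1" "norm (u - v) \<le> norm (q - p)" "norm (a - b) \<le> norm (\<psi> (\<pi> q) - \<psi> (\<pi> p))"
        for u v a b :: 'a
      proof -
        have "norm u *\<^sub>R a - norm v *\<^sub>R b = (norm u - norm v) *\<^sub>R a + norm v *\<^sub>R (a - b)"
          by (simp add: algebra_simps)
        also have "norm \<dots> \<le> norm (q - p) + 1 * (K * c * norm (q - p))"
        proof (rule norm_triangle_mono)
          show "norm ((norm u - norm v) *\<^sub>R a) \<le> norm (q - p)"
            using that norm_triangle_ineq3[of u v] by simp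
          show "norm (norm v *\<^sub>R (a - b)) \<le> 1 * (K * c * norm (q - p))"
            unfolding norm_scaleR using that d\<psi> by (intro mult_mono) auto
        qed
        finally show ?thesis by (simp add: algebra_simps)
      qed
      have unit: "norm (fst (\<psi> (\<pi> q))) = 1" "norm (snd (\<psi> (\<pi> q))) = 1"
        using \<psi> qA by (auto simp: image_subset_iff mem_Times_iff)
      have "norm (\<Psi> q - \<Psi> p) \<le> norm (norm (fst q) *\<^sub>R fst (\<psi> (\<pi> q)) - norm (fst p) *\<^sub>R fst (\<psi> (\<pi> p)))
          + norm (norm (snd q) *\<^sub>R snd (\<psi> (\<pi> q)) - norm (snd p) *\<^sub>R snd (\<psi> (\<pi> p)))"
        unfolding \<Psi>_def by (simp add: norm_Pair_le)
      also have "\<dots> \<le> (1 + K * c) * norm (q - p) + (1 + K * c) * norm (q - p)"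
        by (intro add_mono comp unit p')
          (use fs[of "q - p"] fs[of "\<psi> (\<pi> q) - \<psi> (\<pi> p)"] in auto)
      finally show ?thesis by (simp add: algebra_simps)
    qed
    then show "\<exists>T L. open T \<and> p \<in> T \<and> (\<forall>q \<in> conic_over A \<inter> T. norm (\<Psi> q - \<Psi> p) \<le> L * norm (q - p))"
      by (intro exI[of _ UNIV] exI[of _ "2 + 2 * (K * c)"]) auto
  qed
  moreover have "conic_over B \<subseteq> \<Psi> ` conic_over A"
  proof
    fix p assume p: "p \<in> conic_over B"
    then have p': "fst p \<noteq> 0" "snd p \<noteq> 0" "norm (fst p) \<le> 1" "norm (snd p) \<le> 1" "\<pi> p \<in> B"
      by (auto simp: conic_over_def \<pi>_def)
    then obtain w where w: "w \<in> A" "\<psi> w = \<pi> p" using B by (metis imageE subsetD)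
    have nw: "norm (fst w) = 1" "norm (snd w) = 1" using A w by (auto simp: mem_Times_iff)
    define q where "q = (norm (fst p) *\<^sub>R fst w, norm (snd p) *\<^sub>R snd w)"
    have \<pi>q: "\<pi> q = w" using p' nw by (simp add: \<pi>_def q_def sgn_div_norm)
    have "q \<in> conic_over A"
      using p' nw w(1) \<pi>q by (auto simp: conic_over_def \<pi>_def q_def)
    moreover have "\<Psi> q = p"
      unfolding \<Psi>_def \<pi>q w(2) using nw p' by (simp add: q_def \<pi>_def sgn_div_norm)
    ultimately show "p \<in> \<Psi> ` conic_over A" by force
  qed
  ultimately show ?thesis by (rule negligible_subset)
qed

text \<open>Both vectors share the component \<open>W\<close> orthogonal to \<open>e\<close>, so
  their normalizations lie on one half circle, with coordinates \<open>c > 0\<close> along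
  \<open>W\<close> and \<open>s\<close> along \<open>e\<close>. Near the equator
  \<open>s = 0\<close> this half circle runs mostly in direction \<open>e\<close>. The lemma carries
  a straight translation over to the sphere.\<close>

lemma sgn_line_in_cone:
  fixes X e :: "'a::real_inner"
  assumes e: "norm e = 1" and X: "X \<noteq> 0" "X + \<tau> *\<^sub>R e \<noteq> 0" and \<tau>: "\<tau> \<noteq> 0"
    and small: "\<bar>sgn X \<bullet> e\<bar> \<le> 1 / 4" "\<bar>sgn (X + \<tau> *\<^sub>R e) \<bullet> e\<bar> \<le> 1 / 4"
  shows "(norm (sgn (X + \<tau> *\<^sub>R e) - sgn X))\<^sup>2 < 2 * ((sgn (X + \<tau> *\<^sub>R e) - sgn X) \<bullet> e)\<^sup>2"
proof -
  have ee: "e \<bullet> e = 1" using e by (simp add: norm_eq_1)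
  define X' where "X' = X + \<tau> *\<^sub>R e"
  define W where "W = X - (X \<bullet> e) *\<^sub>R e"
  have We: "W \<bullet> e = 0" "e \<bullet> W = 0" by (simp_all add: W_def inner_diff_left inner_diff_right inner_commute ee)
  have XW: "X = W + (X \<bullet> e) *\<^sub>R e" by (simp add: W_def)
  have XW': "X' = W + (X' \<bullet> e) *\<^sub>R e" by (simp add: W_def X'_def inner_add_left ee algebra_simps)
  define a b s s' c c' where "a = 1 / norm X" and "b = 1 / norm X'" and "s = sgn X \<bullet> e" and "s' = sgn X' \<bullet> e"
    and "c = a * norm W" and "c' = b * norm W"
  have ab: "a > 0" "b > 0" using X by (auto simp: a_def b_def X'_def)
  have sg: "sgn X = a *\<^sub>R W + s *\<^sub>R e" "sgn X' = b *\<^sub>R W + s' *\<^sub>R e"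
  proof -
    have "sgn X = a *\<^sub>R X" "sgn X' = b *\<^sub>R X'" by (simp_all add: sgn_div_norm a_def b_def inverse_eq_divide)
    then show "sgn X = a *\<^sub>R W + s *\<^sub>R e" "sgn X' = b *\<^sub>R W + s' *\<^sub>R e"
      using XW XW' by (auto simp: s_def s'_def) (metis scaleR_add_right scaleR_scaleR)+
  qed
  have sq: "(norm (k *\<^sub>R W + r *\<^sub>R e))\<^sup>2 = (k * norm W)\<^sup>2 + r\<^sup>2" for k r
    unfolding power_mult_distrib power2_norm_eq_inner
    by (simp add: inner_add_left inner_add_right We ee power2_eq_square)
  have unit: "c\<^sup>2 + s\<^sup>2 = 1" "c'\<^sup>2 + s'\<^sup>2 = 1"
    using sq[of a s] sq[of b s'] X by (auto simp: c_def c'_def norm_sgn X'_def simp flip: sg)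
  have diff: "sgn X' - sgn X = (b - a) *\<^sub>R W + (s' - s) *\<^sub>R e" unfolding sg by (simp add: algebra_simps)
  have n2: "(norm (sgn X' - sgn X))\<^sup>2 = (c' - c)\<^sup>2 + (s' - s)\<^sup>2"
    unfolding diff sq by (simp add: c_def c'_def algebra_simps)
  have ie: "(sgn X' - sgn X) \<bullet> e = s' - s" unfolding diff by (simp add: inner_add_left We ee)
  have c0: "c \<ge> 0" "c' \<ge> 0" using ab by (auto simp: c_def c'_def)
  have ss: "s\<^sup>2 \<le> 1 / 16" "s'\<^sup>2 \<le> 1 / 16"
    using abs_le_square_iff[of s "1/4"] abs_le_square_iff[of s' "1/4"] small
    by (auto simp: s_def s'_def X'_def power2_eq_square)
  have ch: "c \<ge> 1 / 2" "c' \<ge> 1 / 2"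
  proof -
    have "(1 / 2)\<^sup>2 \<le> c\<^sup>2" "(1 / 2)\<^sup>2 \<le> c'\<^sup>2" using unit ss by (simp_all add: power_divide)
    then show "c \<ge> 1 / 2" "c' \<ge> 1 / 2" using c0 power2_le_imp_le by blast+
  qed
  \<comment> \<open>Equal \<open>s\<close> would give equal \<open>c\<close>, hence equal norms and
    equal \<open>e\<close>-components of \<open>X\<close> and \<open>X'\<close>, contradicting
    \<open>\<tau> \<noteq> 0\<close>.\<close>
  have ne: "s \<noteq> s'"
  proof
    assume "s = s'"
    then have "c = c'" using unit c0 by (metis add_right_cancel power2_eq_iff_nonneg)
    then have "a = b" using ch by (auto simp: c_def c'_def)
    have "a * (X \<bullet> e) = b * (X' \<bullet> e)" using \<open>s = s'\<close>
      by (simp add: s_def s'_def a_def b_def sgn_div_norm inverse_eq_divide)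
    then have "X \<bullet> e = X' \<bullet> e" using \<open>a = b\<close> ab by simp
    then show False using \<tau> by (simp add: X'_def inner_add_left ee)
  qed
  \<comment> \<open>The two unit circle equations are subtracted. Since
    \<open>c + c' \<ge> 1\<close> while \<open>\<bar>s + s'\<bar> < 1\<close>, the coordinate
    \<open>c\<close> changes less than \<open>s\<close>.\<close>
  have "(c' - c) * (c' + c) = - ((s' - s) * (s' + s))"
    using unit by (simp add: algebra_simps power2_eq_square)
  then have "(c' - c)\<^sup>2 * (c' + c)\<^sup>2 = (s' - s)\<^sup>2 * (s' + s)\<^sup>2"
    by (metis power2_minus power_mult_distrib)
  moreover have "(c' - c)\<^sup>2 * 1 \<le> (c' - c)\<^sup>2 * (c' + c)\<^sup>2"
    using ch by (intro mult_left_mono) (auto intro!: one_le_power)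
  moreover have "(s' - s)\<^sup>2 * (s' + s)\<^sup>2 < (s' - s)\<^sup>2 * 1"
  proof (rule mult_strict_left_mono)
    have "(s' + s)\<^sup>2 \<le> 2 * s\<^sup>2 + 2 * s'\<^sup>2"
      using sum_squares_bound[of s s'] by (simp add: power2_sum algebra_simps)
    then show "(s' + s)\<^sup>2 < 1" using ss by linarith
  qed (use ne in auto)
  ultimately have "(c' - c)\<^sup>2 < (s' - s)\<^sup>2" by linarith
  then show ?thesis using n2 ie by (simp add: X'_def)
qed

text \<open>Two points of \<open>conic_over A\<close> on a line in direction \<open>(e, 0)\<close>
  share the second component, and \<open>sgn_line_in_cone\<close> puts the difference of their
  normalized first components into the region excluded by the last hypothesis. So the translates
  along that direction are disjoint.\<close>

lemma negligible_conic_over_cone: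
  fixes A :: "('a::euclidean_space \<times> 'a) set"
  assumes A: "A \<in> sets borel" and e: "norm e = 1"
    and small: "\<And>x y. (x, y) \<in> A \<Longrightarrow> \<bar>x \<bullet> e\<bar> \<le> 1 / 4"
    and cone: "\<And>x x' y. (x, y) \<in> A \<Longrightarrow> (x', y) \<in> A \<Longrightarrow> \<not> (norm (x' - x))\<^sup>2 < 2 * ((x' - x) \<bullet> e)\<^sup>2"
  shows "negligible (conic_over A)"
proof (rule negligible_of_disjoint_translates[where v = "(e, 0)"])
  show "bounded (conic_over A)" by (rule bounded_conic_over)
  show "conic_over A \<in> sets lebesgue" using borel_conic_over[OF A] by (simp add: sets_completionI_sets)
  fix p \<tau> assume p: "p \<in> conic_over A" and p': "p + \<tau> *\<^sub>R (e, 0) \<in> conic_over A"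
  show "\<tau> = 0"
  proof (rule ccontr)
    assume \<tau>: "\<tau> \<noteq> 0"
    have 1: "fst p \<noteq> 0" "(sgn (fst p), sgn (snd p)) \<in> A" using p by (auto simp: conic_over_def)
    have 2: "fst p + \<tau> *\<^sub>R e \<noteq> 0" "(sgn (fst p + \<tau> *\<^sub>R e), sgn (snd p)) \<in> A" using p' by (auto simp: conic_over_def)
    from sgn_line_in_cone[OF e 1(1) 2(1) \<tau> small[OF 1(2)] small[OF 2(2)]] cone[OF 1(2) 2(2)]
    show False by simp
  qed
qed

section \<open>Equilibria and energy\<close>

lemma unit_vectors_inner_eq_1:
  fixes x y :: "'a::real_inner"
  assumes "norm x = 1" "norm y = 1" "x \<bullet> y = 1"
  shows "x = y"
proof -
  have "(norm (x - y))\<^sup>2 = 0"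
    using assms by (simp add: power2_norm_eq_inner inner_diff inner_commute norm_eq_1)
  then show ?thesis by simp
qed

lemma inner_le_of_norm:
  fixes u v :: "'a::real_inner"
  assumes "norm v \<le> \<epsilon>"
  shows "\<bar>u \<bullet> v\<bar> \<le> \<epsilon> * norm u"
  using Cauchy_Schwarz_ineq2[of u v] mult_left_mono[OF assms, of "norm u"] by (simp add: mult.commute)

text \<open>A chord meets its own end points only to second order; this is what removes the
  first-order terms in \<open>field_linearization\<close>.\<close>

lemma inner_diff_unit_vectors:
  fixes u v :: "'a::real_inner"
  assumes "norm u = 1" "norm v = 1"
  shows "(v - u) \<bullet> v = (norm (v - u))\<^sup>2 / 2" "(v - u) \<bullet> u = - ((norm (v - u))\<^sup>2 / 2)"
  using assms unfolding norm_eq_1 power2_norm_eq_inner by (auto simp: field_simps inner_diff_left inner_diff_right inner_commute)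

lemma infdist_pm1_le: "infdist s {-1, 1} \<le> \<bar>1 - s\<^sup>2\<bar>" for s :: real
proof -
  have fac: "\<bar>1 - s\<^sup>2\<bar> = \<bar>1 - s\<bar> * \<bar>1 + s\<bar>" by (simp add: power2_eq_square algebra_simps flip: abs_mult)
  show ?thesis
  proof (cases "s \<ge> 0")
    case True
    have "infdist s {-1, 1} \<le> dist s 1" by (rule infdist_le) simp
    also have "\<dots> = \<bar>1 - s\<bar> * 1" by (simp add: dist_real_def abs_minus_commute)
    also have "\<dots> \<le> \<bar>1 - s\<bar> * \<bar>1 + s\<bar>" using True by (intro mult_left_mono) auto
    finally show ?thesis using fac by simp
  next
    case False
    have "infdist s {-1, 1} \<le> dist s (-1)" by (rule infdist_le) simp
    also have "\<dots> = 1 * \<bar>1 + s\<bar>" by (simp add: dist_real_def add.commute)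
    also have "\<dots> \<le> \<bar>1 - s\<bar> * \<bar>1 + s\<bar>" using False by (intro mult_right_mono) auto
    finally show ?thesis using fac by simp
  qed
qed

text \<open>In the application \<open>P\<close>, \<open>R\<close>, \<open>b\<close>,
  \<open>n\<close>, \<open>p\<close> are \<open>- (x \<bullet> (V *v x))\<close>,
  \<open>- (y \<bullet> (V *v y))\<close>, \<open>x \<bullet> (V *v y)\<close>,
  \<open>- (x \<bullet> y)\<close> and the weight at \<open>x\<close>, and \<open>eq\<close> says
  that the field at \<open>x\<close> is orthogonal to \<open>y\<close>. If
  \<open>\<bar>n\<bar> < 1\<close>, then \<open>R - b * n\<close> is positive and at least
  \<open>b - P * n\<close>, which rules out \<open>p < 1 / 2\<close>; the remaining case
  \<open>b \<le> - P\<close> forces \<open>n < - 1\<close>.\<close>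

lemma inner_equilibrium_real:
  fixes P R b n p :: real
  assumes P: "P > 0" and PR: "P \<le> R" and b: "b\<^sup>2 \<le> P * R" and n: "\<bar>n\<bar> \<le> 1"
    and p: "0 < p" "p < 1" "P + b > 0 \<Longrightarrow> p < 1 / 2"
    and eq: "p * (b - P * n) = (1 - p) * (R - b * n)"
  shows "\<bar>n\<bar> = 1"
proof (rule ccontr)
  assume "\<bar>n\<bar> \<noteq> 1"
  then have n1: "\<bar>n\<bar> < 1" using n by simp
  have R: "R > 0" using P PR by simp
  have "P * R \<le> R\<^sup>2" using mult_right_mono[OF PR, of R] R by (simp add: power2_eq_square)
  then have "b\<^sup>2 \<le> R\<^sup>2" using b by linarith
  then have bR: "\<bar>b\<bar> \<le> R" using R by (simp add: abs_le_square_iff[symmetric])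
  have "\<bar>b * n\<bar> < R"
    using mult_right_mono[OF bR, of "\<bar>n\<bar>"] mult_strict_left_mono[OF n1 R]
    unfolding abs_mult mult_1_right by (rule le_less_trans) simp
  then have pos: "R - b * n > 0" by linarith
  then have "p * (b - P * n) > 0" unfolding eq using p by simp
  then have pos': "b - P * n > 0" using p by (simp add: zero_less_mult_iff)
  have PbR: "P + R - 2 * b \<ge> 0"
  proof -
    have "(2 * b)\<^sup>2 \<le> (P + R)\<^sup>2"
      using b sum_squares_ge_zero[of "P - R" 0] by (simp add: power2_eq_square algebra_simps)
    then show ?thesis using abs_le_square_iff[of "2 * b" "P + R"] P R by linarith
  qed
  \<comment> \<open>An affine function of \<open>n\<close>, written as the interpolation of its
    values \<open>R - P\<close> at -1 and \<open>P + R - 2 * b\<close> at 1.\<close>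
  have "R - b * n - (b - P * n) = (1 + n) / 2 * (P + R - 2 * b) + (1 - n) / 2 * (R - P)"
    by (simp add: field_simps)
  also have "\<dots> \<ge> 0" using n1 PbR PR by (intro add_nonneg_nonneg mult_nonneg_nonneg) auto
  finally have le: "b - P * n \<le> R - b * n" by simp
  show False
  proof (cases "P + b > 0")
    case True
    have "p * (b - P * n) \<le> p * (R - b * n)" using le p by (intro mult_left_mono) auto
    also have "\<dots> < (1 - p) * (R - b * n)" using p(3)[OF True] pos by (intro mult_strict_right_mono) auto
    finally show False using eq by simp
  next
    case False
    then have "P * n < P * (-1)" using pos' by simp
    then have "n < - 1" using P mult_less_cancel_left_pos by blast
    then show False using n by linarith
  qed
qed

text \<open>Spectral facts replace the eigenbasis: in the application \<open>\<mu>\<close> and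
  \<open>\<mu>2\<close> are the negatives of the smallest and the second smallest eigenvalue,
  \<open>form_le\<close> is the spectral gap in terms of the form, and \<open>\<Lambda>\<close>
  consists of the negatives of all eigenvalues.\<close>

locale attn_system =
  fixes \<beta> :: real and V :: "real^'n^'n" and ed :: "real^'n" and \<mu> \<mu>2 :: real and \<Lambda> :: "real set"
  assumes beta_pos: "\<beta> > 0"
    and sym: "x \<bullet> (V *v y) = (V *v x) \<bullet> y"
    and negdef: "x \<noteq> 0 \<Longrightarrow> x \<bullet> (V *v x) < 0"
    and norm_ed: "norm ed = 1" and eigen_ed: "V *v ed = - \<mu> *\<^sub>R ed"
    and gap: "\<mu>2 < \<mu>"
    and form_le: "- (v \<bullet> (V *v v)) \<le> \<mu> * (v \<bullet> ed)\<^sup>2 + \<mu>2 * (v \<bullet> v - (v \<bullet> ed)\<^sup>2)"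
    and fin: "finite \<Lambda>"
    and \<Lambda>_cases: "m \<in> \<Lambda> \<Longrightarrow> m = \<mu> \<or> 0 < m \<and> m \<le> \<mu>2"
    and eigenvalue: "x \<noteq> 0 \<Longrightarrow> V *v x = - m *\<^sub>R x \<Longrightarrow> m \<in> \<Lambda>"
begin

lemma negsemidef: "x \<bullet> (V *v x) \<le> 0"
  using negdef[of x] by (cases "x = 0") auto

lemma negdef_unit: "norm x = 1 \<Longrightarrow> x \<bullet> (V *v x) < 0"
  by (rule negdef) auto

lemma neg_right: "V *v (- x) = - (V *v x)"
  by (rule linear_neg[OF matrix_vector_mul_linear])

lemma sym': "x \<bullet> (V *v y) = y \<bullet> (V *v x)"
  by (metis sym inner_commute)

lemma form_diff: "(x - y) \<bullet> (V *v (x - y)) = x \<bullet> (V *v x) + y \<bullet> (V *v y) - 2 * (x \<bullet> (V *v y))"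
  using sym'[of y x] by (simp add: matrix_vector_mult_diff_distrib inner_diff_left inner_diff_right)

lemma form_cauchy_schwarz:
  "(x \<bullet> (V *v y))\<^sup>2 \<le> (x \<bullet> (V *v x)) * (y \<bullet> (V *v y))"
proof (cases "y = 0")
  case False
  define c where "c = - (y \<bullet> (V *v y))"
  have c: "c > 0" using negdef[OF False] by (simp add: c_def)
  define t where "t = (x \<bullet> (V *v y)) / (y \<bullet> (V *v y))"
  have t: "t * (y \<bullet> (V *v y)) = x \<bullet> (V *v y)" using c by (simp add: t_def c_def)
  have "0 \<ge> (x - t *\<^sub>R y) \<bullet> (V *v (x - t *\<^sub>R y))" by (rule negsemidef)
  also have "(x - t *\<^sub>R y) \<bullet> (V *v (x - t *\<^sub>R y))
     = x \<bullet> (V *v x) + t * (t * (y \<bullet> (V *v y))) - 2 * t * (x \<bullet> (V *v y))"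
    unfolding form_diff by (simp add: matrix_vector_mult_scaleR)
  also have "\<dots> = x \<bullet> (V *v x) - t * (x \<bullet> (V *v y))" unfolding t by simp
  finally have "c * (x \<bullet> (V *v x)) \<le> c * (t * (x \<bullet> (V *v y)))" using c by (intro mult_left_mono) auto
  also have "\<dots> = - (t * (y \<bullet> (V *v y)) * (x \<bullet> (V *v y)))" by (simp add: c_def)
  also have "\<dots> = - (x \<bullet> (V *v y))\<^sup>2" unfolding t by (simp add: power2_eq_square)
  finally show ?thesis by (simp add: c_def mult.commute)
qed simp

lemma form_bounded: "\<exists>K>0. \<forall>x y. norm x = 1 \<longrightarrow> norm y = 1 \<longrightarrow> \<bar>x \<bullet> (V *v y)\<bar> \<le> K"
proof -
  obtain K where K: "K > 0" "\<And>v. norm (V *v v) \<le> norm v * K"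
    using bounded_linear.pos_bounded[OF matrix_vector_mul_bounded_linear[of V]] by blast
  have "\<bar>x \<bullet> (V *v y)\<bar> \<le> K" if "norm x = 1" "norm y = 1" for x y
    using Cauchy_Schwarz_ineq2[of x "V *v y"] K(2)[of y] that by simp
  then show ?thesis using K(1) by blast
qed

lemma weight_less_half:
  assumes "x \<bullet> (V *v x) < x \<bullet> (V *v y)"
  shows "attn_weight \<beta> V x y < 1 / 2"
  using assms beta_pos by (simp add: attn_weight_def field_simps add_pos_nonneg)

text \<open>The two exponents add up to \<open>- \<beta>\<close> times the form at
  \<open>x - y\<close>, which is nonnegative, and two logistic values have sum at most 1 exactly
  when the product of the exponentials is at least 1. This gives the sign of the extra term in
  \<open>overlap_derivative\<close>.\<close>

lemma weight_sum_le: "attn_weight \<beta> V x y + attn_weight \<beta> V y x \<le> 1"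
proof -
  define s t where "s = \<beta> * (x \<bullet> (V *v y) - x \<bullet> (V *v x))" and "t = \<beta> * (y \<bullet> (V *v x) - y \<bullet> (V *v y))"
  have "s + t = \<beta> * (- ((x - y) \<bullet> (V *v (x - y))))"
    unfolding form_diff s_def t_def using sym'[of y x] by (simp add: algebra_simps)
  also have "\<dots> \<ge> 0" using beta_pos negsemidef[of "x - y"] by (intro mult_nonneg_nonneg) auto
  finally have "1 \<le> exp s * exp t" by (simp flip: exp_add)
  moreover have "1 / (1 + exp s) + 1 / (1 + exp t) = (2 + exp s + exp t) / ((1 + exp s) * (1 + exp t))"
    by (simp add: add_frac_eq add_pos_pos[THEN less_imp_neq, THEN not_sym])
  moreover have "(1 + exp s) * (1 + exp t) > 0" by (simp add: add_pos_pos)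
  ultimately have "1 / (1 + exp s) + 1 / (1 + exp t) \<le> 1"
    by (simp add: pos_divide_le_eq algebra_simps)
  then show ?thesis by (simp add: attn_weight_def s_def t_def)
qed

lemma inner_field_other:
  "attn_field \<beta> V x y \<bullet> y = attn_weight \<beta> V x y * (x \<bullet> (V *v y)) + (1 - attn_weight \<beta> V x y) * (y \<bullet> (V *v y))
     - attn_rate \<beta> V x y * (x \<bullet> y)"
  by (simp add: attn_field_eq inner_diff_left inner_add_left sym inner_commute[of y])

lemma equilibrium_inner:
  assumes x: "norm x = 1" and y: "norm y = 1"
    and eq: "attn_field \<beta> V x y = 0" "attn_field \<beta> V y x = 0"
  shows "\<bar>x \<bullet> y\<bar> = 1"
proof -
  \<comment> \<open>By symmetry the particle with the larger value of the form is called
    \<open>x\<close>; its equation alone suffices.\<close>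
  have *: "\<bar>x \<bullet> y\<bar> = 1" if x: "norm x = 1" and y: "norm y = 1"
    and eq: "attn_field \<beta> V x y = 0" and le: "y \<bullet> (V *v y) \<le> x \<bullet> (V *v x)" for x y
  proof -
    have "\<bar>- (x \<bullet> y)\<bar> = 1"
    proof (rule inner_equilibrium_real)
      show "0 < - (x \<bullet> (V *v x))" using negdef_unit[OF x] by simp
      show "- (x \<bullet> (V *v x)) \<le> - (y \<bullet> (V *v y))" using le by simp
      show "(x \<bullet> (V *v y))\<^sup>2 \<le> - (x \<bullet> (V *v x)) * - (y \<bullet> (V *v y))"
        using form_cauchy_schwarz by simp
      show "\<bar>- (x \<bullet> y)\<bar> \<le> 1" using Cauchy_Schwarz_ineq2[of x y] x y by simp
      show "attn_weight \<beta> V x y < 1 / 2" if "- (x \<bullet> (V *v x)) + x \<bullet> (V *v y) > 0"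
        using weight_less_half that by simp
      have "attn_field \<beta> V x y \<bullet> y = 0" using eq by simp
      then show "attn_weight \<beta> V x y * (x \<bullet> (V *v y) - - (x \<bullet> (V *v x)) * - (x \<bullet> y)) =
          (1 - attn_weight \<beta> V x y) * (- (y \<bullet> (V *v y)) - x \<bullet> (V *v y) * - (x \<bullet> y))"
        unfolding inner_field_other attn_rate_def by (simp add: algebra_simps)
    qed (rule attn_weight_pos attn_weight_less_1)+
    then show ?thesis by simp
  qed
  show ?thesis
    using *[OF x y eq(1)] *[OF y x eq(2)] by (cases "y \<bullet> (V *v y) \<le> x \<bullet> (V *v x)") (auto simp: inner_commute)
qed

lemma equilibrium_eigenvector:
  assumes x: "norm x = 1" and y: "norm y = 1"
    and eq: "attn_field \<beta> V x y = 0" "attn_field \<beta> V y x = 0"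
  shows "V *v x = (x \<bullet> (V *v x)) *\<^sub>R x"
proof -
  have xx: "x \<bullet> x = 1" using x by (simp add: norm_eq_1)
  have "\<exists>k. V *v x = k *\<^sub>R x"
  proof (cases "x \<bullet> y = 1")
    case True
    then have "y = x" using unit_vectors_inner_eq_1[OF x y] by simp
    then have "attn_field \<beta> V x x = 0" using eq by simp
    then show ?thesis unfolding attn_field_eq by (auto simp: algebra_simps)
  next
    case False
    then have "x \<bullet> y = - 1" using equilibrium_inner[OF assms] by linarith
    then have "x = - y" using unit_vectors_inner_eq_1[of x "- y"] x y by simp
    then have y: "y = - x" by simp
    define p where "p = attn_weight \<beta> V x y"
    \<comment> \<open>At an antipodal pair the weighted average is
      \<open>(2 * p - 1) *\<^sub>R (V *v x)\<close>; the bound on \<open>p\<close> lets this factor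
      be cancelled.\<close>
    have "p < 1 / 2" unfolding p_def
      by (rule weight_less_half) (use negdef_unit[OF x] in \<open>auto simp: y neg_right\<close>)
    have "p *\<^sub>R (V *v x) + (1 - p) *\<^sub>R (V *v y) = attn_rate \<beta> V x y *\<^sub>R x"
      using eq(1) unfolding attn_field_eq p_def by (simp only: right_minus_eq)
    moreover have "(2 * p - 1) *\<^sub>R (V *v x) = p *\<^sub>R (V *v x) + (1 - p) *\<^sub>R (V *v y)"
    proof -
      have "p *\<^sub>R (V *v x) + (1 - p) *\<^sub>R (V *v y) = (p - (1 - p)) *\<^sub>R (V *v x)"
        unfolding y neg_right scaleR_left_diff_distrib[of p] by simp
      then show ?thesis by simp
    qed
    ultimately have "(2 * p - 1) *\<^sub>R (V *v x) = attn_rate \<beta> V x y *\<^sub>R x" by (simp only:)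
    then have "(1 / (2 * p - 1)) *\<^sub>R ((2 * p - 1) *\<^sub>R (V *v x)) = (1 / (2 * p - 1)) *\<^sub>R (attn_rate \<beta> V x y *\<^sub>R x)"
      by (simp only:)
    then have "V *v x = (attn_rate \<beta> V x y / (2 * p - 1)) *\<^sub>R x"
      using \<open>p < 1 / 2\<close> by simp
    then show ?thesis by blast
  qed
  then obtain k where "V *v x = k *\<^sub>R x" by blast
  then show ?thesis using xx by simp
qed

section \<open>Energy growth and repulsion from the diagonal\<close>

text \<open>Up to the factor \<open>2 * \<beta>\<close>, the sum of exponentials times the velocity
  is the tangential gradient of the energy, and pairing a tangential velocity with the unprojected
  vector gives a multiple of its squared norm. Symmetry of \<open>V\<close> makes the mixed term
  common to both particles, hence the factor 2 in the energy.\<close>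

lemma energy_derivative:
  assumes sol: "attn_solution \<beta> V x y" and t: "t \<ge> 0" and x: "norm (x t) = 1" and y: "norm (y t) = 1"
  shows "((\<lambda>t. exp (\<beta> * (x t \<bullet> (V *v x t))) + 2 * exp (\<beta> * (x t \<bullet> (V *v y t))) + exp (\<beta> * (y t \<bullet> (V *v y t))))
    has_real_derivative 2 * \<beta> *
      ((exp (\<beta> * (x t \<bullet> (V *v x t))) + exp (\<beta> * (x t \<bullet> (V *v y t)))) * (norm (attn_field \<beta> V (x t) (y t)))\<^sup>2
     + (exp (\<beta> * (y t \<bullet> (V *v y t))) + exp (\<beta> * (y t \<bullet> (V *v x t)))) * (norm (attn_field \<beta> V (y t) (x t)))\<^sup>2))
    (at t within {0..})"
proof -
  have scaled: "(exp (\<beta> * (u \<bullet> (V *v u))) + exp (\<beta> * (u \<bullet> (V *v v)))) * (norm (attn_field \<beta> V u v))\<^sup>2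
     = exp (\<beta> * (u \<bullet> (V *v u))) * (attn_field \<beta> V u v \<bullet> (V *v u))
     + exp (\<beta> * (u \<bullet> (V *v v))) * (attn_field \<beta> V u v \<bullet> (V *v v))" if "norm u = 1" for u v
  proof -
    define A B where "A = exp (\<beta> * (u \<bullet> (V *v u)))" and "B = exp (\<beta> * (u \<bullet> (V *v v)))"
    have AB: "A + B > 0" by (auto simp: A_def B_def add_pos_pos)
    have "attn_field \<beta> V u v \<bullet> u = 0"
      using inner_attn_field[of u \<beta> V v] that by (simp add: norm_eq_1 inner_commute)
    moreover have "attn_weight \<beta> V u v = A / (A + B)" "1 - attn_weight \<beta> V u v = B / (A + B)"
      unfolding A_def B_def by (rule attn_weight_eq)+
    ultimately have "attn_field \<beta> V u v \<bullet> attn_field \<beta> V u v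
        = A / (A + B) * (attn_field \<beta> V u v \<bullet> (V *v u)) + B / (A + B) * (attn_field \<beta> V u v \<bullet> (V *v v))"
      by (subst (2) attn_field_eq)
         (simp only: inner_add_right inner_diff_right inner_scaleR_right mult_zero_right diff_0_right)
    then show ?thesis
      using AB unfolding power2_norm_eq_inner A_def[symmetric] B_def[symmetric]
      by (simp add: distrib_left)
  qed
  define fx fy where "fx = attn_field \<beta> V (x t) (y t)" and "fy = attn_field \<beta> V (y t) (x t)"
  have dx: "(x has_vector_derivative fx) (at t within {0..})" and dy: "(y has_vector_derivative fy) (at t within {0..})"
    using sol t by (auto simp: attn_solution_def fx_def fy_def)
  have dexp: "((\<lambda>t. exp (\<beta> * g t)) has_real_derivative exp (\<beta> * g t) * (\<beta> * D)) (at t within {0..})"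
    if "(g has_real_derivative D) (at t within {0..})" for g D
    using that by (auto intro!: derivative_eq_intros)
  note lin = bounded_linear.has_vector_derivative[OF matrix_vector_mul_bounded_linear[of V]]
  have da: "((\<lambda>t. x t \<bullet> (V *v x t)) has_real_derivative 2 * (fx \<bullet> (V *v x t))) (at t within {0..})"
    using has_real_derivative_inner[OF dx lin[OF dx]] sym'[of "x t" fx] by simp
  have db: "((\<lambda>t. x t \<bullet> (V *v y t)) has_real_derivative (fx \<bullet> (V *v y t) + fy \<bullet> (V *v x t))) (at t within {0..})"
    using has_real_derivative_inner[OF dx lin[OF dy]] sym'[of "x t" fy] by (simp add: add.commute)
  have dc: "((\<lambda>t. y t \<bullet> (V *v y t)) has_real_derivative 2 * (fy \<bullet> (V *v y t))) (at t within {0..})"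
    using has_real_derivative_inner[OF dy lin[OF dy]] sym'[of "y t" fy] by simp
  have "((\<lambda>t. exp (\<beta> * (x t \<bullet> (V *v x t))) + 2 * exp (\<beta> * (x t \<bullet> (V *v y t))) + exp (\<beta> * (y t \<bullet> (V *v y t))))
    has_real_derivative 
      exp (\<beta> * (x t \<bullet> (V *v x t))) * (\<beta> * (2 * (fx \<bullet> (V *v x t))))
    + 2 * (exp (\<beta> * (x t \<bullet> (V *v y t))) * (\<beta> * (fx \<bullet> (V *v y t) + fy \<bullet> (V *v x t))))
    + exp (\<beta> * (y t \<bullet> (V *v y t))) * (\<beta> * (2 * (fy \<bullet> (V *v y t))))) (at t within {0..})"
    by (intro DERIV_add DERIV_cmult dexp da db dc)
  then show ?thesis
  proof (rule DERIV_cong)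
    have "A * (\<beta> * (2 * c1)) + 2 * (B * (\<beta> * (c2 + c3))) + C * (\<beta> * (2 * c4))
        = 2 * \<beta> * ((A * c1 + B * c2) + (C * c4 + B * c3))" for A B C c1 c2 c3 c4 :: real
      by algebra
    then show "exp (\<beta> * (x t \<bullet> (V *v x t))) * (\<beta> * (2 * (fx \<bullet> (V *v x t))))
      + 2 * (exp (\<beta> * (x t \<bullet> (V *v y t))) * (\<beta> * (fx \<bullet> (V *v y t) + fy \<bullet> (V *v x t))))
      + exp (\<beta> * (y t \<bullet> (V *v y t))) * (\<beta> * (2 * (fy \<bullet> (V *v y t))))
      = 2 * \<beta> *
      ((exp (\<beta> * (x t \<bullet> (V *v x t))) + exp (\<beta> * (x t \<bullet> (V *v y t)))) * (norm (attn_field \<beta> V (x t) (y t)))\<^sup>2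
     + (exp (\<beta> * (y t \<bullet> (V *v y t))) + exp (\<beta> * (y t \<bullet> (V *v x t)))) * (norm (attn_field \<beta> V (y t) (x t)))\<^sup>2)"
      unfolding scaled[OF x] scaled[OF y] unfolding fx_def[symmetric] fy_def[symmetric] sym'[of "y t" "x t"] .
  qed
qed

text \<open>The exact derivative exceeds the bound by \<open>1 - p - q\<close> times the value of
  the positive form of \<open>- V\<close> at \<open>x - y\<close>. Near the diagonal both rates are
  close to \<open>x \<bullet> (V *v x) < 0\<close>, so the bound means exponential
  separation.\<close>

lemma overlap_derivative:
  assumes sol: "attn_solution \<beta> V x y" and t: "t \<ge> 0"
  shows "\<exists>D. ((\<lambda>t. 1 - x t \<bullet> y t) has_real_derivative D) (at t within {0..})
     \<and> D \<ge> - (attn_rate \<beta> V (x t) (y t) + attn_rate \<beta> V (y t) (x t)) * (1 - x t \<bullet> y t)"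
proof -
  define p q where "p = attn_weight \<beta> V (x t) (y t)" and "q = attn_weight \<beta> V (y t) (x t)"
  define D where "D = - (attn_field \<beta> V (x t) (y t) \<bullet> y t + attn_field \<beta> V (y t) (x t) \<bullet> x t)"
  have dx: "(x has_vector_derivative attn_field \<beta> V (x t) (y t)) (at t within {0..})"
    and dy: "(y has_vector_derivative attn_field \<beta> V (y t) (x t)) (at t within {0..})"
    using sol t by (auto simp: attn_solution_def)
  have "((\<lambda>t. 1 - x t \<bullet> y t) has_real_derivative D) (at t within {0..})"
    using has_real_derivative_inner[OF dx dy]
    by (auto intro!: derivative_eq_intros simp: D_def inner_commute)
  moreover have "D = (1 - p - q) * - ((x t - y t) \<bullet> (V *v (x t - y t)))
      - (attn_rate \<beta> V (x t) (y t) + attn_rate \<beta> V (y t) (x t)) * (1 - x t \<bullet> y t)"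
    unfolding D_def inner_field_other attn_rate_def form_diff p_def[symmetric] q_def[symmetric]
    by (simp add: algebra_simps sym'[of "y t" "x t"] inner_commute[of "y t" "x t"])
  moreover have "(1 - p - q) * - ((x t - y t) \<bullet> (V *v (x t - y t))) \<ge> 0"
    using weight_sum_le[of "x t" "y t"] negsemidef[of "x t - y t"]
    by (intro mult_nonneg_nonneg) (auto simp: p_def q_def)
  ultimately show ?thesis by (intro exI[of _ D] conjI) linarith+
qed

section \<open>Instability of antipodal eigenpairs\<close>

text \<open>Nearness to the set of all pairs \<open>(u, - u)\<close> with
  \<open>V *v u = - m *\<^sub>R u\<close>, measured by residuals and not by the distance to one such
  pair. This allows eigenspaces of any dimension, and the conditions are closed.\<close>

definition near_antipodal :: "real \<Rightarrow> real \<Rightarrow> (real^'n) \<times> (real^'n) \<Rightarrow> bool" where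
  "near_antipodal m \<epsilon> z \<longleftrightarrow> norm (fst z + snd z) \<le> \<epsilon>
     \<and> norm (V *v fst z + m *\<^sub>R fst z) \<le> \<epsilon> \<and> norm (V *v snd z + m *\<^sub>R snd z) \<le> \<epsilon>"

text \<open>Since chords of the unit sphere are orthogonal to their midpoints, the quadratic form,
  the weight and the rate all vary only to second order near an antipodal eigenpair, so
  their variation does not enter the linearization.\<close>

lemma field_linearization:
  assumes m: "m > 0"
  defines "p0 \<equiv> 1 / (1 + exp (2 * \<beta> * m))"
  shows "\<exists>K>0. \<forall>\<epsilon> x y x' y'. norm x = 1 \<longrightarrow> norm y = 1 \<longrightarrow> norm x' = 1 \<longrightarrow> norm y' = 1 \<longrightarrow>
     near_antipodal m \<epsilon> (x, y) \<longrightarrow> near_antipodal m \<epsilon> (x', y') \<longrightarrow>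
     norm (x' - x) \<le> \<epsilon> \<longrightarrow> norm (y' - y) \<le> \<epsilon> \<longrightarrow>
     norm (attn_field \<beta> V x' y' - attn_field \<beta> V x y
        - (p0 *\<^sub>R (V *v (x' - x)) + (1 - p0) *\<^sub>R (V *v (y' - y)) - ((1 - 2 * p0) * m) *\<^sub>R (x' - x)))
     \<le> K * \<epsilon> * (norm (x' - x) + norm (y' - y))"
proof -
  obtain K0 where K0: "K0 > 0" "\<And>v. norm (V *v v) \<le> norm v * K0"
    using bounded_linear.pos_bounded[OF matrix_vector_mul_bounded_linear[of V]] by blast
  \<comment> \<open>\<open>K1\<close> and \<open>K2\<close> are for the deviation of weight and rate
    from their values at an exact eigenpair, \<open>K3\<close> and \<open>K4\<close> for their
    variation between the two given pairs.\<close>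
  define K1 K2 K3 K4 where "K1 = \<beta> * (2 + m)" and "K2 = 1 + (1 + m) + 2 * m * K1"
    and "K3 = \<beta> * (3 + 2 * m)" and "K4 = K3 * (2 * K0) + 2 + (1 + 2 * m)"
  define K where "K = K1 * K0 + K2 + K3 * (2 * K0) + K4"
  have Kpos: "K1 > 0" "K2 > 0" "K3 > 0" "K4 > 0" "K > 0"
    unfolding K_def K4_def K2_def K1_def K3_def using m beta_pos K0
    by (auto intro!: add_pos_pos mult_pos_pos)
  show ?thesis
  proof (intro exI[of _ K] conjI allI impI Kpos)
    fix \<epsilon> :: real and x y x' y'
    assume x: "norm x = 1" and y: "norm y = 1" and x': "norm x' = 1" and y': "norm y' = 1"
      and "near_antipodal m \<epsilon> (x, y)" and "near_antipodal m \<epsilon> (x', y')"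
      and dx: "norm (x' - x) \<le> \<epsilon>" and dy: "norm (y' - y) \<le> \<epsilon>"
    then have nx: "norm (V *v x + m *\<^sub>R x) \<le> \<epsilon>" and ny: "norm (V *v y + m *\<^sub>R y) \<le> \<epsilon>"
      and nxy: "norm (x + y) \<le> \<epsilon>"
      and nx': "norm (V *v x' + m *\<^sub>R x') \<le> \<epsilon>" and ny': "norm (V *v y' + m *\<^sub>R y') \<le> \<epsilon>"
      and nxy': "norm (x' + y') \<le> \<epsilon>"
      by (auto simp: near_antipodal_def)
    have xx: "x \<bullet> x = 1" using x by (simp add: norm_eq_1)
    have \<epsilon>: "\<epsilon> \<ge> 0" using dx norm_ge_zero order_trans by blast
    define \<delta>x \<delta>y N where "\<delta>x = x' - x" and "\<delta>y = y' - y" and "N = norm (x' - x) + norm (y' - y)"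
    have N: "norm \<delta>x \<le> N" "norm \<delta>y \<le> N" "norm \<delta>x + norm \<delta>y = N" "N \<ge> 0"
      by (auto simp: N_def \<delta>x_def \<delta>y_def)
    define a b a' b' where "a = x \<bullet> (V *v x)" and "b = x \<bullet> (V *v y)"
      and "a' = x' \<bullet> (V *v x')" and "b' = x' \<bullet> (V *v y')"
    define p p' where "p = attn_weight \<beta> V x y" and "p' = attn_weight \<beta> V x' y'"
    \<comment> \<open>At an exact antipodal eigenpair \<open>a = - m\<close> and
      \<open>b = m\<close>, so the weight is \<open>p0\<close> and the rate is
      \<open>\<kappa>\<close>.\<close>
    define \<alpha> \<alpha>' \<kappa> where "\<alpha> = attn_rate \<beta> V x y" and "\<alpha>' = attn_rate \<beta> V x' y'" and "\<kappa> = (1 - 2 * p0) * m"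
    have p01: "0 \<le> p" "p \<le> 1"
      using attn_weight_pos[of \<beta> V x y] attn_weight_less_1[of \<beta> V x y] by (auto simp: p_def)
    have am: "\<bar>a + m\<bar> \<le> \<epsilon>"
      using inner_le_of_norm[OF nx, of x] by (simp add: inner_add_right xx x a_def)
    have bm: "\<bar>b - m\<bar> \<le> (1 + m) * \<epsilon>"
    proof -
      have "b - m = x \<bullet> (V *v y + m *\<^sub>R y) - m * (x \<bullet> (x + y))"
        by (simp add: inner_add_right xx b_def algebra_simps)
      then have "\<bar>b - m\<bar> \<le> \<bar>x \<bullet> (V *v y + m *\<^sub>R y)\<bar> + m * \<bar>x \<bullet> (x + y)\<bar>"
        using m abs_triangle_ineq4[of "x \<bullet> (V *v y + m *\<^sub>R y)" "m * (x \<bullet> (x + y))"] by (simp add: abs_mult)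
      also have "\<dots> \<le> \<epsilon> + m * \<epsilon>"
        using inner_le_of_norm[OF ny, of x] inner_le_of_norm[OF nxy, of x] m x
        by (intro add_mono mult_left_mono) auto
      finally show ?thesis by (simp add: algebra_simps)
    qed
    have pp0: "\<bar>p - p0\<bar> \<le> K1 * \<epsilon>"
    proof -
      have "\<bar>p - p0\<bar> \<le> \<bar>\<beta> * (b - a) - 2 * \<beta> * m\<bar>"
        unfolding p_def p0_def attn_weight_def a_def b_def by (rule logistic_diff_le)
      also have "\<dots> = \<beta> * \<bar>(b - m) - (a + m)\<bar>"
      proof -
        have "\<beta> * (b - a) - 2 * \<beta> * m = \<beta> * ((b - m) - (a + m))" by algebra
        then show ?thesis using beta_pos by (simp add: abs_mult)
      qed
      also have "\<dots> \<le> \<beta> * ((1 + m) * \<epsilon> + \<epsilon>)"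
        using beta_pos am bm abs_triangle_ineq4[of "b - m" "a + m"] by (intro mult_left_mono) auto
      finally show ?thesis by (simp add: K1_def algebra_simps)
    qed
    have \<alpha>\<kappa>: "\<bar>\<alpha> - \<kappa>\<bar> \<le> K2 * \<epsilon>"
    proof -
      have "\<alpha> - \<kappa> = p * (a + m) + (1 - p) * (b - m) - 2 * m * (p - p0)"
        by (simp add: \<alpha>_def \<kappa>_def attn_rate_def algebra_simps flip: p_def a_def b_def)
      then have "\<bar>\<alpha> - \<kappa>\<bar> \<le> p * \<bar>a + m\<bar> + (1 - p) * \<bar>b - m\<bar> + 2 * m * \<bar>p - p0\<bar>"
        using p01 m by (simp add: abs_mult[symmetric] abs_le_iff flip: abs_of_nonneg)
           (smt (verit) abs_ge_self abs_ge_minus_self mult_left_mono mult_minus_right)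
      also have "\<dots> \<le> 1 * \<epsilon> + 1 * ((1 + m) * \<epsilon>) + 2 * m * (K1 * \<epsilon>)"
        using p01 m am bm pp0 \<epsilon> by (intro add_mono mult_mono mult_left_mono) auto
      finally show ?thesis by (simp add: K2_def algebra_simps)
    qed
    have da: "\<bar>a' - a\<bar> \<le> 2 * (\<epsilon> * N)"
    proof -
      \<comment> \<open>As the chord is orthogonal to \<open>x + x'\<close>, the terms
        \<open>m *\<^sub>R x\<close> and \<open>m *\<^sub>R x'\<close> can be added for free, which
        leaves only the small residuals.\<close>
      have "\<delta>x \<bullet> x' + \<delta>x \<bullet> x = 0" unfolding \<delta>x_def using inner_diff_unit_vectors[OF x x'] by simp
      then have "m * (\<delta>x \<bullet> x') + m * (\<delta>x \<bullet> x) = 0" by (simp flip: distrib_left)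
      moreover have "a' - a = \<delta>x \<bullet> (V *v x') + \<delta>x \<bullet> (V *v x)"
        unfolding a_def a'_def \<delta>x_def using sym'[of x x'] by (simp add: inner_diff_left)
      ultimately have "a' - a = \<delta>x \<bullet> (V *v x' + m *\<^sub>R x') + \<delta>x \<bullet> (V *v x + m *\<^sub>R x)"
        by (simp add: inner_add_right)
      also have "\<bar>\<dots>\<bar> \<le> \<epsilon> * norm \<delta>x + \<epsilon> * norm \<delta>x"
        using inner_le_of_norm[OF nx, of \<delta>x] inner_le_of_norm[OF nx', of \<delta>x] by linarith
      also have "\<dots> \<le> 2 * (\<epsilon> * N)" using mult_left_mono[OF N(1) \<epsilon>] by simp
      finally show ?thesis .
    qed
    have db: "\<bar>b' - b\<bar> \<le> (1 + 2 * m) * (\<epsilon> * N)"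
    proof -
      have half: "m * ((norm d)\<^sup>2 / 2) \<le> m * (\<epsilon> * norm d)" if "norm d \<le> \<epsilon>" for d :: "real^'n"
      proof (rule mult_left_mono)
        show "(norm d)\<^sup>2 / 2 \<le> \<epsilon> * norm d"
          using mult_right_mono[OF that norm_ge_zero[of d]] zero_le_power2[of "norm d"]
          unfolding power2_eq_square by linarith
      qed (use m in simp)
      have "b' - b = \<delta>x \<bullet> (V *v y') + \<delta>y \<bullet> (V *v x)"
        unfolding b_def b'_def \<delta>x_def \<delta>y_def using sym'[of x y] sym'[of x y'] by (simp add: inner_diff_left)
      \<comment> \<open>Passing to the residual leaves the chord paired with the other particle.
        Replacing that particle by its antipode costs a small sum, and the product of the chord with
        its own end point is quadratic.\<close>
      moreover have "\<delta>x \<bullet> (V *v y') = \<delta>x \<bullet> (V *v y' + m *\<^sub>R y') - m * (\<delta>x \<bullet> (x' + y')) + m * ((norm \<delta>x)\<^sup>2 / 2)"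
        using inner_diff_unit_vectors(1)[OF x x', folded \<delta>x_def]
        unfolding inner_add_right inner_scaleR_right distrib_left by simp
      moreover have "\<delta>y \<bullet> (V *v x) = \<delta>y \<bullet> (V *v x + m *\<^sub>R x) - m * (\<delta>y \<bullet> (x + y)) - m * ((norm \<delta>y)\<^sup>2 / 2)"
        using inner_diff_unit_vectors(2)[OF y y', folded \<delta>y_def]
        unfolding inner_add_right inner_scaleR_right distrib_left by simp
      moreover have "m * \<bar>\<delta>x \<bullet> (x' + y')\<bar> \<le> m * (\<epsilon> * norm \<delta>x)" "m * \<bar>\<delta>y \<bullet> (x + y)\<bar> \<le> m * (\<epsilon> * norm \<delta>y)"
        using inner_le_of_norm[OF nxy', of \<delta>x] inner_le_of_norm[OF nxy, of \<delta>y] m by auto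
      moreover have "\<bar>m * (\<delta>x \<bullet> (x' + y'))\<bar> = m * \<bar>\<delta>x \<bullet> (x' + y')\<bar>" "\<bar>m * (\<delta>y \<bullet> (x + y))\<bar> = m * \<bar>\<delta>y \<bullet> (x + y)\<bar>"
        using m by (auto simp: abs_mult)
      moreover have "m * ((norm \<delta>x)\<^sup>2 / 2) \<ge> 0" "m * ((norm \<delta>y)\<^sup>2 / 2) \<ge> 0" using m by auto
      ultimately have "\<bar>b' - b\<bar> \<le> (\<epsilon> * norm \<delta>x + m * (\<epsilon> * norm \<delta>x) + m * (\<epsilon> * norm \<delta>x))
          + (\<epsilon> * norm \<delta>y + m * (\<epsilon> * norm \<delta>y) + m * (\<epsilon> * norm \<delta>y))"
        using inner_le_of_norm[OF ny', of \<delta>x] inner_le_of_norm[OF nx, of \<delta>y] 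
          half[OF dx[folded \<delta>x_def]] half[OF dy[folded \<delta>y_def]]
        by linarith
      also have "\<dots> = (1 + 2 * m) * (\<epsilon> * (norm \<delta>x + norm \<delta>y))" by (simp add: algebra_simps)
      finally show ?thesis using N(3) by simp
    qed
    have dp: "\<bar>p' - p\<bar> \<le> K3 * (\<epsilon> * N)"
    proof -
      have "\<bar>p' - p\<bar> \<le> \<bar>\<beta> * (b' - a') - \<beta> * (b - a)\<bar>"
        unfolding p_def p'_def attn_weight_def a_def b_def a'_def b'_def by (rule logistic_diff_le)
      also have "\<dots> = \<beta> * \<bar>(b' - b) - (a' - a)\<bar>"
      proof -
        have "\<beta> * (b' - a') - \<beta> * (b - a) = \<beta> * ((b' - b) - (a' - a))" by algebra
        then show ?thesis using beta_pos by (simp add: abs_mult)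
      qed
      also have "\<dots> \<le> \<beta> * ((1 + 2 * m) * (\<epsilon> * N) + 2 * (\<epsilon> * N))"
        using beta_pos da db by (intro mult_left_mono) linarith+
      finally show ?thesis by (simp add: K3_def algebra_simps)
    qed
    have ab': "\<bar>a' - b'\<bar> \<le> 2 * K0"
    proof -
      have "\<bar>a'\<bar> \<le> K0" "\<bar>b'\<bar> \<le> K0"
        unfolding a'_def b'_def
        using inner_le_of_norm[OF K0(2)[of x'], of x'] inner_le_of_norm[OF K0(2)[of y'], of x'] x' y' by auto
      then show ?thesis by linarith
    qed
    have d\<alpha>: "\<bar>\<alpha>' - \<alpha>\<bar> \<le> K4 * (\<epsilon> * N)"
    proof -
      have "\<alpha>' - \<alpha> = (p' - p) * (a' - b') + p * (a' - a) + (1 - p) * (b' - b)"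
        by (simp add: \<alpha>_def \<alpha>'_def attn_rate_def algebra_simps
            flip: p_def a_def b_def p'_def a'_def b'_def)
      then have "\<bar>\<alpha>' - \<alpha>\<bar> \<le> \<bar>p' - p\<bar> * \<bar>a' - b'\<bar> + p * \<bar>a' - a\<bar> + (1 - p) * \<bar>b' - b\<bar>"
        using p01 abs_triangle_ineq[of "(p' - p) * (a' - b') + p * (a' - a)" "(1 - p) * (b' - b)"]
          abs_triangle_ineq[of "(p' - p) * (a' - b')" "p * (a' - a)"]
        by (simp add: abs_mult)
      also have "\<dots> \<le> K3 * (\<epsilon> * N) * (2 * K0) + 1 * (2 * (\<epsilon> * N)) + 1 * ((1 + 2 * m) * (\<epsilon> * N))"
        using p01 m dp ab' da db \<epsilon> N(4) Kpos by (intro add_mono mult_mono) auto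
      finally show ?thesis by (simp add: K4_def algebra_simps)
    qed
    \<comment> \<open>Telescoping: two terms for replacing weight and rate at \<open>(x, y)\<close>
      by \<open>p0\<close> and \<open>\<kappa>\<close>, two for their variation from
      \<open>(x, y)\<close> to \<open>(x', y')\<close>.\<close>
    have "attn_field \<beta> V x' y' - attn_field \<beta> V x y
        - (p0 *\<^sub>R (V *v \<delta>x) + (1 - p0) *\<^sub>R (V *v \<delta>y) - \<kappa> *\<^sub>R \<delta>x)
      = (p - p0) *\<^sub>R (V *v (\<delta>x - \<delta>y)) - (\<alpha> - \<kappa>) *\<^sub>R \<delta>x + (p' - p) *\<^sub>R (V *v (x' - y')) - (\<alpha>' - \<alpha>) *\<^sub>R x'"
      unfolding attn_field_eq \<delta>x_def \<delta>y_def p_def[symmetric] p'_def[symmetric] \<alpha>_def[symmetric] \<alpha>'_def[symmetric]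
      by (simp add: matrix_vector_mult_diff_distrib algebra_simps)
    also have "norm \<dots> \<le> K1 * \<epsilon> * (N * K0) + K2 * \<epsilon> * N + K3 * (\<epsilon> * N) * (2 * K0) + K4 * (\<epsilon> * N)"
    proof (intro order_trans[OF norm_triangle_ineq4 add_mono] norm_triangle_mono)
      have "norm (V *v (\<delta>x - \<delta>y)) \<le> N * K0"
        using K0(2)[of "\<delta>x - \<delta>y"] norm_triangle_ineq4[of \<delta>x \<delta>y] N(3) K0(1)
        by (meson order_trans mult_right_mono less_imp_le order_eq_refl)
      then show "norm ((p - p0) *\<^sub>R (V *v (\<delta>x - \<delta>y))) \<le> K1 * \<epsilon> * (N * K0)"
        unfolding norm_scaleR using pp0 Kpos \<epsilon> by (intro mult_mono) auto
      show "norm ((\<alpha> - \<kappa>) *\<^sub>R \<delta>x) \<le> K2 * \<epsilon> * N"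
        unfolding norm_scaleR using \<alpha>\<kappa> Kpos \<epsilon> N by (intro mult_mono) auto
      have "norm (V *v (x' - y')) \<le> 2 * K0"
      proof -
        have "norm (x' - y') \<le> 2" using norm_triangle_ineq4[of x' y'] x' y' by simp
        then show ?thesis
          using order_trans[OF K0(2)[of "x' - y'"] mult_right_mono] K0(1) by simp
      qed
      then show "norm ((p' - p) *\<^sub>R (V *v (x' - y'))) \<le> K3 * (\<epsilon> * N) * (2 * K0)"
        unfolding norm_scaleR using dp Kpos \<epsilon> N by (intro mult_mono) auto
      show "norm ((\<alpha>' - \<alpha>) *\<^sub>R x') \<le> K4 * (\<epsilon> * N)" using d\<alpha> x' by simp
    qed
    also have "\<dots> = K * \<epsilon> * N" by (simp add: K_def algebra_simps)
    finally show "norm (attn_field \<beta> V x' y' - attn_field \<beta> V x y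
        - (p0 *\<^sub>R (V *v (x' - x)) + (1 - p0) *\<^sub>R (V *v (y' - y)) - ((1 - 2 * p0) * m) *\<^sub>R (x' - x)))
      \<le> K * \<epsilon> * (norm (x' - x) + norm (y' - y))"
      unfolding \<delta>x_def \<delta>y_def \<kappa>_def N_def .
  qed
qed

text \<open>The indefinite form \<open>h\<close> below grows exponentially while positive, yet never
  exceeds \<open>4 * (\<sigma> \<bullet> ed)\<^sup>2\<close>, which stays bounded as long as both
  solutions remain near eigenpairs. So \<open>h\<close> cannot be positive initially.\<close>

lemma unstable_cone:
  assumes m: "0 < m" "m \<le> \<mu>2"
  shows "\<exists>\<epsilon>>0. \<forall>x y x' y'. attn_solution \<beta> V x y \<longrightarrow> attn_solution \<beta> V x' y' \<longrightarrow>
     (\<forall>t\<ge>0. norm (x t) = 1 \<and> norm (y t) = 1 \<and> norm (x' t) = 1 \<and> norm (y' t) = 1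
        \<and> near_antipodal m \<epsilon> (x t, y t) \<and> near_antipodal m \<epsilon> (x' t, y' t)) \<longrightarrow>
     y 0 = y' 0 \<longrightarrow> \<not> (norm (x' 0 - x 0))\<^sup>2 < 2 * ((x' 0 - x 0) \<bullet> ed)\<^sup>2"
proof -
  define p0 \<omega> where "p0 = 1 / (1 + exp (2 * \<beta> * m))" and "\<omega> = 1 - 2 * p0"
  have "2 * \<beta> * m > 0" using beta_pos m by simp
  then have \<omega>: "\<omega> > 0" unfolding \<omega>_def p0_def by (simp add: field_simps add_pos_pos)
  obtain K where K: "K > 0" "\<And>\<epsilon> x y x' y'. \<lbrakk>norm x = 1; norm y = 1; norm x' = 1; norm y' = 1;
     near_antipodal m \<epsilon> (x, y); near_antipodal m \<epsilon> (x', y'); norm (x' - x) \<le> \<epsilon>; norm (y' - y) \<le> \<epsilon>\<rbrakk> \<Longrightarrow>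
     norm (attn_field \<beta> V x' y' - attn_field \<beta> V x y
        - (p0 *\<^sub>R (V *v (x' - x)) + (1 - p0) *\<^sub>R (V *v (y' - y)) - (\<omega> * m) *\<^sub>R (x' - x)))
     \<le> K * \<epsilon> * (norm (x' - x) + norm (y' - y))"
    using field_linearization[OF m(1)] unfolding p0_def \<omega>_def by blast
  \<comment> \<open>\<open>g\<close> is the growth rate of \<sigma> along \<open>ed\<close> and
    \<open>g2\<close> bounds the rate across it. Inside the cone both component differences are at
    most \<open>2 * \<bar>\<sigma> t \<bullet> ed\<bar>\<close>, hence at most
    \<open>8 * \<epsilon> / (\<mu> - m)\<close>; the summand 1 in \<open>C\<close> ensures
    \<open>\<epsilon> \<le> C * \<epsilon>\<close>.\<close>
  define g g2 C where "g = \<omega> * (\<mu> - m)" and "g2 = \<omega> * (\<mu>2 - m)" and "C = 1 + 8 / (\<mu> - m)"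
  have \<mu>m: "\<mu> - m > 0" using gap m by simp
  have g: "g2 \<ge> 0" "g > g2" using \<omega> m gap by (auto simp: g_def g2_def)
  have C: "C \<ge> 1" using \<mu>m by (simp add: C_def)
  \<comment> \<open>The linearization error enters \<open>h'\<close> with the factor
    \<open>40 * (K * (C * \<epsilon>))\<close>; this choice makes it equal to the gap
    \<open>g - g2\<close>.\<close>
  define \<epsilon> where "\<epsilon> = (g - g2) / (40 * K * C)"
  have \<epsilon>: "\<epsilon> > 0" using g K C by (auto simp: \<epsilon>_def)
  have K\<epsilon>: "40 * (K * (C * \<epsilon>)) = g - g2" using K(1) C by (simp add: \<epsilon>_def)
  show ?thesis
  proof (intro exI[of _ \<epsilon>] conjI \<epsilon> allI impI notI)
    fix x y x' y'
    assume sol: "attn_solution \<beta> V x y" and sol': "attn_solution \<beta> V x' y'"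
      and *: "\<forall>t\<ge>0. norm (x t) = 1 \<and> norm (y t) = 1 \<and> norm (x' t) = 1 \<and> norm (y' t) = 1
        \<and> near_antipodal m \<epsilon> (x t, y t) \<and> near_antipodal m \<epsilon> (x' t, y' t)"
      and y0: "y 0 = y' 0" and init: "(norm (x' 0 - x 0))\<^sup>2 < 2 * ((x' 0 - x 0) \<bullet> ed)\<^sup>2"
    define \<delta>x \<delta>y where "\<delta>x t = x' t - x t" and "\<delta>y t = y' t - y t" for t
    define \<sigma> \<tau> where "\<sigma> t = \<delta>x t - \<delta>y t" and "\<tau> t = \<delta>x t + \<delta>y t" for t
    define h where "h t = 4 * (\<sigma> t \<bullet> ed)\<^sup>2 - \<sigma> t \<bullet> \<sigma> t - \<tau> t \<bullet> \<tau> t" for t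
    define Dx Dy where "Dx t = attn_field \<beta> V (x' t) (y' t) - attn_field \<beta> V (x t) (y t)"
      and "Dy t = attn_field \<beta> V (y' t) (x' t) - attn_field \<beta> V (y t) (x t)" for t
    define h' where "h' t = 8 * (\<sigma> t \<bullet> ed) * ((Dx t - Dy t) \<bullet> ed) - 2 * (\<sigma> t \<bullet> (Dx t - Dy t))
       - 2 * (\<tau> t \<bullet> (Dx t + Dy t))" for t
    have dh: "(h has_real_derivative h' t) (at t within {0..})" if t: "t \<ge> 0" for t
    proof -
      have "(\<delta>x has_vector_derivative Dx t) (at t within {0..})"
        "(\<delta>y has_vector_derivative Dy t) (at t within {0..})"
        using sol sol' t unfolding \<delta>x_def \<delta>y_def Dx_def Dy_def attn_solution_def
        by (auto intro!: has_vector_derivative_diff)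
      then have ds: "(\<sigma> has_vector_derivative (Dx t - Dy t)) (at t within {0..})"
        and dt: "(\<tau> has_vector_derivative (Dx t + Dy t)) (at t within {0..})"
        unfolding \<sigma>_def \<tau>_def by (auto intro!: has_vector_derivative_diff has_vector_derivative_add)
      have "((\<lambda>t. \<sigma> t \<bullet> ed) has_real_derivative (Dx t - Dy t) \<bullet> ed) (at t within {0..})"
        using has_real_derivative_inner[OF ds has_vector_derivative_const[of ed]] by simp
      note d = this has_real_derivative_inner[OF ds ds] has_real_derivative_inner[OF dt dt]
      show ?thesis unfolding h_def h'_def
        by (rule derivative_eq_intros d refl)+ (simp add: inner_commute)
    qed
    have \<sigma>d: "\<bar>\<sigma> t \<bullet> ed\<bar> \<le> 4 * \<epsilon> / (\<mu> - m)" if t: "t \<ge> 0" for t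
    proof -
      have small: "\<bar>v \<bullet> ed\<bar> \<le> \<epsilon> / (\<mu> - m)" if "norm (V *v v + m *\<^sub>R v) \<le> \<epsilon>" for v
      proof -
        \<comment> \<open>Pairing the residual with the eigenvector \<open>ed\<close> of eigenvalue
          \<open>- \<mu>\<close> isolates the \<open>ed\<close>-coordinate, with factor
          \<open>\<mu> - m\<close>.\<close>
        have "ed \<bullet> (V *v v + m *\<^sub>R v) = - ((\<mu> - m) * (v \<bullet> ed))"
          using sym[of ed v] by (simp add: inner_add_right eigen_ed inner_commute algebra_simps)
        then have "(\<mu> - m) * \<bar>v \<bullet> ed\<bar> \<le> \<epsilon>"
          using inner_le_of_norm[OF that, of ed] \<mu>m norm_ed by (simp add: abs_mult)
        then show ?thesis using \<mu>m by (simp add: field_simps)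
      qed
      have "\<bar>x t \<bullet> ed\<bar> \<le> \<epsilon> / (\<mu> - m)" "\<bar>y t \<bullet> ed\<bar> \<le> \<epsilon> / (\<mu> - m)"
        "\<bar>x' t \<bullet> ed\<bar> \<le> \<epsilon> / (\<mu> - m)" "\<bar>y' t \<bullet> ed\<bar> \<le> \<epsilon> / (\<mu> - m)"
        using * t by (auto intro!: small simp: near_antipodal_def)
      then show ?thesis unfolding \<sigma>_def \<delta>x_def \<delta>y_def inner_diff_left by simp
    qed
    have h'_ge: "h' t \<ge> (g + g2) * h t" if t: "t \<ge> 0" and ht: "h t > 0" for t
    proof -
      define sd s2 T2 where "sd = \<sigma> t \<bullet> ed" and "s2 = \<sigma> t \<bullet> \<sigma> t" and "T2 = \<tau> t \<bullet> \<tau> t"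
      have nonneg: "s2 \<ge> 0" "T2 \<ge> 0" by (auto simp: s2_def T2_def)
      have n2: "(norm (\<sigma> t))\<^sup>2 = s2" "(norm (\<tau> t))\<^sup>2 = T2" by (simp_all add: s2_def T2_def power2_norm_eq_inner)
      have bounds: "s2 \<le> (2 * sd)\<^sup>2" "T2 \<le> (2 * sd)\<^sup>2"
        using ht nonneg unfolding h_def sd_def[symmetric] s2_def[symmetric] T2_def[symmetric] by auto
      have ns: "norm (\<sigma> t) \<le> 2 * \<bar>sd\<bar>" "norm (\<tau> t) \<le> 2 * \<bar>sd\<bar>"
        using bounds abs_le_square_iff[of "norm (\<sigma> t)" "2 * sd"] abs_le_square_iff[of "norm (\<tau> t)" "2 * sd"]
        by (auto simp: n2 abs_mult)
      have \<delta>\<sigma>: "\<delta>x t = (1/2) *\<^sub>R (\<tau> t + \<sigma> t)" "\<delta>y t = (1/2) *\<^sub>R (\<tau> t - \<sigma> t)"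
        unfolding \<sigma>_def \<tau>_def by (simp_all flip: scaleR_2)
      have half: "norm (\<delta>x t) \<le> (norm (\<sigma> t) + norm (\<tau> t)) / 2" "norm (\<delta>y t) \<le> (norm (\<sigma> t) + norm (\<tau> t)) / 2"
        unfolding \<delta>\<sigma> norm_scaleR using norm_triangle_ineq[of "\<tau> t" "\<sigma> t"] norm_triangle_ineq4[of "\<tau> t" "\<sigma> t"] by auto
      have "8 * \<epsilon> / (\<mu> - m) \<le> C * \<epsilon>" using \<epsilon> by (simp add: C_def distrib_right)
      then have \<delta>C: "norm (\<delta>x t) \<le> C * \<epsilon>" "norm (\<delta>y t) \<le> C * \<epsilon>"
        using half ns \<sigma>d[OF t] unfolding sd_def[symmetric] by auto
      have "\<epsilon> \<le> C * \<epsilon>" using C \<epsilon> by simp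
      then have near: "near_antipodal m (C * \<epsilon>) (x t, y t)" "near_antipodal m (C * \<epsilon>) (x' t, y' t)"
        "near_antipodal m (C * \<epsilon>) (y t, x t)" "near_antipodal m (C * \<epsilon>) (y' t, x' t)"
        using * t by (auto simp: near_antipodal_def add.commute)
      define Ex where "Ex = Dx t - (p0 *\<^sub>R (V *v \<delta>x t) + (1 - p0) *\<^sub>R (V *v \<delta>y t) - (\<omega> * m) *\<^sub>R \<delta>x t)"
      define Ey where "Ey = Dy t - (p0 *\<^sub>R (V *v \<delta>y t) + (1 - p0) *\<^sub>R (V *v \<delta>x t) - (\<omega> * m) *\<^sub>R \<delta>y t)"
      define S \<eta> where "S = norm (\<sigma> t) + norm (\<tau> t)" and "\<eta> = 2 * (K * (C * \<epsilon>))"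
      have \<eta>: "\<eta> \<ge> 0" "20 * \<eta> = g - g2" using K(1) C \<epsilon> K\<epsilon> by (auto simp: \<eta>_def)
      have "norm Ex \<le> K * (C * \<epsilon>) * (norm (\<delta>x t) + norm (\<delta>y t))"
        unfolding Ex_def Dx_def \<delta>x_def \<delta>y_def
        by (rule K(2)) (use * t near \<delta>C in \<open>auto simp: \<delta>x_def \<delta>y_def\<close>)
      moreover have "norm Ey \<le> K * (C * \<epsilon>) * (norm (\<delta>y t) + norm (\<delta>x t))"
        unfolding Ey_def Dy_def \<delta>x_def \<delta>y_def
        by (rule K(2)) (use * t near \<delta>C in \<open>auto simp: \<delta>x_def \<delta>y_def\<close>)
      moreover have "K * (C * \<epsilon>) * (norm (\<delta>x t) + norm (\<delta>y t)) \<le> K * (C * \<epsilon>) * S"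
        using half K(1) C \<epsilon> by (intro mult_left_mono) (auto simp: S_def)
      ultimately have E: "norm Ex \<le> K * (C * \<epsilon>) * S" "norm Ey \<le> K * (C * \<epsilon>) * S"
        by (auto simp: add.commute)
      have e: "norm (Ex - Ey) \<le> \<eta> * S" "norm (Ex + Ey) \<le> \<eta> * S"
        using E norm_triangle_ineq4[of Ex Ey] norm_triangle_ineq[of Ex Ey] by (auto simp: \<eta>_def)
      \<comment> \<open>Decoupling: the weights \<open>p0\<close> and \<open>1 - p0\<close> have sum
        1, which acts on \<tau>, and difference \<open>- \<omega>\<close>, which acts on
        \<sigma>.\<close>
      have D\<sigma>: "Dx t - Dy t = - \<omega> *\<^sub>R (V *v \<sigma> t) - (\<omega> * m) *\<^sub>R \<sigma> t + (Ex - Ey)"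
        and D\<tau>: "Dx t + Dy t = V *v \<tau> t - (\<omega> * m) *\<^sub>R \<tau> t + (Ex + Ey)"
        unfolding Ex_def Ey_def \<sigma>_def \<tau>_def \<omega>_def
        by (simp_all add: matrix_vector_mult_diff_distrib matrix_vector_right_distrib
            scaleR_left_diff_distrib scaleR_left_distrib scaleR_right_diff_distrib scaleR_right_distrib mult.assoc scaleR_2 flip: scaleR_scaleR)
      have Ved: "(V *v \<sigma> t) \<bullet> ed = - \<mu> * sd"
        using sym[of "\<sigma> t" ed] by (simp add: eigen_ed sd_def)
      have 1: "sd * ((Dx t - Dy t) \<bullet> ed) = g * sd\<^sup>2 + sd * ((Ex - Ey) \<bullet> ed)"
        unfolding D\<sigma> by (simp add: inner_add_left inner_diff_left Ved g_def algebra_simps power2_eq_square flip: sd_def)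
      have 2: "\<sigma> t \<bullet> (Dx t - Dy t) = \<omega> * (- (\<sigma> t \<bullet> (V *v \<sigma> t)) - m * s2) + \<sigma> t \<bullet> (Ex - Ey)"
        unfolding D\<sigma> by (simp add: inner_add_right inner_diff_right s2_def algebra_simps)
      have 3: "\<tau> t \<bullet> (Dx t + Dy t) = \<tau> t \<bullet> (V *v \<tau> t) - \<omega> * m * T2 + \<tau> t \<bullet> (Ex + Ey)"
        unfolding D\<tau> by (simp add: inner_add_right inner_diff_right T2_def)
      have "\<omega> * (- (\<sigma> t \<bullet> (V *v \<sigma> t)) - m * s2) \<le> \<omega> * (\<mu> * sd\<^sup>2 + \<mu>2 * (s2 - sd\<^sup>2) - m * s2)"
        using form_le[of "\<sigma> t"] \<omega> by (intro mult_left_mono) (auto simp: sd_def s2_def)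
      also have "\<dots> = g * sd\<^sup>2 + g2 * (s2 - sd\<^sup>2)" by (simp add: g_def g2_def algebra_simps)
      finally have 4: "\<omega> * (- (\<sigma> t \<bullet> (V *v \<sigma> t)) - m * s2) \<le> g * sd\<^sup>2 + g2 * (s2 - sd\<^sup>2)" .
      have 5: "\<tau> t \<bullet> (V *v \<tau> t) - \<omega> * m * T2 \<le> 0"
      proof -
        have "\<omega> * m * T2 \<ge> 0" using \<omega> m nonneg by simp
        then show ?thesis using negsemidef[of "\<tau> t"] by linarith
      qed
      have sdn: "\<bar>sd\<bar> \<le> norm (\<sigma> t)" using Cauchy_Schwarz_ineq2[of "\<sigma> t" ed] norm_ed by (simp add: sd_def)
      have "\<bar>sd * ((Ex - Ey) \<bullet> ed)\<bar> \<le> norm (\<sigma> t) * (\<eta> * S)"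
        unfolding abs_mult using sdn inner_le_of_norm[OF e(1), of ed] norm_ed
        by (intro mult_mono) (auto simp: inner_commute)
      moreover have "norm (\<sigma> t) * (\<eta> * S) \<le> S * (\<eta> * S)" "norm (\<tau> t) * (\<eta> * S) \<le> S * (\<eta> * S)"
        using \<eta> by (auto intro!: mult_right_mono simp: S_def)
      moreover have "\<bar>\<sigma> t \<bullet> (Ex - Ey)\<bar> \<le> norm (\<sigma> t) * (\<eta> * S)" "\<bar>\<tau> t \<bullet> (Ex + Ey)\<bar> \<le> norm (\<tau> t) * (\<eta> * S)"
        using inner_le_of_norm[OF e(1), of "\<sigma> t"] inner_le_of_norm[OF e(2), of "\<tau> t"] by (auto simp: mult.commute)
      moreover have "norm (\<sigma> t) * (\<eta> * S) + norm (\<tau> t) * (\<eta> * S) = S * (\<eta> * S)"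
        by (simp add: S_def algebra_simps)
      ultimately have err: "8 * (sd * ((Ex - Ey) \<bullet> ed)) - 2 * (\<sigma> t \<bullet> (Ex - Ey)) - 2 * (\<tau> t \<bullet> (Ex + Ey)) \<ge> - 10 * (S * (\<eta> * S))"
        by linarith
      have "S\<^sup>2 \<le> 2 * (s2 + T2)"
        unfolding S_def n2[symmetric] using sum_squares_bound[of "norm (\<sigma> t)" "norm (\<tau> t)"] by (simp add: power2_sum)
      then have "10 * (S * (\<eta> * S)) \<le> 20 * \<eta> * (s2 + T2)"
        using mult_left_mono[of "S\<^sup>2" "2 * (s2 + T2)" "10 * \<eta>"] \<eta> by (simp add: power2_eq_square algebra_simps)
      then have err2: "10 * (S * (\<eta> * S)) \<le> (g - g2) * (s2 + T2)" unfolding \<eta>(2) .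
      have "h' t \<ge> 8 * (g * sd\<^sup>2) - 2 * (g * sd\<^sup>2 + g2 * (s2 - sd\<^sup>2)) - (g - g2) * (s2 + T2)"
        unfolding h'_def sd_def[symmetric] mult.assoc 1 2 3 using err err2 4 5 by (simp add: distrib_left) 
      \<comment> \<open>Splitting off \<open>(g + g2)\<close> times \<open>h\<close> leaves two
        nonnegative terms.\<close>
      moreover have "8 * (g * sd\<^sup>2) - 2 * (g * sd\<^sup>2 + g2 * (s2 - sd\<^sup>2)) - (g - g2) * (s2 + T2)
          = (g + g2) * (4 * sd\<^sup>2 - s2 - T2) + 2 * ((g - g2) * sd\<^sup>2) + 2 * (g2 * T2)"
        by (simp add: algebra_simps)
      moreover have "(g - g2) * sd\<^sup>2 \<ge> 0" "g2 * T2 \<ge> 0" using g nonneg by auto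
      ultimately show ?thesis unfolding h_def sd_def[symmetric] s2_def[symmetric] T2_def[symmetric] by linarith
    qed
    have h0: "h 0 > 0"
    proof -
      \<comment> \<open>With equal second components \<sigma> and \<tau> coincide at time 0, so
        \<open>h 0 > 0\<close> is precisely the assumed cone inequality.\<close>
      have "\<sigma> 0 = x' 0 - x 0" "\<tau> 0 = x' 0 - x 0" using y0 by (auto simp: \<sigma>_def \<tau>_def \<delta>x_def \<delta>y_def)
      then show ?thesis using init by (simp add: h_def power2_norm_eq_inner)
    qed
    have h_le: "h t \<le> 4 * (4 * \<epsilon> / (\<mu> - m))\<^sup>2" if t: "t \<ge> 0" for t
    proof -
      have "(\<sigma> t \<bullet> ed)\<^sup>2 \<le> (4 * \<epsilon> / (\<mu> - m))\<^sup>2"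
        using \<sigma>d[OF t] \<epsilon> \<mu>m by (subst abs_le_square_iff[symmetric]) auto
      moreover have "\<sigma> t \<bullet> \<sigma> t \<ge> 0" "\<tau> t \<bullet> \<tau> t \<ge> 0" by auto
      ultimately show ?thesis unfolding h_def by linarith
    qed
    define M where "M = 4 * (4 * \<epsilon> / (\<mu> - m))\<^sup>2"
    \<comment> \<open>By this time even the linear lower bound of the exponential carries
      \<open>h\<close> beyond \<open>M\<close>.\<close>
    define T where "T = M / (h 0 * (g + g2))"
    have T: "T \<ge> 0" "h 0 * ((g + g2) * T) = M" using h0 g by (auto simp: T_def M_def)
    have "h 0 * (1 + (g + g2) * T) \<le> h 0 * exp ((g + g2) * T)"
      using h0 by (intro mult_left_mono exp_ge_add_one_self) auto
    also have "\<dots> \<le> h T"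
      by (rule exponential_growth_while_positive[OF dh h'_ge h0 T(1)])
    also have "\<dots> \<le> M" unfolding M_def by (rule h_le[OF T(1)])
    finally show False using T(2) h0 by (simp add: distrib_left)
  qed
qed

section \<open>Almost everywhere convergence\<close>

abbreviation unit_pairs :: "((real^'n) \<times> (real^'n)) set" where
  "unit_pairs \<equiv> sphere 0 1 \<times> sphere 0 1"

abbreviation flow :: "(real^'n) \<times> (real^'n) \<Rightarrow> real \<Rightarrow> (real^'n) \<times> (real^'n)" where
  "flow \<equiv> ode_flow (clamped_field \<beta> V)"

lemma compact_unit_pairs: "compact unit_pairs"
  by (intro compact_Times compact_sphere)

lemma clamped_solution_unit:
  assumes der: "\<And>t. t \<ge> 0 \<Longrightarrow> (z has_vector_derivative s *\<^sub>R clamped_field \<beta> V (z t)) (at t within {0..})"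
    and z0: "z 0 \<in> unit_pairs" and t: "t \<ge> 0"
  shows "z t \<in> unit_pairs"
proof -
  note comps = bounded_linear.has_vector_derivative[OF bounded_linear_fst der]
    bounded_linear.has_vector_derivative[OF bounded_linear_snd der]
  have "norm (fst (z t)) = 1"
    by (rule clamped_unit_norm[where s = s and y = "\<lambda>t. snd (z t)" and \<beta> = \<beta> and V = V, OF _ _ t])
       (use comps z0 in \<open>auto simp: clamped_field_def pair_field_def clamp_pair_def mem_Times_iff\<close>)
  moreover have "norm (snd (z t)) = 1"
    by (rule clamped_unit_norm[where s = s and y = "\<lambda>t. fst (z t)" and \<beta> = \<beta> and V = V, OF _ _ t])
       (use comps z0 in \<open>auto simp: clamped_field_def pair_field_def clamp_pair_def mem_Times_iff\<close>)
  ultimately show ?thesis by (simp add: mem_Times_iff)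
qed

lemma clamped_lipschitz_field: "\<exists>L. lipschitz_field (clamped_field \<beta> V) L"
  using clamped_field_lipschitz[of \<beta> V] unfolding lipschitz_field_def by blast

lemma flow_unit:
  assumes "z \<in> unit_pairs" "t \<ge> 0"
  shows "flow z t \<in> unit_pairs"
proof -
  obtain L where "lipschitz_field (clamped_field \<beta> V) L" using clamped_lipschitz_field by blast
  then interpret lipschitz_field "clamped_field \<beta> V" L .
  show ?thesis
    by (rule clamped_solution_unit[where s = 1]) (use assms flow_deriv in \<open>auto simp: flow_0\<close>)
qed

lemma clamped_field_unit: "z \<in> unit_pairs \<Longrightarrow> clamped_field \<beta> V z = pair_field \<beta> V z"
  by (simp add: clamped_field_def clamp_pair_unit mem_Times_iff)

lemma flow_attn_solution:
  assumes "z \<in> unit_pairs"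
  shows "attn_solution \<beta> V (\<lambda>t. fst (flow z t)) (\<lambda>t. snd (flow z t))"
proof -
  obtain L where "lipschitz_field (clamped_field \<beta> V) L" using clamped_lipschitz_field by blast
  then interpret lipschitz_field "clamped_field \<beta> V" L .
  show ?thesis unfolding attn_solution_def
  proof (intro allI impI)
    fix t :: real assume t: "t \<ge> 0"
    have "(flow z has_vector_derivative pair_field \<beta> V (flow z t)) (at t within {0..})"
      using flow_deriv[OF t, of z] clamped_field_unit[OF flow_unit[OF assms t]] by simp
    from bounded_linear.has_vector_derivative[OF bounded_linear_fst this]
      bounded_linear.has_vector_derivative[OF bounded_linear_snd this]
    show "((\<lambda>t. fst (flow z t)) has_vector_derivative attn_field \<beta> V (fst (flow z t)) (snd (flow z t))) (at t within {0..}) \<and>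
      ((\<lambda>t. snd (flow z t)) has_vector_derivative attn_field \<beta> V (snd (flow z t)) (fst (flow z t))) (at t within {0..})"
      by (simp add: pair_field_def)
  qed
qed

lemma attn_solution_pair:
  assumes "attn_solution \<beta> V x y" "t \<ge> 0"
  shows "((\<lambda>t. (x t, y t)) has_vector_derivative pair_field \<beta> V (x t, y t)) (at t within {0..})"
  using assms unfolding attn_solution_def pair_field_def by (auto intro!: has_vector_derivative_Pair)

lemma attn_solution_unit:
  assumes "attn_solution \<beta> V x y" "(x 0, y 0) \<in> unit_pairs" "t \<ge> 0"
  shows "norm (x t) = 1" "norm (y t) = 1"
  using attn_solution_unit_norm[OF assms(1) _ assms(3)] attn_solution_unit_norm[OF attn_solution_commute[OF assms(1)] _ assms(3)] assms(2)
  by auto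

text \<open>Solutions from unit data stay on the sphere, where clamping is the identity; uniqueness
  for the clamped field therefore reduces statements about all solutions to one flow.\<close>

lemma attn_solution_eq_flow:
  assumes sol: "attn_solution \<beta> V x y" and z: "(x 0, y 0) \<in> unit_pairs" and t: "t \<ge> 0"
  shows "(x t, y t) = flow (x 0, y 0) t"
proof -
  obtain L where "lipschitz_field (clamped_field \<beta> V) L" using clamped_lipschitz_field by blast
  then interpret lipschitz_field "clamped_field \<beta> V" L .
  show ?thesis
  proof (rule flow_unique[OF _ t])
    fix t :: real assume t: "t \<ge> 0"
    have "clamped_field \<beta> V (x t, y t) = pair_field \<beta> V (x t, y t)"
      using attn_solution_unit[OF sol z t] by (intro clamped_field_unit) simp
    then show "((\<lambda>t. (x t, y t)) has_vector_derivative clamped_field \<beta> V (x t, y t)) (at t within {0..})"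
      using attn_solution_pair[OF sol t] by simp
  qed
qed

section \<open>Asymptotics of a single solution\<close>

text \<open>Barbalat's lemma for the energy. On the sphere the exponentials are bounded below, so
  the energy rate dominates a multiple of the squared speed, and this multiple is Lipschitz in time
  because the field is bounded and Lipschitz.\<close>

lemma pair_field_tendsto_0:
  assumes sol: "attn_solution \<beta> V x y" and z: "(x 0, y 0) \<in> unit_pairs"
  shows "((\<lambda>t. pair_field \<beta> V (x t, y t)) \<longlongrightarrow> 0) at_top"
proof -
  note unit = attn_solution_unit[OF sol z]
  have U: "(x t, y t) \<in> unit_pairs" if "t \<ge> 0" for t using unit[OF that] by simp
  obtain K where K: "K > 0" "\<And>u v. norm u = 1 \<Longrightarrow> norm v = 1 \<Longrightarrow> \<bar>u \<bullet> (V *v v)\<bar> \<le> K"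
    using form_bounded by blast
  have bU: "bounded unit_pairs" by (rule compact_imp_bounded[OF compact_unit_pairs])
  have exp_bounds: "exp (- \<beta> * K) \<le> exp (\<beta> * (u \<bullet> (V *v v)))" "exp (\<beta> * (u \<bullet> (V *v v))) \<le> exp (\<beta> * K)"
    if "norm u = 1" "norm v = 1" for u v
  proof -
    have "- K \<le> u \<bullet> (V *v v)" "u \<bullet> (V *v v) \<le> K" using K(2)[OF that] by auto
    then show "exp (- \<beta> * K) \<le> exp (\<beta> * (u \<bullet> (V *v v)))" "exp (\<beta> * (u \<bullet> (V *v v))) \<le> exp (\<beta> * K)"
      using beta_pos mult_left_mono[of "- K" "u \<bullet> (V *v v)" \<beta>] by auto
  qed
  define c where "c = 2 * \<beta> * exp (- \<beta> * K)"
  have c: "c > 0" using beta_pos by (simp add: c_def)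
  define q where "q z = c * (pair_field \<beta> V z \<bullet> pair_field \<beta> V z)" for z
  have blq: "bounded_lipschitz_on unit_pairs q"
    unfolding q_def
    by (intro bounded_lipschitz_on_bilinear[OF bounded_bilinear_mult] bounded_lipschitz_on_const
        bounded_lipschitz_on_bilinear[OF bounded_bilinear_inner] bounded_lipschitz_on_pair_field bU)
  obtain L1 where L1: "L1 > 0" "\<And>z w. z \<in> unit_pairs \<Longrightarrow> w \<in> unit_pairs \<Longrightarrow> norm (q z - q w) \<le> L1 * norm (z - w)"
    using bounded_lipschitz_onE[OF blq] by metis
  obtain M where M: "M > 0" "\<And>z. z \<in> unit_pairs \<Longrightarrow> norm (pair_field \<beta> V z) \<le> M"
    using bounded_lipschitz_onE[OF bounded_lipschitz_on_pair_field[OF bU]] by metis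
  have zlip: "norm ((x s, y s) - (x t, y t)) \<le> M * norm (s - t)" if "s \<ge> 0" "t \<ge> 0" for s t
  proof (rule differentiable_bound[where S = "{0..}" and f' = "\<lambda>t h. h *\<^sub>R pair_field \<beta> V (x t, y t)"])
    show "((\<lambda>t. (x t, y t)) has_derivative (\<lambda>h. h *\<^sub>R pair_field \<beta> V (x t, y t))) (at t within {0..})"
      if "t \<in> {0..}" for t
      using attn_solution_pair[OF sol, of t] that by (simp add: has_vector_derivative_def)
    show "onorm (\<lambda>h. h *\<^sub>R pair_field \<beta> V (x t, y t)) \<le> M" if "t \<in> {0..}" for t
      using M(2)[OF U[of t]] that by (intro onorm_le) (auto simp: mult.commute[of M] intro!: mult_left_mono)
  qed (use that in auto)
  have "((\<lambda>t. q (x t, y t)) \<longlongrightarrow> 0) at_top"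
  proof (rule barbalat_lipschitz[where L = "L1 * M" and M = "4 * exp (\<beta> * K)"])
    fix t :: real assume t: "t \<ge> 0"
    note u = unit[OF t]
    show "((\<lambda>t. exp (\<beta> * (x t \<bullet> (V *v x t))) + 2 * exp (\<beta> * (x t \<bullet> (V *v y t))) + exp (\<beta> * (y t \<bullet> (V *v y t))))
    has_real_derivative 2 * \<beta> *
      ((exp (\<beta> * (x t \<bullet> (V *v x t))) + exp (\<beta> * (x t \<bullet> (V *v y t)))) * (norm (attn_field \<beta> V (x t) (y t)))\<^sup>2
     + (exp (\<beta> * (y t \<bullet> (V *v y t))) + exp (\<beta> * (y t \<bullet> (V *v x t)))) * (norm (attn_field \<beta> V (y t) (x t)))\<^sup>2))
    (at t within {0..})" by (rule energy_derivative[OF sol t u])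
    have "q (x t, y t) = 2 * \<beta> * (exp (- \<beta> * K) * (norm (attn_field \<beta> V (x t) (y t)))\<^sup>2 + exp (- \<beta> * K) * (norm (attn_field \<beta> V (y t) (x t)))\<^sup>2)"
      by (simp add: q_def c_def pair_field_def algebra_simps power2_norm_eq_inner)
    also have "\<dots> \<le> 2 * \<beta> *
      ((exp (\<beta> * (x t \<bullet> (V *v x t))) + exp (\<beta> * (x t \<bullet> (V *v y t)))) * (norm (attn_field \<beta> V (x t) (y t)))\<^sup>2
     + (exp (\<beta> * (y t \<bullet> (V *v y t))) + exp (\<beta> * (y t \<bullet> (V *v x t)))) * (norm (attn_field \<beta> V (y t) (x t)))\<^sup>2)"
      using beta_pos exp_bounds(1)[OF u(1) u(1)] exp_bounds(1)[OF u(2) u(2)]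
      by (intro mult_left_mono add_mono mult_right_mono) (auto intro: add_increasing2)
    finally show "q (x t, y t) \<le> 2 * \<beta> *
      ((exp (\<beta> * (x t \<bullet> (V *v x t))) + exp (\<beta> * (x t \<bullet> (V *v y t)))) * (norm (attn_field \<beta> V (x t) (y t)))\<^sup>2
     + (exp (\<beta> * (y t \<bullet> (V *v y t))) + exp (\<beta> * (y t \<bullet> (V *v x t)))) * (norm (attn_field \<beta> V (y t) (x t)))\<^sup>2)" .
    show "0 \<le> q (x t, y t)" using c by (simp add: q_def)
    show "exp (\<beta> * (x t \<bullet> (V *v x t))) + 2 * exp (\<beta> * (x t \<bullet> (V *v y t))) + exp (\<beta> * (y t \<bullet> (V *v y t))) \<le> 4 * exp (\<beta> * K)"
      using exp_bounds(2)[OF u(1) u(1)] exp_bounds(2)[OF u(1) u(2)] exp_bounds(2)[OF u(2) u(2)] by linarith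
  next
    fix s t :: real assume st: "s \<ge> 0" "t \<ge> 0"
    have "\<bar>q (x s, y s) - q (x t, y t)\<bar> \<le> L1 * norm ((x s, y s) - (x t, y t))"
      using L1(2)[OF U[OF st(1)] U[OF st(2)]] by simp
    also have "\<dots> \<le> L1 * (M * \<bar>s - t\<bar>)" using zlip[OF st] L1(1) by (intro mult_left_mono) auto
    finally show "\<bar>q (x s, y s) - q (x t, y t)\<bar> \<le> L1 * M * \<bar>s - t\<bar>" by simp
  qed
  then have "((\<lambda>t. sqrt (q (x t, y t) / c)) \<longlongrightarrow> sqrt (0 / c)) at_top"
    using c by (intro tendsto_intros) auto
  moreover have "sqrt (q w / c) = norm (pair_field \<beta> V w)" for w
    using c by (simp add: q_def norm_eq_sqrt_inner)
  ultimately show ?thesis by (simp add: tendsto_norm_zero_iff)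
qed

text \<open>This turns vanishing velocity into limits of scalar quantities without convergence of
  the solution itself: by compactness, being almost stationary means being close to the set of
  equilibria.\<close>

lemma antipodal_limit_zero:
  fixes g :: "(real^'n) \<times> (real^'n) \<Rightarrow> real"
  assumes sol: "attn_solution \<beta> V x y" and z: "(x 0, y 0) \<in> unit_pairs"
    and g: "continuous_on unit_pairs g"
    and zero: "\<And>u v. norm u = 1 \<Longrightarrow> norm v = 1 \<Longrightarrow> attn_field \<beta> V u v = 0 \<Longrightarrow> attn_field \<beta> V v u = 0 \<Longrightarrow> g (u, v) = 0"
  shows "((\<lambda>t. g (x t, y t)) \<longlongrightarrow> 0) at_top"
proof (rule tendsto_zero_of_zeros_on_compact[where f = "pair_field \<beta> V" and g = g and x = "\<lambda>t. (x t, y t)",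
      OF compact_unit_pairs _ g _ _ pair_field_tendsto_0[OF sol z]])
  show "continuous_on unit_pairs (pair_field \<beta> V)"
    by (intro bounded_lipschitz_on_continuous bounded_lipschitz_on_pair_field compact_imp_bounded compact_unit_pairs)
  show "g w = 0" if "w \<in> unit_pairs" "pair_field \<beta> V w = 0" for w
    using zero[of "fst w" "snd w"] that by (auto simp: pair_field_def mem_Times_iff zero_prod_def)
  show "\<forall>\<^sub>F t in at_top. (x t, y t) \<in> unit_pairs"
    using attn_solution_unit[OF sol z] by (intro eventually_at_top_linorderI[of 0]) auto
qed

text \<open>Near the diagonal the sum of the rates stays below a negative constant, so
  \<open>1 - x t \<bullet> y t\<close> would grow exponentially from a positive value, although it
  never exceeds 2.\<close>

lemma overlap_not_tendsto_1:
  assumes sol: "attn_solution \<beta> V x y" and z: "(x 0, y 0) \<in> unit_pairs" and ne: "x 0 \<noteq> y 0"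
  shows "\<not> ((\<lambda>t. x t \<bullet> y t) \<longlongrightarrow> 1) at_top"
proof
  assume lim: "((\<lambda>t. x t \<bullet> y t) \<longlongrightarrow> 1) at_top"
  note unit = attn_solution_unit[OF sol z]
  have bU: "bounded unit_pairs" by (rule compact_imp_bounded[OF compact_unit_pairs])
  define \<rho> where "\<rho> w = attn_rate \<beta> V (fst w) (snd w) + attn_rate \<beta> V (snd w) (fst w)" for w
  have bl\<rho>: "bounded_lipschitz_on unit_pairs \<rho>"
    unfolding \<rho>_def by (intro bounded_lipschitz_on_add bounded_lipschitz_on_attn_rate bounded_lipschitz_on_fst_snd bU)
  obtain M where M: "M > 0" "\<And>w. w \<in> unit_pairs \<Longrightarrow> norm (\<rho> w) \<le> M"
    using bounded_lipschitz_onE[OF bl\<rho>] by metis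
  define \<nu> where "\<nu> t = 1 - x t \<bullet> y t" for t
  obtain \<nu>' where d\<nu>: "\<And>t. t \<ge> 0 \<Longrightarrow> (\<nu> has_real_derivative \<nu>' t) (at t within {0..})"
    and \<nu>'_ge: "\<And>t. t \<ge> 0 \<Longrightarrow> \<nu>' t \<ge> - \<rho> (x t, y t) * \<nu> t"
  proof -
    have "\<forall>t\<in>{0..}. \<exists>D. (\<nu> has_real_derivative D) (at t within {0..}) \<and> D \<ge> - \<rho> (x t, y t) * \<nu> t"
      using overlap_derivative[OF sol] unfolding \<nu>_def \<rho>_def by auto
    then obtain D where "\<forall>t\<in>{0..}. (\<nu> has_real_derivative D t) (at t within {0..}) \<and> D t \<ge> - \<rho> (x t, y t) * \<nu> t"
      by metis
    then show ?thesis by (intro that[of D]) auto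
  qed
  have \<nu>_ge0: "\<nu> t \<ge> 0" and \<nu>_le: "\<nu> t \<le> 2" if "t \<ge> 0" for t
    using Cauchy_Schwarz_ineq2[of "x t" "y t"] unit[OF that] by (auto simp: \<nu>_def)
  have "x 0 \<bullet> y 0 \<noteq> 1" using unit_vectors_inner_eq_1[of "x 0" "y 0"] unit[of 0] ne by auto
  then have \<nu>0: "\<nu> 0 > 0" using \<nu>_ge0[of 0] by (simp add: \<nu>_def)
  \<comment> \<open>A solution starting off the diagonal never reaches it: the rates are bounded, so
    \<open>\<nu>\<close> decays at most exponentially. The growth after time \<open>T\<close> needs
    this positive starting value.\<close>
  have \<nu>pos: "\<nu> t > 0" if t: "t \<ge> 0" for t
  proof -
    have "\<nu> t \<ge> \<nu> 0 * exp (- M * t)"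
    proof (rule exponential_lower_bound[OF _ _ t])
      show "(\<nu> has_real_derivative \<nu>' s) (at s within {0..t})" if "s \<in> {0..t}" for s
        by (rule has_field_derivative_subset[OF d\<nu>]) (use that in auto)
      show "- M * \<nu> s \<le> \<nu>' s" if "s \<in> {0..t}" for s
      proof -
        have "\<rho> (x s, y s) * \<nu> s \<le> M * \<nu> s"
          using M(2)[of "(x s, y s)"] unit[of s] that \<nu>_ge0[of s] by (intro mult_right_mono) auto
        then show ?thesis using \<nu>'_ge[of s] that by auto
      qed
    qed
    then show ?thesis using \<nu>0 by (smt (verit) exp_gt_zero mult_pos_pos)
  qed
  have "\<exists>k>0. \<forall>u. norm u = 1 \<longrightarrow> u \<bullet> (V *v u) \<le> - k"
  proof -
    have cont: "continuous_on (sphere 0 1) (\<lambda>u. u \<bullet> (V *v u))"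
      by (intro continuous_intros linear_continuous_on matrix_vector_mul_bounded_linear)
    have "ed \<in> sphere 0 1" using norm_ed by simp
    then obtain w where w: "w \<in> sphere 0 1" "\<And>u. u \<in> sphere 0 1 \<Longrightarrow> u \<bullet> (V *v u) \<le> w \<bullet> (V *v w)"
      using continuous_attains_sup[OF compact_sphere _ cont] by blast
    then show ?thesis using negdef_unit[of w] by (intro exI[of _ "- (w \<bullet> (V *v w))"]) auto
  qed
  then obtain k where k: "k > 0" "\<And>u. norm u = 1 \<Longrightarrow> u \<bullet> (V *v u) \<le> - k" by blast
  \<comment> \<open>On the diagonal both rates equal \<open>x \<bullet> (V *v x) \<le> - k\<close>,
    so an error below \<open>k\<close> still leaves their sum at most \<open>- k\<close>.\<close>
  have "((\<lambda>t. \<rho> (x t, y t) - 2 * (fst (x t, y t) \<bullet> (V *v fst (x t, y t)))) \<longlongrightarrow> 0) at_top"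
  proof (rule tendsto_zero_of_zeros_on_compact[where f = "\<lambda>w. 1 - fst w \<bullet> snd w"
        and g = "\<lambda>w. \<rho> w - 2 * (fst w \<bullet> (V *v fst w))" and x = "\<lambda>t. (x t, y t)", OF compact_unit_pairs])
    show "continuous_on unit_pairs (\<lambda>w. 1 - fst w \<bullet> snd w)" by (intro continuous_intros)
    show "continuous_on unit_pairs (\<lambda>w. \<rho> w - 2 * (fst w \<bullet> (V *v fst w)))"
      by (intro continuous_intros bounded_lipschitz_on_continuous[OF bl\<rho>]
          linear_continuous_on_compose[OF _ matrix_vector_mul_linear])
    show "\<rho> w - 2 * (fst w \<bullet> (V *v fst w)) = 0" if "w \<in> unit_pairs" "1 - fst w \<bullet> snd w = 0" for w
      using unit_vectors_inner_eq_1[of "fst w" "snd w"] that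
      by (simp add: \<rho>_def attn_rate_def mem_Times_iff) (simp add: algebra_simps)
    show "\<forall>\<^sub>F t in at_top. (x t, y t) \<in> unit_pairs"
      using unit by (intro eventually_at_top_linorderI[of 0]) auto
    show "((\<lambda>t. 1 - fst (x t, y t) \<bullet> snd (x t, y t)) \<longlongrightarrow> 0) at_top"
      using tendsto_diff[OF tendsto_const[of 1] lim] by simp
  qed
  then have "((\<lambda>t. \<rho> (x t, y t) - 2 * (x t \<bullet> (V *v x t))) \<longlongrightarrow> 0) at_top" by simp
  then have "eventually (\<lambda>t. dist (\<rho> (x t, y t) - 2 * (x t \<bullet> (V *v x t))) 0 < k) at_top"
    by (rule tendstoD[OF _ k(1)])
  then obtain T0 where T0: "\<And>t. t \<ge> T0 \<Longrightarrow> \<bar>\<rho> (x t, y t) - 2 * (x t \<bullet> (V *v x t))\<bar> < k"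
    by (auto simp: eventually_at_top_linorder)
  define T where "T = max T0 0"
  have grow: "\<nu>' t \<ge> k * \<nu> t" if t: "t \<ge> T" for t
  proof -
    have t0: "t \<ge> 0" "t \<ge> T0" using t by (auto simp: T_def)
    have "\<rho> (x t, y t) \<le> - k" using T0[OF t0(2)] k(2)[of "x t"] unit[OF t0(1)] by auto
    then have "k * \<nu> t \<le> - \<rho> (x t, y t) * \<nu> t" using \<nu>_ge0[OF t0(1)] by (intro mult_right_mono) auto
    then show ?thesis using \<nu>'_ge[OF t0(1)] by linarith
  qed
  define s where "s = 2 / (k * \<nu> T)"
  have T: "T \<ge> 0" by (simp add: T_def)
  have s: "s \<ge> 0" "k * s * \<nu> T = 2" using k \<nu>pos[OF T] by (auto simp: s_def)
  have "\<nu> (T + s) \<ge> \<nu> (T + 0) * exp (k * s)"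
  proof (rule exponential_lower_bound[where g = "\<lambda>r. \<nu> (T + r)" and g' = "\<lambda>r. \<nu>' (T + r)", OF _ _ s(1)])
    show "((\<lambda>r. \<nu> (T + r)) has_real_derivative \<nu>' (T + r)) (at r within {0..s})" if "r \<in> {0..s}" for r
    proof -
      have "((\<nu> \<circ> (+) T) has_real_derivative \<nu>' (T + r) * 1) (at r within {0..s})"
        by (rule DERIV_image_chain)
          (use that T in \<open>auto intro!: derivative_eq_intros has_field_derivative_subset[OF d\<nu>]\<close>)
      then show ?thesis by (simp add: o_def)
    qed
    show "k * \<nu> (T + r) \<le> \<nu>' (T + r)" if "r \<in> {0..s}" for r using grow[of "T + r"] that by auto
  qed
  moreover have "\<nu> T * (1 + k * s) \<le> \<nu> T * exp (k * s)"
    using \<nu>pos[OF T] by (intro mult_left_mono exp_ge_add_one_self) auto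
  moreover have "\<nu> T * (1 + k * s) = \<nu> T + 2" using s(2) by (simp add: algebra_simps)
  ultimately show False using \<nu>_le[of "T + s"] \<nu>pos[OF T] T s by auto
qed

text \<open>The form converges to some \<open>- m\<close> with \<open>m\<close> in the finite set
  \<open>\<Lambda>\<close>, and \<open>m\<close> decides the alternative. For
  \<open>m = \<mu>\<close> the spectral gap forces the \<open>ed\<close>-coordinate to 1 or -1;
  every other \<open>m\<close> yields eventual nearness for all \<open>\<epsilon>\<close>.\<close>

lemma solution_dichotomy:
  assumes sol: "attn_solution \<beta> V x y" and z: "(x 0, y 0) \<in> unit_pairs" and ne: "x 0 \<noteq> y 0"
  shows "(\<exists>\<sigma>\<in>{-1, 1}. ((\<lambda>t. (x t, y t)) \<longlongrightarrow> (\<sigma> *\<^sub>R ed, - (\<sigma> *\<^sub>R ed))) at_top)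
    \<or> (\<exists>m\<in>\<Lambda>. 0 < m \<and> m \<le> \<mu>2 \<and> (\<forall>\<epsilon>>0. eventually (\<lambda>t. near_antipodal m \<epsilon> (x t, y t)) at_top))"
proof -
  note unit = attn_solution_unit[OF sol z]
  note cont = attn_solution_continuous[OF sol]
  have unit_ev: "\<forall>\<^sub>F t in at_top. norm (x t) = 1 \<and> norm (y t) = 1"
    using unit by (intro eventually_at_top_linorderI[of 0]) auto
  note Vcont = linear_continuous_on_compose[OF _ matrix_vector_mul_linear]
  have "((\<lambda>t. infdist (x t \<bullet> y t) {-1, 1}) \<longlongrightarrow> 0) at_top"
  proof (rule antipodal_limit_zero[OF sol z, of "\<lambda>w. infdist (fst w \<bullet> snd w) {-1, 1}", simplified fst_conv snd_conv])
    show "continuous_on unit_pairs (\<lambda>w. infdist (fst w \<bullet> snd w) {-1, 1})" by (intro continuous_intros)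
    show "infdist (u \<bullet> v) {-1, 1} = 0"
      if "norm u = 1" "norm v = 1" "attn_field \<beta> V u v = 0" "attn_field \<beta> V v u = 0" for u v
      using equilibrium_inner[OF that] by (intro infdist_zero) auto
  qed
  then have "\<exists>l\<in>{-1, 1}. ((\<lambda>t. x t \<bullet> y t) \<longlongrightarrow> l) at_top"
    by (intro tendsto_of_infdist_finite continuous_intros cont) auto
  then have n: "((\<lambda>t. x t \<bullet> y t) \<longlongrightarrow> - 1) at_top"
    using overlap_not_tendsto_1[OF sol z ne] by auto
  have "((\<lambda>t. sqrt (2 + 2 * (x t \<bullet> y t))) \<longlongrightarrow> sqrt (2 + 2 * (- 1))) at_top"
    by (intro tendsto_intros n)
  moreover have "\<forall>\<^sub>F t in at_top. sqrt (2 + 2 * (x t \<bullet> y t)) = norm (x t + y t)"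
    using unit_ev by eventually_elim
      (simp add: norm_eq_sqrt_inner inner_add_left inner_add_right inner_commute norm_eq_1)
  ultimately have "((\<lambda>t. norm (x t + y t)) \<longlongrightarrow> 0) at_top"
    by (subst (asm) tendsto_cong) auto
  then have xy: "((\<lambda>t. x t + y t) \<longlongrightarrow> 0) at_top" by (simp add: tendsto_norm_zero_iff)
  have "((\<lambda>t. infdist (x t \<bullet> (V *v x t)) (uminus ` \<Lambda>)) \<longlongrightarrow> 0) at_top"
  proof (rule antipodal_limit_zero[OF sol z, of "\<lambda>w. infdist (fst w \<bullet> (V *v fst w)) (uminus ` \<Lambda>)", simplified fst_conv snd_conv])
    show "continuous_on unit_pairs (\<lambda>w. infdist (fst w \<bullet> (V *v fst w)) (uminus ` \<Lambda>))"
      by (intro continuous_intros Vcont)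
    show "infdist (u \<bullet> (V *v u)) (uminus ` \<Lambda>) = 0"
      if eq: "norm u = 1" "norm v = 1" "attn_field \<beta> V u v = 0" "attn_field \<beta> V v u = 0" for u v
    proof (rule infdist_zero)
      have "u \<noteq> 0" using eq(1) by auto
      moreover have "V *v u = - (- (u \<bullet> (V *v u))) *\<^sub>R u" using equilibrium_eigenvector[OF eq] by simp
      ultimately have "- (u \<bullet> (V *v u)) \<in> \<Lambda>" by (rule eigenvalue)
      then show "u \<bullet> (V *v u) \<in> uminus ` \<Lambda>" by (metis image_eqI minus_minus)
    qed
  qed
  moreover have "\<mu> \<in> \<Lambda>" using norm_ed by (intro eigenvalue[OF _ eigen_ed]) auto
  ultimately have "\<exists>l\<in>uminus ` \<Lambda>. ((\<lambda>t. x t \<bullet> (V *v x t)) \<longlongrightarrow> l) at_top"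
    using fin by (intro tendsto_of_infdist_finite continuous_intros cont Vcont) auto
  then obtain m where m: "m \<in> \<Lambda>" "((\<lambda>t. x t \<bullet> (V *v x t)) \<longlongrightarrow> - m) at_top" by auto
  have "((\<lambda>t. norm (V *v x t - (x t \<bullet> (V *v x t)) *\<^sub>R x t)) \<longlongrightarrow> 0) at_top"
  proof (rule antipodal_limit_zero[OF sol z, of "\<lambda>w. norm (V *v fst w - (fst w \<bullet> (V *v fst w)) *\<^sub>R fst w)", simplified fst_conv snd_conv])
    show "continuous_on unit_pairs (\<lambda>w. norm (V *v fst w - (fst w \<bullet> (V *v fst w)) *\<^sub>R fst w))"
      by (intro continuous_intros Vcont)
    show "norm (V *v u - (u \<bullet> (V *v u)) *\<^sub>R u) = 0"
      if "norm u = 1" "norm v = 1" "attn_field \<beta> V u v = 0" "attn_field \<beta> V v u = 0" for u v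
      using equilibrium_eigenvector[OF that] by simp
  qed
  moreover have "((\<lambda>t. \<bar>x t \<bullet> (V *v x t) + m\<bar>) \<longlongrightarrow> \<bar>- m + m\<bar>) at_top"
    by (intro tendsto_intros m)
  ultimately have "((\<lambda>t. norm (V *v x t - (x t \<bullet> (V *v x t)) *\<^sub>R x t) + \<bar>x t \<bullet> (V *v x t) + m\<bar>) \<longlongrightarrow> 0) at_top"
    using tendsto_add by fastforce
  moreover have "\<forall>\<^sub>F t in at_top. norm (V *v x t + m *\<^sub>R x t)
      \<le> norm (V *v x t - (x t \<bullet> (V *v x t)) *\<^sub>R x t) + \<bar>x t \<bullet> (V *v x t) + m\<bar>"
    using unit_ev
  proof eventually_elim
    case (elim t)
    have "V *v x t + m *\<^sub>R x t = (V *v x t - (x t \<bullet> (V *v x t)) *\<^sub>R x t) + (x t \<bullet> (V *v x t) + m) *\<^sub>R x t"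
      by (simp add: algebra_simps)
    also have "norm \<dots> \<le> norm (V *v x t - (x t \<bullet> (V *v x t)) *\<^sub>R x t) + norm ((x t \<bullet> (V *v x t) + m) *\<^sub>R x t)"
      by (rule norm_triangle_ineq)
    finally show ?case using elim by simp
  qed
  ultimately have Vx: "((\<lambda>t. V *v x t + m *\<^sub>R x t) \<longlongrightarrow> 0) at_top"
    by (rule Lim_null_comparison[rotated])
  have "((\<lambda>t. V *v (x t + y t) + m *\<^sub>R (x t + y t) - (V *v x t + m *\<^sub>R x t)) \<longlongrightarrow> V *v 0 + m *\<^sub>R 0 - 0) at_top"
    by (intro tendsto_intros Vx xy bounded_linear.tendsto[OF matrix_vector_mul_bounded_linear])
  then have Vy: "((\<lambda>t. V *v y t + m *\<^sub>R y t) \<longlongrightarrow> 0) at_top"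
    by (simp add: matrix_vector_right_distrib algebra_simps)
  consider "m = \<mu>" | "0 < m" "m \<le> \<mu>2" using \<Lambda>_cases[OF m(1)] by blast
  then show ?thesis
  proof cases
    case 1
    define s where "s t = x t \<bullet> ed" for t
    have "((\<lambda>t. (\<mu> + x t \<bullet> (V *v x t)) / (\<mu> - \<mu>2)) \<longlongrightarrow> (\<mu> + - m) / (\<mu> - \<mu>2)) at_top"
      using gap by (intro tendsto_intros m) auto
    then have lim0: "((\<lambda>t. (\<mu> + x t \<bullet> (V *v x t)) / (\<mu> - \<mu>2)) \<longlongrightarrow> 0) at_top" using 1 by simp
    have "((\<lambda>t. infdist (s t) {-1, 1}) \<longlongrightarrow> 0) at_top"
    proof (rule Lim_null_comparison[OF _ lim0])
      show "\<forall>\<^sub>F t in at_top. norm (infdist (s t) {-1, 1}) \<le> (\<mu> + x t \<bullet> (V *v x t)) / (\<mu> - \<mu>2)"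
        using unit_ev
      proof eventually_elim
        case (elim t)
        have "\<bar>s t\<bar> \<le> 1" using Cauchy_Schwarz_ineq2[of "x t" ed] elim norm_ed by (simp add: s_def)
        then have "(s t)\<^sup>2 \<le> 1" by (simp add: abs_square_le_1)
        \<comment> \<open>By \<open>form_le\<close>, the defect \<open>1 - (s t)\<^sup>2\<close> is
          at most the excess of the form over its minimum \<open>- \<mu>\<close>, divided by the
          gap.\<close>
        have "- (x t \<bullet> (V *v x t)) \<le> \<mu> * (s t)\<^sup>2 + \<mu>2 * (1 - (s t)\<^sup>2)"
          using form_le[of "x t"] elim by (simp add: s_def norm_eq_1)
        then have "(1 - (s t)\<^sup>2) * (\<mu> - \<mu>2) \<le> \<mu> + x t \<bullet> (V *v x t)" by (simp add: algebra_simps)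
        then have "1 - (s t)\<^sup>2 \<le> (\<mu> + x t \<bullet> (V *v x t)) / (\<mu> - \<mu>2)"
          using gap by (simp add: pos_le_divide_eq)
        then show ?case
          using infdist_pm1_le[of "s t"] \<open>(s t)\<^sup>2 \<le> 1\<close> by (simp add: infdist_nonneg)
      qed
    qed
    then have "\<exists>\<sigma>\<in>{-1, 1}. (s \<longlongrightarrow> \<sigma>) at_top"
      unfolding s_def by (intro tendsto_of_infdist_finite continuous_intros cont) auto
    then obtain \<sigma> :: real where \<sigma>: "\<sigma> \<in> {-1, 1}" "(s \<longlongrightarrow> \<sigma>) at_top" by blast
    have \<sigma>2: "\<sigma> * \<sigma> = 1" using \<sigma>(1) by auto
    have "((\<lambda>t. sqrt (2 - 2 * \<sigma> * s t)) \<longlongrightarrow> sqrt (2 - 2 * \<sigma> * \<sigma>)) at_top"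
      by (intro tendsto_intros \<sigma>)
    moreover have "\<forall>\<^sub>F t in at_top. sqrt (2 - 2 * \<sigma> * s t) = norm (x t - \<sigma> *\<^sub>R ed)"
      using unit_ev
    proof eventually_elim
      case (elim t)
      then have "(x t - \<sigma> *\<^sub>R ed) \<bullet> (x t - \<sigma> *\<^sub>R ed) = 2 - 2 * \<sigma> * s t"
        using \<sigma>2 norm_ed by (simp add: inner_diff_left inner_diff_right inner_commute norm_eq_1 s_def)
      then show ?case by (simp add: norm_eq_sqrt_inner)
    qed
    ultimately have "((\<lambda>t. norm (x t - \<sigma> *\<^sub>R ed)) \<longlongrightarrow> 0) at_top"
      using \<sigma>2 by (subst (asm) tendsto_cong) (auto simp: mult.assoc)
    then have "((\<lambda>t. x t - \<sigma> *\<^sub>R ed) \<longlongrightarrow> 0) at_top" by (simp add: tendsto_norm_zero_iff)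
    then have xl: "(x \<longlongrightarrow> \<sigma> *\<^sub>R ed) at_top" by (simp add: LIM_zero_iff)
    then have "((\<lambda>t. (x t + y t) - x t) \<longlongrightarrow> 0 - \<sigma> *\<^sub>R ed) at_top" by (intro tendsto_diff xy)
    then have "(y \<longlongrightarrow> - (\<sigma> *\<^sub>R ed)) at_top" by simp
    then show ?thesis using \<sigma>(1) xl by (intro disjI1 bexI[of _ \<sigma>] tendsto_Pair)
  next
    case 2
    have "eventually (\<lambda>t. near_antipodal m \<epsilon> (x t, y t)) at_top" if \<epsilon>: "\<epsilon> > 0" for \<epsilon>
      using tendstoD[OF xy \<epsilon>] tendstoD[OF Vx \<epsilon>] tendstoD[OF Vy \<epsilon>]
      by eventually_elim (simp add: near_antipodal_def)
    then show ?thesis using 2 m(1) by blast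
  qed
qed

section \<open>Exceptional initial data\<close>

definition trapped :: "real \<Rightarrow> real \<Rightarrow> real \<Rightarrow> ((real^'n) \<times> (real^'n)) set" where
  "trapped m \<epsilon> T = {z \<in> unit_pairs. \<forall>t\<ge>T. near_antipodal m \<epsilon> (flow z t)}"

text \<open>An intersection of closed conditions over all later times; closedness supplies the Borel
  measurability needed for null sets.\<close>

lemma closed_trapped:
  assumes "T \<ge> 0"
  shows "closed (trapped m \<epsilon> T)"
proof -
  obtain L where "lipschitz_field (clamped_field \<beta> V) L" using clamped_lipschitz_field by blast
  then interpret lipschitz_field "clamped_field \<beta> V" L .
  have "closed {z. near_antipodal m \<epsilon> z}"
    unfolding near_antipodal_def
    by (intro closed_Collect_conj closed_Collect_le continuous_intros
        linear_continuous_on_compose[OF _ matrix_vector_mul_linear])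
  then have "closed ((\<lambda>z. flow z t) -` {z. near_antipodal m \<epsilon> z})" if "t \<ge> 0" for t
    using that by (intro closed_vimage flow_continuous)
  then have "closed (unit_pairs \<inter> (\<Inter>t\<in>{T..}. (\<lambda>z. flow z t) -` {z. near_antipodal m \<epsilon> z}))"
    using assms by (intro closed_Int[OF compact_imp_closed[OF compact_unit_pairs]] closed_INT ballI) auto
  moreover have "trapped m \<epsilon> T = unit_pairs \<inter> (\<Inter>t\<in>{T..}. (\<lambda>z. flow z t) -` {z. near_antipodal m \<epsilon> z})"
    by (auto simp: trapped_def)
  ultimately show ?thesis by simp
qed

text \<open>One \<open>\<epsilon>\<close> must serve all \<open>T\<close>, since the time at which a
  solution becomes trapped is not known in advance. The cone argument settles \<open>T = 0\<close>,
  and the backward flow transports the result without changing \<open>\<epsilon>\<close>.\<close>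

lemma negligible_trapped:
  assumes m: "0 < m" "m \<le> \<mu>2"
  shows "\<exists>\<epsilon>>0. \<forall>T\<ge>0. negligible (conic_over (trapped m \<epsilon> T))"
proof -
  obtain L where "lipschitz_field (clamped_field \<beta> V) L" using clamped_lipschitz_field by blast
  then interpret lipschitz_field "clamped_field \<beta> V" L .
  obtain \<epsilon>0 where \<epsilon>0: "\<epsilon>0 > 0" and cone: "\<And>x y x' y'. attn_solution \<beta> V x y \<Longrightarrow> attn_solution \<beta> V x' y' \<Longrightarrow>
     (\<forall>t\<ge>0. norm (x t) = 1 \<and> norm (y t) = 1 \<and> norm (x' t) = 1 \<and> norm (y' t) = 1
        \<and> near_antipodal m \<epsilon>0 (x t, y t) \<and> near_antipodal m \<epsilon>0 (x' t, y' t)) \<Longrightarrow>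
     y 0 = y' 0 \<Longrightarrow> \<not> (norm (x' 0 - x 0))\<^sup>2 < 2 * ((x' 0 - x 0) \<bullet> ed)\<^sup>2"
    using unstable_cone[OF m] by blast
  \<comment> \<open>The second bound yields \<open>\<bar>x \<bullet> ed\<bar> \<le> 1 / 4\<close> on
    the trapped set, as \<open>negligible_conic_over_cone\<close> demands.\<close>
  define \<epsilon> where "\<epsilon> = min \<epsilon>0 ((\<mu> - m) / 4)"
  have \<mu>m: "\<mu> - m > 0" using gap m by simp
  have \<epsilon>: "\<epsilon> > 0" "\<epsilon> \<le> \<epsilon>0" "\<epsilon> \<le> (\<mu> - m) / 4"
    using \<epsilon>0 \<mu>m unfolding \<epsilon>_def by (auto simp del: le_divide_eq_numeral1 intro: min.cobounded2)
  have near_mono: "near_antipodal m \<epsilon> w \<Longrightarrow> near_antipodal m \<epsilon>0 w" for w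
    using \<epsilon>(2) by (auto simp: near_antipodal_def)
  have null0: "negligible (conic_over (trapped m \<epsilon> 0))"
  proof (rule negligible_conic_over_cone[OF borel_closed[OF closed_trapped] norm_ed])
    fix x y assume "(x, y) \<in> trapped m \<epsilon> 0"
    then have "near_antipodal m \<epsilon> (flow (x, y) 0)" by (auto simp: trapped_def)
    then have "norm (V *v x + m *\<^sub>R x) \<le> \<epsilon>" by (simp add: flow_0 near_antipodal_def)
    moreover have "ed \<bullet> (V *v x + m *\<^sub>R x) = - ((\<mu> - m) * (x \<bullet> ed))"
      using sym[of ed x] by (simp add: inner_add_right eigen_ed inner_commute algebra_simps)
    ultimately have "(\<mu> - m) * \<bar>x \<bullet> ed\<bar> \<le> \<epsilon>"
      using inner_le_of_norm[of "V *v x + m *\<^sub>R x" \<epsilon> ed] \<mu>m norm_ed by (simp add: abs_mult)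
    also have "\<dots> \<le> (\<mu> - m) * (1 / 4)" using \<epsilon>(3) by simp
    finally show "\<bar>x \<bullet> ed\<bar> \<le> 1 / 4" using \<mu>m by (simp only: mult_le_cancel_left_pos)
  next
    fix x x' y assume z: "(x, y) \<in> trapped m \<epsilon> 0" and z': "(x', y) \<in> trapped m \<epsilon> 0"
    then have U: "(x, y) \<in> unit_pairs" "(x', y) \<in> unit_pairs" by (auto simp: trapped_def)
    have "\<not> (norm (fst (flow (x', y) 0) - fst (flow (x, y) 0)))\<^sup>2 < 2 * ((fst (flow (x', y) 0) - fst (flow (x, y) 0)) \<bullet> ed)\<^sup>2"
    proof (rule cone[OF flow_attn_solution[OF U(1)] flow_attn_solution[OF U(2)]])
      show "\<forall>t\<ge>0. norm (fst (flow (x, y) t)) = 1 \<and> norm (snd (flow (x, y) t)) = 1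
        \<and> norm (fst (flow (x', y) t)) = 1 \<and> norm (snd (flow (x', y) t)) = 1
        \<and> near_antipodal m \<epsilon>0 (fst (flow (x, y) t), snd (flow (x, y) t))
        \<and> near_antipodal m \<epsilon>0 (fst (flow (x', y) t), snd (flow (x', y) t))"
        using flow_unit[OF U(1)] flow_unit[OF U(2)] z z' near_mono
        by (auto simp: trapped_def mem_Times_iff)
      show "snd (flow (x, y) 0) = snd (flow (x', y) 0)" by (simp add: flow_0)
    qed
    then show "\<not> (norm (x' - x))\<^sup>2 < 2 * ((x' - x) \<bullet> ed)\<^sup>2" by (simp add: flow_0)
  qed simp
  have "negligible (conic_over (trapped m \<epsilon> T))" if T: "T \<ge> 0" for T
  proof -
    interpret bw: lipschitz_field "\<lambda>z. - clamped_field \<beta> V z" L by (rule lipschitz_field_uminus)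
    define \<psi> where "\<psi> w = ode_flow (\<lambda>z. - clamped_field \<beta> V z) w T" for w
    show ?thesis
    proof (rule negligible_conic_over_image[OF null0, of \<psi> _ "exp (L * T)"])
      show "trapped m \<epsilon> 0 \<subseteq> unit_pairs" by (auto simp: trapped_def)
      show "\<psi> ` trapped m \<epsilon> 0 \<subseteq> unit_pairs"
      proof (rule image_subsetI)
        fix w assume "w \<in> trapped m \<epsilon> 0"
        then have w: "w \<in> unit_pairs" by (simp add: trapped_def)
        show "\<psi> w \<in> unit_pairs" unfolding \<psi>_def
        proof (rule clamped_solution_unit[where s = "- 1", OF _ _ T])
          show "(ode_flow (\<lambda>z. - clamped_field \<beta> V z) w has_vector_derivative
            (- 1) *\<^sub>R clamped_field \<beta> V (ode_flow (\<lambda>z. - clamped_field \<beta> V z) w t)) (at t within {0..})"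
            if "t \<ge> 0" for t
            unfolding scaleR_minus1_left by (rule bw.flow_deriv[OF that])
        qed (use w in \<open>simp add: bw.flow_0\<close>)
      qed
      show "trapped m \<epsilon> T \<subseteq> \<psi> ` trapped m \<epsilon> 0"
      proof
        fix w assume w: "w \<in> trapped m \<epsilon> T"
        have "w = \<psi> (flow w T)" unfolding \<psi>_def using backward_flow[OF T, of w] by simp
        moreover have "flow w T \<in> trapped m \<epsilon> 0"
          using w flow_unit[of w T] T flow_add[OF T, of _ w] by (auto simp: trapped_def)
        ultimately show "w \<in> \<psi> ` trapped m \<epsilon> 0" by blast
      qed
      show "norm (\<psi> u - \<psi> w) \<le> exp (L * T) * norm (u - w)" for u w
        unfolding \<psi>_def using bw.flow_distance[OF T, of u w] by (simp add: mult.commute)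
    qed simp
  qed
  then show ?thesis using \<epsilon>(1) by blast
qed

text \<open>Countably many null sets cover the exceptional data: the diagonal and the trapped sets
  for the finitely many \<open>m\<close> and integer times. Integers suffice because trapping from
  time \<open>T\<close> on implies trapping from any later time on.\<close>

theorem almost_every_solution_converges:
  assumes dim: "CARD('n) \<ge> 2"
  shows "AE p in sphere_measure \<Otimes>\<^sub>M sphere_measure.
     (\<exists>x y. x 0 = fst p \<and> y 0 = snd p \<and> attn_solution \<beta> V x y) \<and>
     (\<forall>x y. x 0 = fst p \<and> y 0 = snd p \<and> attn_solution \<beta> V x y \<longrightarrow>
        (\<exists>\<sigma>\<in>{-1, 1}. ((\<lambda>t. (x t, y t)) \<longlongrightarrow> (\<sigma> *\<^sub>R ed, - (\<sigma> *\<^sub>R ed))) at_top))"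
proof -
  obtain L where "lipschitz_field (clamped_field \<beta> V) L" using clamped_lipschitz_field by blast
  then interpret lipschitz_field "clamped_field \<beta> V" L .
  define Q where "Q = {m \<in> \<Lambda>. 0 < m \<and> m \<le> \<mu>2}"
  have "\<forall>m\<in>Q. \<exists>\<epsilon>>0. \<forall>T\<ge>0. negligible (conic_over (trapped m \<epsilon> T))"
    using negligible_trapped by (auto simp: Q_def)
  then obtain \<epsilon> where \<epsilon>: "\<And>m. m \<in> Q \<Longrightarrow> \<epsilon> m > 0"
    "\<And>m T. m \<in> Q \<Longrightarrow> T \<ge> 0 \<Longrightarrow> negligible (conic_over (trapped m (\<epsilon> m) T))"
    by metis
  have "AE p in sphere_measure \<Otimes>\<^sub>M sphere_measure. p \<notin> {p :: (real^'n) \<times> (real^'n). fst p = snd p}"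
    by (intro AE_sphere_product negligible_conic_over_diagonal borel_closed closed_Collect_eq continuous_intros)
       (use dim in simp)
  moreover have "AE p in sphere_measure \<Otimes>\<^sub>M sphere_measure. \<forall>m\<in>Q. \<forall>N::nat. p \<notin> trapped m (\<epsilon> m) (real N)"
  proof (intro AE_ball_countable' allI AE_all_countable[THEN iffD2])
    show "countable Q" using fin by (auto simp: Q_def intro: countable_finite)
    show "AE p in sphere_measure \<Otimes>\<^sub>M sphere_measure. p \<notin> trapped m (\<epsilon> m) (real N)" if "m \<in> Q" for m N
      by (intro AE_sphere_product borel_closed closed_trapped \<epsilon> that) simp_all
  qed
  ultimately show ?thesis
    using AE_space
  proof eventually_elim
    case (elim p)
    then have p: "p \<in> unit_pairs" by (simp add: space_pair_measure space_sphere_measure)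
    show ?case
    proof (intro conjI allI impI)
      show "\<exists>x y. x 0 = fst p \<and> y 0 = snd p \<and> attn_solution \<beta> V x y"
        using flow_attn_solution[OF p]
        by (intro exI[of _ "\<lambda>t. fst (flow p t)"] exI[of _ "\<lambda>t. snd (flow p t)"]) (simp add: flow_0)
      fix x y assume xy: "x 0 = fst p \<and> y 0 = snd p \<and> attn_solution \<beta> V x y"
      then have sol: "attn_solution \<beta> V x y" and p_eq: "(x 0, y 0) = p" and z: "(x 0, y 0) \<in> unit_pairs" and ne: "x 0 \<noteq> y 0"
        using p elim(1) by auto
      have "\<not> eventually (\<lambda>t. near_antipodal m (\<epsilon> m) (x t, y t)) at_top" if m: "m \<in> Q" for m
      proof
        assume "eventually (\<lambda>t. near_antipodal m (\<epsilon> m) (x t, y t)) at_top"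
        then obtain T where T: "\<And>t. t \<ge> T \<Longrightarrow> near_antipodal m (\<epsilon> m) (x t, y t)"
          by (auto simp: eventually_at_top_linorder)
        obtain N :: nat where N: "T \<le> real N" using real_arch_simple by blast
        have "near_antipodal m (\<epsilon> m) (flow p t)" if "t \<ge> real N" for t
          using T[of t] attn_solution_eq_flow[OF sol z, of t] that N p_eq by simp
        then have "p \<in> trapped m (\<epsilon> m) (real N)" using p by (simp add: trapped_def)
        then show False using elim(2) m by blast
      qed
      then show "\<exists>\<sigma>\<in>{-1, 1}. ((\<lambda>t. (x t, y t)) \<longlongrightarrow> (\<sigma> *\<^sub>R ed, - (\<sigma> *\<^sub>R ed))) at_top"
        using solution_dichotomy[OF sol z ne] \<epsilon>(1) unfolding Q_def by blast
    qed
  qed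
qed

end

section \<open>Spectral data of \<open>V\<close> and conclusion\<close>

text \<open>The remainder is orthogonal to all the \<open>e k\<close>, which span the space by a
  dimension count, hence to itself.\<close>

lemma orthonormal_expansion:
  fixes e :: "nat \<Rightarrow> 'a::euclidean_space"
  assumes on: "\<And>i j. i \<in> {1..DIM('a)} \<Longrightarrow> j \<in> {1..DIM('a)} \<Longrightarrow> e i \<bullet> e j = (if i = j then 1 else 0)"
  shows "(\<Sum>k\<in>{1..DIM('a)}. (x \<bullet> e k) *\<^sub>R e k) = x"
proof -
  let ?I = "{1..DIM('a)}"
  have inj: "inj_on e ?I"
    using on by (intro inj_onI) (metis zero_neq_one)
  have "independent (e ` ?I)"
  proof (rule pairwise_orthogonal_independent)
    show "pairwise orthogonal (e ` ?I)"
      using on by (auto simp: pairwise_def orthogonal_def)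
    show "0 \<notin> e ` ?I" using on by (auto simp: image_iff) (metis inner_zero_left zero_neq_one atLeastAtMost_iff)
  qed
  moreover have "card (e ` ?I) = DIM('a)" using card_image[OF inj] by simp
  ultimately have span: "span (e ` ?I) = UNIV"
    using card_ge_dim_independent[of "e ` ?I" UNIV] by (auto simp: dim_UNIV)
  define y where "y = x - (\<Sum>k\<in>?I. (x \<bullet> e k) *\<^sub>R e k)"
  have "y \<bullet> e j = 0" if j: "j \<in> ?I" for j
  proof -
    have "(\<Sum>k\<in>?I. (x \<bullet> e k) * (e k \<bullet> e j)) = (\<Sum>k\<in>?I. if k = j then x \<bullet> e k else 0)"
      by (intro sum.cong) (use on j in auto)
    also have "\<dots> = x \<bullet> e j" using j by simp
    finally show ?thesis by (simp add: y_def inner_diff_left inner_sum_left)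
  qed
  then have "orthogonal y v" if "v \<in> e ` ?I" for v using that by (auto simp: orthogonal_def)
  then have "orthogonal y y" using orthogonal_to_span[of y "e ` ?I" y] span by auto
  then have "y = 0" by (simp add: orthogonal_self)
  then show ?thesis by (simp add: y_def)
qed

theorem theorem6p4:
  fixes \<beta> :: real and V :: "real^'n^'n"
    and e :: "nat \<Rightarrow> real^'n" and lam :: "nat \<Rightarrow> real"
  defines "d \<equiv> CARD('n)"
  assumes dim2: "d \<ge> 2"
    and beta_pos: "\<beta> > 0"
    and symm: "transpose V = V"
    and negdef: "\<And>x. x \<noteq> 0 \<Longrightarrow> x \<bullet> (V *v x) < 0"
    and eigen: "\<And>k. k \<in> {1..d} \<Longrightarrow> V *v e k = lam k *\<^sub>R e k"
    and orthonormal: "\<And>i j. i \<in> {1..d} \<Longrightarrow> j \<in> {1..d} \<Longrightarrow>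
                         e i \<bullet> e j = (if i = j then 1 else 0)"
    and lam1_neg: "lam 1 < 0"
    and lam_ord: "\<And>k. k \<in> {1..<d} \<Longrightarrow> lam k \<ge> lam (Suc k)"
    and simple: "dim {v. V *v v = lam d *\<^sub>R v} = 1"
  shows "AE p in (sphere_measure \<Otimes>\<^sub>M sphere_measure).
     (\<exists>x1 x2 :: real \<Rightarrow> real^'n. x1 0 = fst p \<and> x2 0 = snd p \<and>
        (\<forall>t\<ge>0. (x1 has_vector_derivative attn_field \<beta> V (x1 t) (x2 t)) (at t within {0..}) \<and>
                (x2 has_vector_derivative attn_field \<beta> V (x2 t) (x1 t)) (at t within {0..}))) \<and>
     (\<forall>x1 x2 :: real \<Rightarrow> real^'n. x1 0 = fst p \<and> x2 0 = snd p \<and>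
        (\<forall>t\<ge>0. (x1 has_vector_derivative attn_field \<beta> V (x1 t) (x2 t)) (at t within {0..}) \<and>
                (x2 has_vector_derivative attn_field \<beta> V (x2 t) (x1 t)) (at t within {0..}))
        \<longrightarrow> (\<exists>\<sigma>\<in>{-1, 1::real}.
              ((\<lambda>t. (x1 t, x2 t)) \<longlongrightarrow> (\<sigma> *\<^sub>R e d, - (\<sigma> *\<^sub>R e d))) at_top))"
proof -
  have sym: "x \<bullet> (V *v y) = (V *v x) \<bullet> y" for x y
    using dot_lmul_matrix[of x V y] symm by (metis transpose_matrix_vector)
  have d_in: "d \<in> {1..d}" using dim2 by simp
  have expansion: "(\<Sum>k\<in>{1..d}. (x \<bullet> e k) *\<^sub>R e k) = x" for x
    using orthonormal_expansion[of e x] orthonormal by (simp add: d_def)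
  have unit: "e k \<bullet> e k = 1" if "k \<in> {1..d}" for k using orthonormal[OF that that] by simp
  have inner_expansion: "v \<bullet> v = (\<Sum>k\<in>{1..d}. (v \<bullet> e k)\<^sup>2)" for v
  proof -
    have "v \<bullet> v = v \<bullet> (\<Sum>k\<in>{1..d}. (v \<bullet> e k) *\<^sub>R e k)" by (simp only: expansion)
    then show ?thesis by (simp add: inner_sum_right power2_eq_square)
  qed
  have form_expansion: "v \<bullet> (V *v v) = (\<Sum>k\<in>{1..d}. lam k * (v \<bullet> e k)\<^sup>2)" for v
  proof -
    have "v \<bullet> (V *v v) = (V *v v) \<bullet> (\<Sum>k\<in>{1..d}. (v \<bullet> e k) *\<^sub>R e k)"
      by (simp only: expansion inner_commute)
    also have "\<dots> = (\<Sum>k\<in>{1..d}. (v \<bullet> e k) * (v \<bullet> (V *v e k)))"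
      by (simp add: inner_sum_right sym)
    also have "\<dots> = (\<Sum>k\<in>{1..d}. lam k * (v \<bullet> e k)\<^sup>2)"
      by (intro sum.cong) (simp_all add: eigen power2_eq_square)
    finally show ?thesis .
  qed
  have lam_neg: "lam k < 0" if "k \<in> {1..d}" for k
    using negdef[of "e k"] unit[OF that] eigen[OF that] by (metis inner_scaleR_right inner_zero_left mult.right_neutral zero_neq_one)
  have lam_le: "lam j \<le> lam i" if "1 \<le> i" "i \<le> j" "j \<le> d" for i j
    using that(2,3)
  proof (induction j rule: dec_induct)
    case (step n)
    then show ?case using lam_ord[of n] that(1) by simp
  qed simp
  define \<mu> \<mu>2 where "\<mu> = - lam d" and "\<mu>2 = - lam (d - 1)"
  \<comment> \<open>Were the two values equal, two orthonormal vectors would lie in an eigenspace of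
    dimension 1. The index \<open>d - 1\<close> is legitimate because
    \<open>d \<ge> 2\<close>.\<close>
  have gap: "lam d < lam (d - 1)"
  proof -
    have "lam (d - 1) \<noteq> lam d"
    proof
      assume eq: "lam (d - 1) = lam d"
      have in1: "d - 1 \<in> {1..d}" using dim2 by auto
      have ne: "d - 1 \<noteq> d" using dim2 by auto
      have "e (d - 1) \<noteq> e d"
        using orthonormal[OF in1 d_in] unit[OF d_in] ne by auto
      moreover have "independent {e (d - 1), e d}"
      proof (rule pairwise_orthogonal_independent)
        show "pairwise orthogonal {e (d - 1), e d}"
          using orthonormal[OF in1 d_in] orthonormal[OF d_in in1] ne by (auto simp: pairwise_def orthogonal_def)
        show "0 \<notin> {e (d - 1), e d}" using unit[OF in1] unit[OF d_in] by auto
      qed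
      moreover have "{e (d - 1), e d} \<subseteq> {v. V *v v = lam d *\<^sub>R v}"
        using eigen[OF in1] eigen[OF d_in] eq by auto
      ultimately have "card {e (d - 1), e d} \<le> dim {v. V *v v = lam d *\<^sub>R v}"
        by (intro independent_card_le_dim)
      then have "2 \<le> dim {v. V *v v = lam d *\<^sub>R v}" using \<open>e (d - 1) \<noteq> e d\<close> by simp
      then show False using simple by simp
    qed
    then show ?thesis using lam_le[of "d - 1" d] dim2 by fastforce
  qed
  interpret attn_system \<beta> V "e d" \<mu> \<mu>2 "(\<lambda>k. - lam k) ` {1..d}"
  proof
    show "norm (e d) = 1" using unit[OF d_in] by (simp add: norm_eq_1)
    show "V *v e d = - \<mu> *\<^sub>R e d" using eigen[OF d_in] by (simp add: \<mu>_def)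
    show "\<mu>2 < \<mu>" using gap by (simp add: \<mu>_def \<mu>2_def)
    show "- (v \<bullet> (V *v v)) \<le> \<mu> * (v \<bullet> e d)\<^sup>2 + \<mu>2 * (v \<bullet> v - (v \<bullet> e d)\<^sup>2)" for v
    proof -
      have split: "{1..d} = insert d {1..<d}" using dim2 by auto
      have "- (v \<bullet> (V *v v)) = \<mu> * (v \<bullet> e d)\<^sup>2 + (\<Sum>k\<in>{1..<d}. - lam k * (v \<bullet> e k)\<^sup>2)"
        unfolding form_expansion split by (simp add: \<mu>_def sum_negf)
      also have "\<dots> \<le> \<mu> * (v \<bullet> e d)\<^sup>2 + (\<Sum>k\<in>{1..<d}. \<mu>2 * (v \<bullet> e k)\<^sup>2)"
        using lam_le[of _ "d - 1"] by (intro add_left_mono sum_mono mult_right_mono) (auto simp: \<mu>2_def)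
      also have "(\<Sum>k\<in>{1..<d}. \<mu>2 * (v \<bullet> e k)\<^sup>2) = \<mu>2 * (v \<bullet> v - (v \<bullet> e d)\<^sup>2)"
        unfolding inner_expansion[of v] split by (simp add: sum_distrib_left)
      finally show ?thesis .
    qed
    show "m = \<mu> \<or> 0 < m \<and> m \<le> \<mu>2" if m: "m \<in> (\<lambda>k. - lam k) ` {1..d}" for m
    proof -
      obtain k where k: "k \<in> {1..d}" "m = - lam k" using m by blast
      show ?thesis
      proof (cases "k = d")
        case False
        then have "lam (d - 1) \<le> lam k" using lam_le[of k "d - 1"] k by auto
        then show ?thesis using lam_neg[OF k(1)] k by (simp add: \<mu>2_def)
      qed (simp add: k \<mu>_def)
    qed
    \<comment> \<open>A nonzero \<open>x\<close> has a nonzero coordinate along some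
      \<open>e k\<close>, and symmetry of \<open>V\<close> then equates the two eigenvalues.\<close>
    show "m \<in> (\<lambda>k. - lam k) ` {1..d}" if x: "x \<noteq> 0" and m: "V *v x = - m *\<^sub>R x" for x m
    proof -
      have "\<exists>k\<in>{1..d}. x \<bullet> e k \<noteq> 0"
      proof (rule ccontr)
        assume "\<not> ?thesis"
        then have "x = 0" using expansion[of x] by simp
        then show False using x by simp
      qed
      then obtain k where k: "k \<in> {1..d}" "x \<bullet> e k \<noteq> 0" by blast
      have "lam k * (x \<bullet> e k) = - m * (x \<bullet> e k)"
        using sym[of x "e k"] unfolding eigen[OF k(1)] m by simp
      then have "lam k = - m" using mult_right_cancel[OF k(2)] by blast
      then show ?thesis using k(1) by (metis image_eqI minus_minus)
    qed
  qed (use beta_pos sym negdef in auto)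
  show ?thesis
    using almost_every_solution_converges dim2 unfolding d_def attn_solution_def by simp
qed

end
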